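(* Let $s\in(0,1)$, $n>2s$, let $\Omega\subset\mathbb{R}^n$ be a bounded domain with smooth boundary, let $A\in L^\infty_{loc}(\mathbb{R}^n;\mathbb{R}^n)$, and let $p\in(2,2_s^* )$ with $2_s^*=\frac{2n}{n-2s}$. Let $f$ and $M:[0,\infty)\to[0,\infty)$ satisfy the following hypotheses, where $F(\sigma)=\int_0^\sigma f(\tau)\tau\,d\tau$ and $\mathscr{M}(\sigma)=\int_0^\sigma M(\tau)\,d\tau$: (1) $f\in C^1([0,\infty))$, and there exist $C>0$ and $\gamma\ge p$ such that $|F(\sigma)|\le C\sigma^p$ and $f(\sigma)\sigma^2\le pC\sigma^p$ for all $\sigma\ge 0$, and $0<\gamma F(\sigma)\le f(\sigma)\sigma^2$ and $\sigma^2\big(\sigma f'(\sigma)-(p-2)f(\sigma)\big)\ge 0$ for all $\sigma>0$; (2) $M$ is continuous and there exist constants $m_0>0$ and $\theta\in(1,\frac{2_s^*}{2})$ such that $M(\sigma)\ge m_0\sigma^{\theta-1}$ for all $\sigma\in[0,\infty)$; (3) there exists a constant $\mu\in(1,\frac{2_s^*}{2})$ such that $\mu\mathscr{M}(\sigma)\ge M(\sigma)\sigma$ for all $\sigma\in[0,\infty)$; (4) $2\max\{\theta,\mu\}<p<2_s^*$. Let $u=u(t)$ be a solution of $$\begin{cases}u_t+M\left(\|u\|_{X_{0,A}}^2\right)(-\Delta)_A^su=f(|u|)u & \text{in }\Omega\times(0,T),\\ u(x,t)=0 & \text{in }(\mathbb{R}^n\setminus\Omega)\times(0,T),\\ u(x,0)=u_0(x)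 & \text{in }\Omega,\end{cases}$$ with $u_0\in X_{0,A}$ such that $J(u_0)\le d$ and $I(u_0)>0$. If the maximal existence time of $u$ is $T=\infty$, then there exist an increasing sequence $\{t_k\}_{k=1}^\infty$ with $t_k\to\infty$ as $k\to\infty$ and a stationary solution $v\in X_{0,A}$ of the problem such that $u(t_k)\to v$ strongly in $X_{0,A}$ as $k\to\infty$.
   Context: All functions are complex valued; $\mathcal{R}z$ denotes the real part and $\overline{z}$ the complex conjugate of $z\in\mathbb{C}$. Magnetic fractional Laplacian: for $u\in C_0^\infty(\mathbb{R}^n,\mathbb{C})$ and $x\in\mathbb{R}^n$, $$(-\Delta)_A^su(x)=2\lim_{\varepsilon\to0^+}\int_{\mathbb{R}^n\setminus B(x,\varepsilon)}\frac{u(x)-e^{i(x-y)\cdot A(\frac{x+y}{2})}u(y)}{|x-y|^{n+2s}}\,dy.$$ For the problem it is understood in the weak sense given below. Function spaces: for an open set $U\subseteq\mathbb{R}^n$, $H_A^s(U)$ is the space of $u\in L^2(U,\mathbb{C})$ with $$[u]^2_{H_A^s(U)}=\iint_{U\times U}\frac{|u(x)-e^{i(x-y)\cdot A(\frac{x+y}{2})}u(y)|^2}{|x-y|^{n+2s}}\,dx\,dy<\infty,$$ with norm $(\|u\|_{L^2(U)}^2+[u]^2_{H^s_A(U)})^{1/2}$. Set $X_{0,A}=\{u\in H_A^s(\mathbb{R}^n): u=0 \text{ a.e. in }\mathbb{R}^n\setminus\Omega\}$ (also written $X_{0,A}(\Omega)$), with real scalar product $$\langle u,v\rangle_{X_{0,A}}=\mathcal{R}\iint_{\mathbb{R}^{2n}}\frac{\big(u(x)-e^{i(x-y)\cdot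 A(\frac{x+y}{2})}u(y)\big)\overline{\big(v(x)-e^{i(x-y)\cdot A(\frac{x+y}{2})}v(y)\big)}}{|x-y|^{n+2s}}\,dx\,dy$$ and induced norm $\|u\|_{X_{0,A}}=\langle u,u\rangle_{X_{0,A}}^{1/2}$. Functionals: for $u\in X_{0,A}$, $$J(u)=\tfrac12\mathscr{M}(\|u\|_{X_{0,A}}^2)-\int_\Omega F(|u|)\,dx,$$ a $C^1$-functional with $\langle J'(u),\phi\rangle=M(\|u\|_{X_{0,A}}^2)\langle u,\phi\rangle_{X_{0,A}}-\mathcal{R}\int_\Omega f(|u|)u\overline{\phi}\,dx$ for $\phi\in X_{0,A}$. The Nehari functional is $$I(u)=\langle J'(u),u\rangle=M(\|u\|_{X_{0,A}}^2)\|u\|_{X_{0,A}}^2-\int_\Omega f(|u|)|u|^2\,dx,$$ and the mountain pass level is $d=\inf\{J(u): u\in X_{0,A}\setminus\{0\},\ I(u)=0\}$. Solution: $u$ is a solution of the evolution problem on $(0,T)$, $T>0$, if $u\in L^\infty(0,\infty;L^2(\Omega))\cap L^\infty(0,\infty;X_{0,A})\cap C([0,\infty);L^2(\Omega))$ with $u_t\in L^2(0,\infty;L^2(\Omega))$, $u(0)=u_0$, and $$\mathcal{R}\int_0^T\int_\Omega u_t\overline{\phi}\,dx\,dt+\int_0^T M(\|u\|_{X_{0,A}}^2)\langle u,\phi\rangle_{X_{0,A}}\,dt-\mathcal{R}\int_0^T\int_\Omega f(|u|)u\overline{\phi}\,dx\,dt=0\quad\text{for all }\phi\in X_{0,A}.$$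 A global solution is one for which this holds for all $T>0$. Maximal existence time $T=T(u_0)$ of a solution $u=u(t)$: $T=\infty$ if $u(t)\in X_{0,A}$ for all $t\in[0,\infty)$; $T=t_{\max}>0$ if $u(t)\in X_{0,A}$ for $t\in[0,t_{\max})$ and $u(t_{\max})\notin X_{0,A}$. When $T=\infty$, $u$ is a global solution, i.e. $u\in L^\infty(0,\infty;L^2(\Omega))\cap L^\infty(0,\infty;X_{0,A})\cap C([0,\infty);L^2(\Omega))$ with $u_t\in L^2(0,\infty;L^2(\Omega))$, $u(0)=u_0$, and $\mathcal{R}\int_0^S\int_\Omega u_t\overline{\phi}\,dx\,dt+\int_0^S M(\|u\|_{X_{0,A}}^2)\langle u,\phi\rangle_{X_{0,A}}\,dt-\mathcal{R}\int_0^S\int_\Omega f(|u|)u\overline{\phi}\,dx\,dt=0$ for all $\phi\in X_{0,A}$ and every finite $S>0$. Stationary solution: $v\in X_{0,A}$ is a stationary solution of the problem if $\langle J'(v),\phi\rangle=0$ for all $\phi\in X_{0,A}$, i.e. $M(\|v\|_{X_{0,A}}^2)\langle v,\phi\rangle_{X_{0,A}}-\mathcal{R}\int_\Omega f(|v|)v\overline{\phi}\,dx=0$ for all $\phi\in X_{0,A}$. *)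

theory Defs
  imports "HOL-Analysis.Analysis"
begin

text \<open>
  Elements of the function spaces below are represented by functions, not by almost-everywhere
  classes, so norms are seminorms and equalities of elements are read almost everywhere.
  Measurability is Lebesgue measurability, and double integrals over
  \<open>\<real>\<^sup>n \<times> \<real>\<^sup>n\<close> are taken with respect to Lebesgue measure on the product space.
\<close>

primrec Ck_on :: "nat \<Rightarrow> ('a::euclidean_space \<Rightarrow> 'b::euclidean_space) \<Rightarrow> 'a set \<Rightarrow> bool" where
  "Ck_on 0 g U \<longleftrightarrow> continuous_on U g"
| "Ck_on (Suc k) g U \<longleftrightarrow>
     (\<forall>x\<in>U. g differentiable at x) \<and> (\<forall>v. Ck_on k (\<lambda>x. frechet_derivative g (at x) v) U)"

definition smooth_on :: "('a::euclidean_space \<Rightarrow> 'b::euclidean_space) \<Rightarrow> 'a set \<Rightarrow> bool" where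
  "smooth_on g U \<longleftrightarrow> (\<forall>k. Ck_on k g U)"

text \<open>Near each of its points the boundary is straightened by a smooth diffeomorphism that maps
  the domain to one side of a hyperplane.\<close>

definition smooth_boundary :: "(real^'n) set \<Rightarrow> bool" where
  "smooth_boundary \<Omega> \<longleftrightarrow>
     (\<forall>x\<in>frontier \<Omega>. \<exists>U (D :: (real^'n) set) \<Psi> \<Phi> (k::'n).
        open U \<and> x \<in> U \<and> open D \<and> homeomorphism U D \<Psi> \<Phi> \<and> smooth_on \<Psi> U \<and> smooth_on \<Phi> D \<and>
        \<Psi> ` (U \<inter> \<Omega>) = {y \<in> D. y $ k > 0} \<and> \<Psi> ` (U \<inter> frontier \<Omega>) = {y \<in> D. y $ k = 0})"

definition bounded_smooth_domain :: "(real^'n) set \<Rightarrow> bool" where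
  "bounded_smooth_domain \<Omega> \<longleftrightarrow>
     open \<Omega> \<and> connected \<Omega> \<and> \<Omega> \<noteq> {} \<and> bounded \<Omega> \<and> smooth_boundary \<Omega>"

definition Linf_loc :: "(real^'n \<Rightarrow> real^'n) \<Rightarrow> bool" where
  "Linf_loc A \<longleftrightarrow> A \<in> borel_measurable lebesgue \<and>
     (\<forall>K. compact K \<longrightarrow> (\<exists>B. AE x in lebesgue. x \<in> K \<longrightarrow> norm (A x) \<le> B))"

definition L2 :: "(real^'n) set \<Rightarrow> (real^'n \<Rightarrow> complex) set" where
  "L2 U = {u. set_borel_measurable lebesgue U u \<and>
              set_integrable lebesgue U (\<lambda>x. (cmod (u x))\<^sup>2)}"

definition L2_norm :: "(real^'n) set \<Rightarrow> (real^'n \<Rightarrow> complex) \<Rightarrow> real" where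
  "L2_norm U u = sqrt (LINT x:U|lebesgue. (cmod (u x))\<^sup>2)"

definition mag_diff ::
  "(real^'n \<Rightarrow> real^'n) \<Rightarrow> (real^'n \<Rightarrow> complex) \<Rightarrow> real^'n \<Rightarrow> real^'n \<Rightarrow> complex" where
  "mag_diff A u x y = u x - exp (\<i> * of_real ((x - y) \<bullet> A ((x + y) /\<^sub>R 2))) * u y"

definition mag_kernel :: "real \<Rightarrow> real^'n \<Rightarrow> real^'n \<Rightarrow> real" where
  "mag_kernel s x y = norm (x - y) powr (real CARD('n) + 2 * s)"

definition HsA :: "real \<Rightarrow> (real^'n \<Rightarrow> real^'n) \<Rightarrow> (real^'n) set \<Rightarrow> (real^'n \<Rightarrow> complex) set" where
  "HsA s A U = {u \<in> L2 U. set_integrable lebesgue (U \<times> U)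
                  (\<lambda>(x, y). (cmod (mag_diff A u x y))\<^sup>2 / mag_kernel s x y)}"

definition X0A :: "real \<Rightarrow> (real^'n \<Rightarrow> real^'n) \<Rightarrow> (real^'n) set \<Rightarrow> (real^'n \<Rightarrow> complex) set" where
  "X0A s A \<Omega> = {u \<in> HsA s A UNIV. AE x in lebesgue. x \<notin> \<Omega> \<longrightarrow> u x = 0}"

definition X_inner ::
  "real \<Rightarrow> (real^'n \<Rightarrow> real^'n) \<Rightarrow> (real^'n \<Rightarrow> complex) \<Rightarrow> (real^'n \<Rightarrow> complex) \<Rightarrow> real" where
  "X_inner s A u v =
     Re (LINT z|lebesgue. (case z of (x, y) \<Rightarrow>
           mag_diff A u x y * cnj (mag_diff A v x y) / of_real (mag_kernel s x y)))"

definition X_norm :: "real \<Rightarrow> (real^'n \<Rightarrow> real^'n) \<Rightarrow> (real^'n \<Rightarrow> complex) \<Rightarrow> real" where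
  "X_norm s A u = sqrt (X_inner s A u u)"

text \<open>A space is given by its set of elements \<open>V\<close> and its (semi)norm \<open>N\<close>. Strong (Bochner)
  measurability on \<open>I\<close>: almost everywhere limit of simple functions with values in \<open>V\<close>.\<close>

definition strongly_measurable ::
  "real set \<Rightarrow> 'f::minus set \<Rightarrow> ('f \<Rightarrow> real) \<Rightarrow> (real \<Rightarrow> 'f) \<Rightarrow> bool" where
  "strongly_measurable I V N g \<longleftrightarrow>
     (\<exists>\<sigma> :: nat \<Rightarrow> real \<Rightarrow> 'f.
        (\<forall>k. finite (\<sigma> k ` I) \<and> \<sigma> k ` I \<subseteq> V \<and> (\<forall>w. {t \<in> I. \<sigma> k t = w} \<in> sets lebesgue)) \<and>
        (AE t in lebesgue. t \<in> I \<longrightarrow> g t \<in> V \<and> (\<lambda>k. N (\<sigma> k t - g t)) \<longlonglongrightarrow> 0))"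

definition Linf_time ::
  "real set \<Rightarrow> 'f::minus set \<Rightarrow> ('f \<Rightarrow> real) \<Rightarrow> (real \<Rightarrow> 'f) set" where
  "Linf_time I V N = {g. strongly_measurable I V N g \<and>
                        (\<exists>B. AE t in lebesgue. t \<in> I \<longrightarrow> N (g t) \<le> B)}"

definition L2_time ::
  "real set \<Rightarrow> 'f::minus set \<Rightarrow> ('f \<Rightarrow> real) \<Rightarrow> (real \<Rightarrow> 'f) set" where
  "L2_time I V N = {g. strongly_measurable I V N g \<and>
                      set_integrable lebesgue I (\<lambda>t. (N (g t))\<^sup>2)}"

definition C_time ::
  "real set \<Rightarrow> 'f::minus set \<Rightarrow> ('f \<Rightarrow> real) \<Rightarrow> (real \<Rightarrow> 'f) set" where
  "C_time I V N = {g. \<forall>t\<in>I. g t \<in> V \<and> ((\<lambda>r. N (g r - g t)) \<longlongrightarrow> 0) (at t within I)}"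

text \<open>\<open>w = u\<^sub>t\<close> on \<open>(0, \<infinity>)\<close> in the sense of \<open>L\<^sup>2(\<Omega>)\<close>-valued distributions. The identity
  \<open>\<integral> \<psi>' u dt = - \<integral> \<psi> w dt\<close> between Bochner integrals in \<open>L\<^sup>2(\<Omega>)\<close> is expressed by
  pairing both sides with every \<open>h\<close> in \<open>L\<^sup>2(\<Omega>)\<close>.\<close>

definition has_time_derivative ::
  "(real^'n) set \<Rightarrow> (real \<Rightarrow> real^'n \<Rightarrow> complex) \<Rightarrow> (real \<Rightarrow> real^'n \<Rightarrow> complex) \<Rightarrow> bool" where
  "has_time_derivative \<Omega> u w \<longleftrightarrow>
     (\<forall>\<psi> :: real \<Rightarrow> real. smooth_on \<psi> UNIV \<and> (\<exists>a b. 0 < a \<and> (\<forall>t. t \<notin> {a..b} \<longrightarrow> \<psi> t = 0)) \<longrightarrow>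
        (\<forall>h \<in> L2 \<Omega>.
           (LINT t:{0<..}|lebesgue.
              of_real (deriv \<psi> t) * (LINT x:\<Omega>|lebesgue. u t x * cnj (h x))) =
           - (LINT t:{0<..}|lebesgue.
              of_real (\<psi> t) * (LINT x:\<Omega>|lebesgue. w t x * cnj (h x)))))"

definition crit_exp :: "nat \<Rightarrow> real \<Rightarrow> real" where
  "crit_exp n s = 2 * real n / (real n - 2 * s)"

definition F_prim :: "(real \<Rightarrow> real) \<Rightarrow> real \<Rightarrow> real" where
  "F_prim f \<sigma> = integral {0..\<sigma>} (\<lambda>\<tau>. f \<tau> * \<tau>)"

definition M_prim :: "(real \<Rightarrow> real) \<Rightarrow> real \<Rightarrow> real" where
  "M_prim M \<sigma> = integral {0..\<sigma>} M"

definition J_fun ::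
  "real \<Rightarrow> (real^'n \<Rightarrow> real^'n) \<Rightarrow> (real^'n) set \<Rightarrow> (real \<Rightarrow> real) \<Rightarrow> (real \<Rightarrow> real) \<Rightarrow>
   (real^'n \<Rightarrow> complex) \<Rightarrow> real" where
  "J_fun s A \<Omega> M f u =
     1/2 * M_prim M ((X_norm s A u)\<^sup>2) - (LINT x:\<Omega>|lebesgue. F_prim f (cmod (u x)))"

definition J_deriv ::
  "real \<Rightarrow> (real^'n \<Rightarrow> real^'n) \<Rightarrow> (real^'n) set \<Rightarrow> (real \<Rightarrow> real) \<Rightarrow> (real \<Rightarrow> real) \<Rightarrow>
   (real^'n \<Rightarrow> complex) \<Rightarrow> (real^'n \<Rightarrow> complex) \<Rightarrow> real" where
  "J_deriv s A \<Omega> M f u \<phi> =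
     M ((X_norm s A u)\<^sup>2) * X_inner s A u \<phi>
     - Re (LINT x:\<Omega>|lebesgue. of_real (f (cmod (u x))) * u x * cnj (\<phi> x))"

definition I_fun ::
  "real \<Rightarrow> (real^'n \<Rightarrow> real^'n) \<Rightarrow> (real^'n) set \<Rightarrow> (real \<Rightarrow> real) \<Rightarrow> (real \<Rightarrow> real) \<Rightarrow>
   (real^'n \<Rightarrow> complex) \<Rightarrow> real" where
  "I_fun s A \<Omega> M f u =
     M ((X_norm s A u)\<^sup>2) * (X_norm s A u)\<^sup>2
     - (LINT x:\<Omega>|lebesgue. f (cmod (u x)) * (cmod (u x))\<^sup>2)"

definition mp_level ::
  "real \<Rightarrow> (real^'n \<Rightarrow> real^'n) \<Rightarrow> (real^'n) set \<Rightarrow> (real \<Rightarrow> real) \<Rightarrow> (real \<Rightarrow> real) \<Rightarrow> ereal" where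
  "mp_level s A \<Omega> M f =
     Inf {ereal (J_fun s A \<Omega> M f u) | u.
            u \<in> X0A s A \<Omega> \<and> \<not> (AE x in lebesgue. u x = 0) \<and> I_fun s A \<Omega> M f u = 0}"

definition stationary_solution ::
  "real \<Rightarrow> (real^'n \<Rightarrow> real^'n) \<Rightarrow> (real^'n) set \<Rightarrow> (real \<Rightarrow> real) \<Rightarrow> (real \<Rightarrow> real) \<Rightarrow>
   (real^'n \<Rightarrow> complex) \<Rightarrow> bool" where
  "stationary_solution s A \<Omega> M f v \<longleftrightarrow>
     v \<in> X0A s A \<Omega> \<and> (\<forall>\<phi> \<in> X0A s A \<Omega>. J_deriv s A \<Omega> M f v \<phi> = 0)"

definition solution_on ::
  "real \<Rightarrow> (real^'n \<Rightarrow> real^'n) \<Rightarrow> (real^'n) set \<Rightarrow> (real \<Rightarrow> real) \<Rightarrow> (real \<Rightarrow> real) \<Rightarrow>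
   (real^'n \<Rightarrow> complex) \<Rightarrow> real \<Rightarrow> (real \<Rightarrow> real^'n \<Rightarrow> complex) \<Rightarrow> bool" where
  "solution_on s A \<Omega> M f u\<^sub>0 T u \<longleftrightarrow>
     u \<in> Linf_time {0<..} (L2 \<Omega>) (L2_norm \<Omega>) \<and>
     u \<in> Linf_time {0<..} (X0A s A \<Omega>) (X_norm s A) \<and>
     u \<in> C_time {0..} (L2 \<Omega>) (L2_norm \<Omega>) \<and>
     (AE x in lebesgue. x \<in> \<Omega> \<longrightarrow> u 0 x = u\<^sub>0 x) \<and>
     (\<exists>u\<^sub>t \<in> L2_time {0<..} (L2 \<Omega>) (L2_norm \<Omega>).
        has_time_derivative \<Omega> u u\<^sub>t \<and>
        (\<forall>\<phi> \<in> X0A s A \<Omega>.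
           Re (LINT t:{0<..<T}|lebesgue. (LINT x:\<Omega>|lebesgue. u\<^sub>t t x * cnj (\<phi> x)))
           + (LINT t:{0<..<T}|lebesgue. M ((X_norm s A (u t))\<^sup>2) * X_inner s A (u t) \<phi>)
           - Re (LINT t:{0<..<T}|lebesgue. (LINT x:\<Omega>|lebesgue.
                   of_real (f (cmod (u t x))) * u t x * cnj (\<phi> x))) = 0))"

definition global_solution ::
  "real \<Rightarrow> (real^'n \<Rightarrow> real^'n) \<Rightarrow> (real^'n) set \<Rightarrow> (real \<Rightarrow> real) \<Rightarrow> (real \<Rightarrow> real) \<Rightarrow>
   (real^'n \<Rightarrow> complex) \<Rightarrow> (real \<Rightarrow> real^'n \<Rightarrow> complex) \<Rightarrow> bool" where
  "global_solution s A \<Omega> M f u\<^sub>0 u \<longleftrightarrow> (\<forall>S>0. solution_on s A \<Omega> M f u\<^sub>0 S u)"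

definition evolution_solution ::
  "real \<Rightarrow> (real^'n \<Rightarrow> real^'n) \<Rightarrow> (real^'n) set \<Rightarrow> (real \<Rightarrow> real) \<Rightarrow> (real \<Rightarrow> real) \<Rightarrow>
   (real^'n \<Rightarrow> complex) \<Rightarrow> ereal \<Rightarrow> (real \<Rightarrow> real^'n \<Rightarrow> complex) \<Rightarrow> bool" where
  "evolution_solution s A \<Omega> M f u\<^sub>0 T u \<longleftrightarrow>
     (T = \<infinity> \<and> global_solution s A \<Omega> M f u\<^sub>0 u) \<or>
     (\<exists>S>0. T = ereal S \<and> solution_on s A \<Omega> M f u\<^sub>0 S u)"

definition maximal_existence_time ::
  "real \<Rightarrow> (real^'n \<Rightarrow> real^'n) \<Rightarrow> (real^'n) set \<Rightarrow> (real \<Rightarrow> real^'n \<Rightarrow> complex) \<Rightarrow> ereal \<Rightarrow> bool" where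
  "maximal_existence_time s A \<Omega> u T \<longleftrightarrow>
     (T = \<infinity> \<and> (\<forall>t\<ge>0. u t \<in> X0A s A \<Omega>)) \<or>
     (\<exists>\<tau>>0. T = ereal \<tau> \<and> (\<forall>t\<in>{0..<\<tau>}. u t \<in> X0A s A \<Omega>) \<and> u \<tau> \<notin> X0A s A \<Omega>)"

end

theory Submission
  imports Defs "HOL-Complex_Analysis.Great_Picard"
begin

text \<open>
  Because \<open>u\<^sub>t\<close> is square integrable in time, \<open>\<parallel>u\<^sub>t(t)\<parallel>\<close> is small on a set of positive
  measure beyond every \<open>T\<close>. At almost every time of that set the weak equation says that \<open>J'(u(t))\<close>
  is small in the dual space, so that arbitrarily late times yield a bounded Palais-Smale sequence;
  bounded sequences are compact in \<open>L\<^sup>q\<close> for subcritical \<open>q\<close>, and the Kirchhoff coefficient stays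
  away from zero unless the norms vanish, which upgrades weak to strong convergence.

  The exceptional set of times depends on the test function. Separability of the energy space
  is avoided as follows: a strongly measurable \<open>u\<close> returns arbitrarily close to almost each of its
  values on a set of positive measure, hence for each test function at a time where the equation holds.
\<close>

section \<open>Square integrable functions\<close>

text \<open>Weak compactness is not invoked as such. A bounded sequence yields an almost everywhere
  convergent subsequence; Fatou keeps the limit in the energy space, and dominated convergence,
  relaxed by a small multiple of an L1-bounded sequence, turns pointwise limits into limits of the
  energy pairing and of the reaction term. The magnetic phase is handled in two ways. It has modulus
  one, so the Poincare and Sobolev bounds see only moduli and lose it by the diamagnetic inequality.
  Compactness concerns the functions themselves; there the domain is cut into cubes of side
  \<delta>, on which the local bound on \<open>A\<close> keeps the phase within O(\<delta>) of 1,
  and the cube averages form finitely many functionals. In time, the obstacle is that the weak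
  formulation chooses a derivative \<open>u\<^sub>t\<close> separately for each final time; these
  are identified through uniqueness of distributional derivatives before the equation is localized
  at single times. The energy bound on the sequence is the essential bound contained in the notion
  of a global solution.\<close>

definition sq_integrable :: "'a measure \<Rightarrow> ('a \<Rightarrow> complex) \<Rightarrow> bool" where
  "sq_integrable M g \<longleftrightarrow> g \<in> borel_measurable M \<and> integrable M (\<lambda>x. (cmod (g x))\<^sup>2)"

definition l2norm :: "'a measure \<Rightarrow> ('a \<Rightarrow> complex) \<Rightarrow> real" where
  "l2norm M g = sqrt (\<integral>x. (cmod (g x))\<^sup>2 \<partial>M)"

definition l2inner :: "'a measure \<Rightarrow> ('a \<Rightarrow> complex) \<Rightarrow> ('a \<Rightarrow> complex) \<Rightarrow> complex" where
  "l2inner M g h = (\<integral>x. g x * cnj (h x) \<partial>M)"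

lemma sq_integrableD:
  assumes "sq_integrable M g"
  shows "g \<in> borel_measurable M" "integrable M (\<lambda>x. (cmod (g x))\<^sup>2)"
  using assms by (auto simp: sq_integrable_def)

lemma l2norm_nonneg [simp]: "0 \<le> l2norm M g"
  by (simp add: l2norm_def)

lemma l2norm_sq: "(l2norm M g)\<^sup>2 = (\<integral>x. (cmod (g x))\<^sup>2 \<partial>M)"
  by (simp add: l2norm_def)

lemma cmod_diff_sq_le: "(cmod (a - b))\<^sup>2 \<le> 2 * (cmod a)\<^sup>2 + 2 * (cmod b)\<^sup>2"
proof -
  have "(cmod (a - b))\<^sup>2 \<le> (cmod a + cmod b)\<^sup>2"
    by (intro power_mono norm_triangle_ineq4) auto
  also have "\<dots> \<le> 2 * (cmod a)\<^sup>2 + 2 * (cmod b)\<^sup>2"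
    using sum_squares_bound[of "cmod a" "cmod b"] by (simp add: power2_sum)
  finally show ?thesis .
qed

lemma sq_integrable_diff:
  assumes "sq_integrable M g" "sq_integrable M h"
  shows "sq_integrable M (\<lambda>x. g x - h x)"
  unfolding sq_integrable_def
proof
  note [measurable] = sq_integrableD(1)[OF assms(1)] sq_integrableD(1)[OF assms(2)]
  show m: "(\<lambda>x. g x - h x) \<in> borel_measurable M" by measurable
  show "integrable M (\<lambda>x. (cmod (g x - h x))\<^sup>2)"
  proof (rule Bochner_Integration.integrable_bound)
    show "integrable M (\<lambda>x. 2 * (cmod (g x))\<^sup>2 + 2 * (cmod (h x))\<^sup>2)"
      using assms by (auto simp: sq_integrable_def)
  qed (use cmod_diff_sq_le m in \<open>auto simp: borel_measurable_diff\<close>)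
qed

lemma borel_measurable_cnj [measurable]: "cnj \<in> borel_measurable borel"
  by (intro borel_measurable_continuous_onI continuous_intros)

lemma integrable_mult_cnj:
  assumes "sq_integrable M g" "sq_integrable M h"
  shows "integrable M (\<lambda>x. g x * cnj (h x))"
proof (rule Bochner_Integration.integrable_bound)
  note [measurable] = sq_integrableD(1)[OF assms(1)] sq_integrableD(1)[OF assms(2)]
  show "integrable M (\<lambda>x. (cmod (g x))\<^sup>2 + (cmod (h x))\<^sup>2)"
    using assms by (auto simp: sq_integrable_def)
  show "(\<lambda>x. g x * cnj (h x)) \<in> borel_measurable M" by measurable
  have "a * b \<le> a\<^sup>2 + b\<^sup>2" if "0 \<le> a" "0 \<le> b" for a b :: real
    using sum_squares_bound[of a b] mult_nonneg_nonneg[OF that] by linarith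
  then show "AE x in M. norm (g x * cnj (h x)) \<le> norm ((cmod (g x))\<^sup>2 + (cmod (h x))\<^sup>2)"
    by (simp add: norm_mult)
qed

text \<open>Optimizing the weight at \<open>e = sqrt B / sqrt A\<close> turns a weighted Young bound
  into a Cauchy-Schwarz bound. If \<open>A\<close> or \<open>B\<close> vanishes there is no optimal
  weight; a weight reducing the right side to at most \<open>X\<close> then contradicts
  \<open>X > 0\<close>.\<close>

lemma le_sqrt_mult_if_weighted_bound:
  fixes X A B :: real
  assumes "\<And>e. 0 < e \<Longrightarrow> 2 * X \<le> e * A + B / e" and "0 \<le> A" "0 \<le> B"
  shows "X \<le> sqrt A * sqrt B"
proof (cases "X \<le> 0")
  case True
  then show ?thesis using assms by (meson mult_nonneg_nonneg order_trans real_sqrt_ge_zero)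
next
  case False
  then have X: "X > 0" by simp
  consider "A = 0" "B = 0" | "A = 0" "B > 0" | "A > 0" "B = 0" | "A > 0" "B > 0"
    using assms(2,3) by linarith
  then show ?thesis
  proof cases
    case 1
    then show ?thesis using assms(1)[of 1] X by auto
  next
    case 2
    then show ?thesis using assms(1)[of "B / X"] X by (auto simp: field_simps)
  next
    case 3
    then show ?thesis using assms(1)[of "X / A"] X by (auto simp: field_simps)
  next
    case 4
    have e: "sqrt B / sqrt A * A = sqrt A * sqrt B" "B / (sqrt B / sqrt A) = sqrt A * sqrt B"
      using 4 real_sqrt_mult_self[of A] real_sqrt_mult_self[of B] by (auto simp: field_simps)
    show ?thesis using assms(1)[of "sqrt B / sqrt A"] 4 unfolding e by simp
  qed
qed

text \<open>Integrating the pointwise inequality 2ab <= e a^2 + b^2/e leaves the weight free;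
  optimizing it gives Cauchy-Schwarz.\<close>

lemma norm_l2inner_le:
  assumes "sq_integrable M g" "sq_integrable M h"
  shows "cmod (l2inner M g h) \<le> l2norm M g * l2norm M h"
  unfolding l2norm_def
proof (rule le_sqrt_mult_if_weighted_bound)
  fix e :: real assume e: "0 < e"
  have int: "integrable M (\<lambda>x. (cmod (g x))\<^sup>2)" "integrable M (\<lambda>x. (cmod (h x))\<^sup>2)"
    using assms by (auto simp: sq_integrable_def)
  have "2 * (a * b) \<le> e * a\<^sup>2 + b\<^sup>2 / e" for a b :: real
  proof -
    have "0 \<le> (e * a - b)\<^sup>2 / e" using e by simp
    also have "\<dots> = e * a\<^sup>2 + b\<^sup>2 / e - 2 * (a * b)"
      using e by (simp add: power2_diff field_simps power2_eq_square)
    finally show ?thesis by simp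
  qed
  then have *: "2 * cmod (g x * cnj (h x)) \<le> e * (cmod (g x))\<^sup>2 + (cmod (h x))\<^sup>2 / e" for x
    by (simp add: norm_mult)
  have "2 * cmod (l2inner M g h) \<le> 2 * (\<integral>x. cmod (g x * cnj (h x)) \<partial>M)"
    unfolding l2inner_def by (simp add: integral_norm_bound)
  also have "\<dots> = (\<integral>x. 2 * cmod (g x * cnj (h x)) \<partial>M)" by simp
  also have "\<dots> \<le> (\<integral>x. e * (cmod (g x))\<^sup>2 + (cmod (h x))\<^sup>2 / e \<partial>M)"
    using * int integrable_mult_cnj[OF assms] by (intro integral_mono) auto
  also have "\<dots> = e * (\<integral>x. (cmod (g x))\<^sup>2 \<partial>M) + (\<integral>x. (cmod (h x))\<^sup>2 \<partial>M) / e"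
    using int by simp
  finally show "2 * cmod (l2inner M g h) \<le>
      e * (\<integral>x. (cmod (g x))\<^sup>2 \<partial>M) + (\<integral>x. (cmod (h x))\<^sup>2 \<partial>M) / e" .
qed auto

lemma l2inner_diff_left:
  assumes "sq_integrable M f" "sq_integrable M g" "sq_integrable M h"
  shows "l2inner M (\<lambda>x. f x - g x) h = l2inner M f h - l2inner M g h"
  unfolding l2inner_def
  using integrable_mult_cnj[OF assms(1,3)] integrable_mult_cnj[OF assms(2,3)]
  by (simp add: left_diff_distrib)

lemma l2inner_diff_right:
  assumes "sq_integrable M f" "sq_integrable M g" "sq_integrable M h"
  shows "l2inner M h (\<lambda>x. f x - g x) = l2inner M h f - l2inner M h g"
  unfolding l2inner_def
  using integrable_mult_cnj[OF assms(3,1)] integrable_mult_cnj[OF assms(3,2)]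
  by (simp add: right_diff_distrib)

lemma l2inner_self: "l2inner M g g = of_real ((l2norm M g)\<^sup>2)"
proof -
  have "l2inner M g g = (\<integral>x. complex_of_real ((cmod (g x))\<^sup>2) \<partial>M)"
    unfolding l2inner_def by (simp add: complex_norm_square del: of_real_power)
  also have "\<dots> = of_real (\<integral>x. (cmod (g x))\<^sup>2 \<partial>M)"
    by (rule integral_complex_of_real)
  finally show ?thesis by (simp add: l2norm_sq)
qed

lemma Re_l2inner_commute: "Re (l2inner M g h) = Re (l2inner M h g)"
proof -
  have "l2inner M g h = (\<integral>x. cnj (h x * cnj (g x)) \<partial>M)"
    by (simp add: l2inner_def mult.commute)
  also have "\<dots> = cnj (l2inner M h g)" unfolding l2inner_def by (rule Bochner_Integration.integral_cnj)
  finally show ?thesis by simp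
qed

lemma l2norm_diff_sq:
  assumes "sq_integrable M g" "sq_integrable M h"
  shows "(l2norm M (\<lambda>x. g x - h x))\<^sup>2
    = (l2norm M g)\<^sup>2 + (l2norm M h)\<^sup>2 - 2 * Re (l2inner M g h)"
proof -
  have "complex_of_real ((l2norm M (\<lambda>x. g x - h x))\<^sup>2)
      = l2inner M g g - l2inner M g h - (l2inner M h g - l2inner M h h)"
    unfolding l2inner_self[symmetric]
    using assms by (simp add: l2inner_diff_left l2inner_diff_right sq_integrable_diff)
  then have "Re (complex_of_real ((l2norm M (\<lambda>x. g x - h x))\<^sup>2))
      = Re (l2inner M g g - l2inner M g h - (l2inner M h g - l2inner M h h))" by simp
  then show ?thesis by (simp add: l2inner_self Re_l2inner_commute[of M h g] del: of_real_power)
qed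

lemma l2norm_diff_triangle:
  assumes "sq_integrable M g" "sq_integrable M h"
  shows "l2norm M (\<lambda>x. g x - h x) \<le> l2norm M g + l2norm M h"
proof (rule power2_le_imp_le)
  have "- Re (l2inner M g h) \<le> l2norm M g * l2norm M h"
    using norm_l2inner_le[OF assms] abs_Re_le_cmod[of "l2inner M g h"] by linarith
  then show "(l2norm M (\<lambda>x. g x - h x))\<^sup>2 \<le> (l2norm M g + l2norm M h)\<^sup>2"
    unfolding l2norm_diff_sq[OF assms] by (simp add: power2_sum)
qed simp

lemma l2norm_cong_AE:
  assumes "AE x in M. g x = h x" "g \<in> borel_measurable M" "h \<in> borel_measurable M"
  shows "l2norm M g = l2norm M h"
  unfolding l2norm_def using assms by (intro arg_cong[where f=sqrt] integral_cong_AE) auto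

text \<open>Dominated convergence with an error: truncating \<open>h k\<close> at \<open>D\<close>
  leaves a genuinely dominated sequence, and the excess costs at most \<epsilon> times the bound
  \<open>K\<close>. This serves both L2 pairings, with \<open>P\<close> the squared modulus, and the
  reaction term, with \<open>P\<close> a sum of q-th powers.\<close>

lemma integral_tendsto_0_if_almost_dominated:
  fixes h P :: "nat \<Rightarrow> 'a \<Rightarrow> real"
  assumes meas: "\<And>k. integrable M (h k)"
    and nonneg: "\<And>k. AE x in M. 0 \<le> h k x"
    and lim: "AE x in M. (\<lambda>k. h k x) \<longlonglongrightarrow> 0"
    and P: "\<And>k. integrable M (P k)" "\<And>k. (\<integral>x. P k x \<partial>M) \<le> K"
    and dom: "\<And>\<epsilon>. 0 < \<epsilon> \<Longrightarrow> \<exists>D. integrable M D \<and> (\<forall>k. AE x in M. 0 \<le> P k x \<and> h k x \<le> D x + \<epsilon> * P k x)"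
  shows "(\<lambda>k. \<integral>x. h k x \<partial>M) \<longlonglongrightarrow> 0"
proof (rule LIMSEQ_I)
  fix r :: real assume r: "0 < r"
  \<comment> \<open>Half of \<open>r\<close> divided by a positive majorant of \<open>K\<close>, so
    the excess accounts for at most \<open>r / 2\<close> whatever the sign of
    \<open>K\<close>.\<close>
  define \<epsilon> where "\<epsilon> = r / (2 * (\<bar>K\<bar> + 1))"
  have eps: "0 < \<epsilon>" "\<epsilon> * K \<le> r / 2"
  proof -
    show "0 < \<epsilon>" using r by (simp add: \<epsilon>_def)
    then have "\<epsilon> * K \<le> \<epsilon> * (\<bar>K\<bar> + 1)" by (intro mult_left_mono) auto
    also have "\<dots> = r / 2" unfolding \<epsilon>_def by (simp add: field_simps)
    finally show "\<epsilon> * K \<le> r / 2" .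
  qed
  obtain D where D: "integrable M D"
    and dom': "\<And>k. AE x in M. 0 \<le> P k x \<and> h k x \<le> D x + \<epsilon> * P k x"
    using dom[OF eps(1)] by blast
  have "(\<lambda>k. \<integral>x. min (h k x) \<bar>D x\<bar> \<partial>M) \<longlonglongrightarrow> (\<integral>x. 0 \<partial>M)"
  proof (rule integral_dominated_convergence[where w="\<lambda>x. \<bar>D x\<bar>"])
    show "AE x in M. (\<lambda>k. min (h k x) \<bar>D x\<bar>) \<longlonglongrightarrow> 0"
      using lim
    proof eventually_elim
      case (elim x)
      from tendsto_min[OF this tendsto_const[of "\<bar>D x\<bar>"]] show ?case by simp
    qed
    show "AE x in M. norm (min (h k x) \<bar>D x\<bar>) \<le> \<bar>D x\<bar>" for k
      using nonneg[of k] by eventually_elim auto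
    show "integrable M (\<lambda>x. \<bar>D x\<bar>)" using D by simp
    show "(\<lambda>x. min (h k x) \<bar>D x\<bar>) \<in> borel_measurable M" for k
      using borel_measurable_integrable[OF meas[of k]] borel_measurable_integrable[OF D] by measurable
  qed simp
  then have "(\<lambda>k. \<integral>x. min (h k x) \<bar>D x\<bar> \<partial>M) \<longlonglongrightarrow> 0" by simp
  then obtain N where N: "\<And>k. k \<ge> N \<Longrightarrow> norm (\<integral>x. min (h k x) \<bar>D x\<bar> \<partial>M) < r / 2"
    using LIMSEQ_D[of _ 0 "r / 2"] r by (auto simp del: real_norm_def)
  show "\<exists>no. \<forall>n\<ge>no. norm ((\<integral>x. h n x \<partial>M) - 0) < r"
  proof (intro exI allI impI)
    fix k assume k: "k \<ge> N"
    have "(\<integral>x. h k x \<partial>M) \<le> (\<integral>x. min (h k x) \<bar>D x\<bar> + \<epsilon> * P k x \<partial>M)"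
    proof (rule integral_mono_AE)
      show "AE x in M. h k x \<le> min (h k x) \<bar>D x\<bar> + \<epsilon> * P k x"
        using dom'[of k]
      proof eventually_elim
        case (elim x)
        moreover have "0 \<le> \<epsilon> * P k x" using elim eps by simp
        ultimately show ?case by linarith
      qed
    next
      show "integrable M (h k)" by (rule meas)
      show "integrable M (\<lambda>x. min (h k x) \<bar>D x\<bar> + \<epsilon> * P k x)"
        by (intro Bochner_Integration.integrable_add integrable_min integrable_mult_right
            integrable_abs meas P D)
    qed
    also have "\<dots> = (\<integral>x. min (h k x) \<bar>D x\<bar> \<partial>M) + \<epsilon> * (\<integral>x. P k x \<partial>M)"
      by (subst Bochner_Integration.integral_add)
        (auto intro!: integrable_min integrable_mult_right integrable_abs meas P D)
    also have "\<dots> \<le> (\<integral>x. min (h k x) \<bar>D x\<bar> \<partial>M) + \<epsilon> * K"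
      using P eps by simp
    finally have "(\<integral>x. h k x \<partial>M) < r" using N[OF k] eps(2) by auto
    moreover have "0 \<le> (\<integral>x. h k x \<partial>M)" using nonneg by (intro integral_nonneg_AE)
    ultimately show "norm ((\<integral>x. h k x \<partial>M) - 0) < r" by simp
  qed
qed

text \<open>Pointwise convergence with bounded L2 norms forces weak convergence: Young's inequality
  dominates the product of the difference with \<open>h\<close> by a multiple of |h|^2 plus
  \<epsilon> times the squared difference, and the differences stay bounded in L2.\<close>

lemma l2inner_tendsto_if_AE_bounded:
  assumes g: "\<And>k. sq_integrable M (g k)" "sq_integrable M g'" "sq_integrable M h"
    and B: "\<And>k. l2norm M (g k) \<le> B"
    and lim: "AE x in M. (\<lambda>k. g k x) \<longlonglongrightarrow> g' x"
  shows "(\<lambda>k. l2inner M (g k) h) \<longlonglongrightarrow> l2inner M g' h"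
proof -
  define d where "d k x = g k x - g' x" for k x
  have d: "sq_integrable M (d k)" for k
    unfolding d_def using sq_integrable_diff[OF g(1,2)] by simp
  have B0: "0 \<le> B" using B[of 0] l2norm_nonneg[of M "g 0"] by linarith
  have "(\<lambda>k. \<integral>x. cmod (d k x * cnj (h x)) \<partial>M) \<longlonglongrightarrow> 0"
  proof (rule integral_tendsto_0_if_almost_dominated[where P="\<lambda>k x. (cmod (d k x))\<^sup>2"
        and K="(B + l2norm M g')\<^sup>2"])
    show "integrable M (\<lambda>x. cmod (d k x * cnj (h x)))" for k
      using integrable_mult_cnj[OF d g(3)] by (rule integrable_norm)
    show "AE x in M. (\<lambda>k. cmod (d k x * cnj (h x))) \<longlonglongrightarrow> 0"
      using lim
    proof eventually_elim
      case (elim x)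
      then have "(\<lambda>k. d k x) \<longlonglongrightarrow> 0" unfolding d_def by (simp add: LIM_zero)
      then show ?case by (intro tendsto_norm_zero tendsto_mult_left_zero)
    qed
    show "integrable M (\<lambda>x. (cmod (d k x))\<^sup>2)" for k using d by (simp add: sq_integrable_def)
    show "(\<integral>x. (cmod (d k x))\<^sup>2 \<partial>M) \<le> (B + l2norm M g')\<^sup>2" for k
      unfolding l2norm_sq[symmetric]
      using l2norm_diff_triangle[OF g(1)[of k] g(2)] B[of k] unfolding d_def
      by (intro power_mono) auto
    fix \<epsilon> :: real assume e: "0 < \<epsilon>"
    show "\<exists>D. integrable M D \<and> (\<forall>k. AE x in M. 0 \<le> (cmod (d k x))\<^sup>2 \<and>
        cmod (d k x * cnj (h x)) \<le> D x + \<epsilon> * (cmod (d k x))\<^sup>2)"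
    proof (intro exI[of _ "\<lambda>x. (cmod (h x))\<^sup>2 / \<epsilon>"] conjI allI)
      show "integrable M (\<lambda>x. (cmod (h x))\<^sup>2 / \<epsilon>)" using g by (simp add: sq_integrable_def)
      have "a * b \<le> b\<^sup>2 / \<epsilon> + \<epsilon> * a\<^sup>2" if "0 \<le> a" "0 \<le> b" for a b :: real
      proof -
        have "0 \<le> (\<epsilon> * a - b)\<^sup>2 / \<epsilon> + a * b" using e that by simp
        also have "\<dots> = b\<^sup>2 / \<epsilon> + \<epsilon> * a\<^sup>2 - a * b"
          using e by (simp add: power2_diff field_simps power2_eq_square)
        finally show ?thesis by simp
      qed
      then show "AE x in M. 0 \<le> (cmod (d k x))\<^sup>2 \<and>
        cmod (d k x * cnj (h x)) \<le> (cmod (h x))\<^sup>2 / \<epsilon> + \<epsilon> * (cmod (d k x))\<^sup>2" for k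
        by (simp add: norm_mult)
    qed
  qed auto
  then have "(\<lambda>k. l2inner M (d k) h) \<longlonglongrightarrow> 0"
    by (rule Lim_null_comparison[rotated]) (auto simp: l2inner_def integral_norm_bound)
  moreover have "l2inner M (d k) h = l2inner M (g k) h - l2inner M g' h" for k
    unfolding d_def using g by (simp add: l2inner_diff_left)
  ultimately show ?thesis by (simp add: LIM_zero_iff)
qed

text \<open>Fatou for the squared moduli; this takes the place of weak closedness of balls.\<close>

lemma sq_integrable_AE_limit:
  assumes g: "\<And>k. sq_integrable M (g k)" and B: "\<And>k. l2norm M (g k) \<le> B"
    and lim: "AE x in M. (\<lambda>k. g k x) \<longlonglongrightarrow> g' x" and [measurable]: "g' \<in> borel_measurable M"
  shows "sq_integrable M g'"
proof -
  have [measurable]: "g k \<in> borel_measurable M" for k using g by (simp add: sq_integrable_def)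
  have B0: "0 \<le> B" using B[of 0] l2norm_nonneg[of M "g 0"] by linarith
  have nn: "(\<integral>\<^sup>+x. ennreal ((cmod (g k x))\<^sup>2) \<partial>M) \<le> ennreal (B\<^sup>2)" for k
    using g[of k] B[of k] power_mono[OF B[of k], of 2]
    by (subst nn_integral_eq_integral) (auto simp: sq_integrable_def l2norm_sq)
  have "(\<integral>\<^sup>+x. ennreal ((cmod (g' x))\<^sup>2) \<partial>M)
      = (\<integral>\<^sup>+x. liminf (\<lambda>k. ennreal ((cmod (g k x))\<^sup>2)) \<partial>M)"
  proof (rule nn_integral_cong_AE)
    show "AE x in M. ennreal ((cmod (g' x))\<^sup>2) = liminf (\<lambda>k. ennreal ((cmod (g k x))\<^sup>2))"
      using lim
    proof eventually_elim
      case (elim x)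
      have "(\<lambda>k. ennreal ((cmod (g k x))\<^sup>2)) \<longlonglongrightarrow> ennreal ((cmod (g' x))\<^sup>2)"
        by (intro tendsto_intros elim)
      then show ?case by (metis lim_imp_Liminf sequentially_bot)
    qed
  qed
  also have "\<dots> \<le> liminf (\<lambda>k. \<integral>\<^sup>+x. ennreal ((cmod (g k x))\<^sup>2) \<partial>M)"
    by (rule nn_integral_liminf) measurable
  also have "\<dots> \<le> ennreal (B\<^sup>2)"
    using nn by (intro Liminf_le) (auto intro: always_eventually)
  finally show ?thesis
    unfolding sq_integrable_def by (auto intro!: integrableI_bounded simp: top.extremum_strict order_le_less_trans)
qed

text \<open>A fast subsequence makes the squared norms of consecutive differences at most 4^-j.
  Weighted by 2^j they remain summable, so the weighted squares are summable at almost every point,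
  and the telescoping series converges there.\<close>

lemma l2_Cauchy_AE_subseq:
  fixes g :: "nat \<Rightarrow> 'a \<Rightarrow> complex"
  assumes g: "\<And>k. sq_integrable M (g k)"
    and cau: "\<And>e. 0 < e \<Longrightarrow> \<exists>N. \<forall>k\<ge>N. \<forall>l\<ge>N. (l2norm M (\<lambda>x. g k x - g l x))\<^sup>2 \<le> e"
  obtains r g' where "strict_mono (r :: nat \<Rightarrow> nat)" "g' \<in> borel_measurable M"
    "AE x in M. (\<lambda>k. g (r k) x) \<longlonglongrightarrow> g' x"
proof -
  have [measurable]: "g k \<in> borel_measurable M" for k using g by (simp add: sq_integrable_def)
  have "\<exists>N. \<forall>k\<ge>N. \<forall>l\<ge>N. (l2norm M (\<lambda>x. g k x - g l x))\<^sup>2 \<le> (1/4) ^ j" for j :: nat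
    by (rule cau) simp
  then obtain N where N: "\<And>j k l. k \<ge> N j \<Longrightarrow> l \<ge> N j \<Longrightarrow>
      (l2norm M (\<lambda>x. g k x - g l x))\<^sup>2 \<le> (1/4) ^ j" by metis
  \<comment> \<open>Summing the thresholds, each raised by one, gives a strictly increasing index
    that lies beyond \<open>N j\<close>.\<close>
  define r where "r j = (\<Sum>i\<le>j. Suc (N i))" for j
  have "strict_mono r" by (rule strict_monoI_Suc) (simp add: r_def)
  have rN: "r j \<ge> N j" "r (Suc j) \<ge> N j" for j
  proof -
    have "Suc (N j) \<le> r j" unfolding r_def by (rule member_le_sum) auto
    then show "r j \<ge> N j" by simp
    moreover have "r j \<le> r (Suc j)" by (simp add: r_def)
    ultimately show "r (Suc j) \<ge> N j" by linarith
  qed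
  define d where "d j x = g (r (Suc j)) x - g (r j) x" for j x
  have d: "sq_integrable M (d j)" for j unfolding d_def using sq_integrable_diff[OF g g] by simp
  have [measurable]: "d j \<in> borel_measurable M" for j using d by (simp add: sq_integrable_def)
  have "(\<integral>\<^sup>+x. (\<Sum>j. ennreal (2 ^ j * (cmod (d j x))\<^sup>2)) \<partial>M)
      = (\<Sum>j. \<integral>\<^sup>+x. ennreal (2 ^ j * (cmod (d j x))\<^sup>2) \<partial>M)"
    by (rule nn_integral_suminf) measurable
  also have "\<dots> \<le> (\<Sum>j. ennreal ((1/2) ^ j))"
  proof (intro suminf_le)
    fix j
    have "(\<integral>\<^sup>+x. ennreal (2 ^ j * (cmod (d j x))\<^sup>2) \<partial>M) = ennreal (2 ^ j * (l2norm M (d j))\<^sup>2)"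
      using d[of j] by (subst nn_integral_eq_integral) (auto simp: sq_integrable_def l2norm_sq)
    also have "\<dots> \<le> ennreal ((1/2) ^ j)"
    proof (rule ennreal_leI)
      have "2 ^ j * (l2norm M (d j))\<^sup>2 \<le> 2 ^ j * (1/4) ^ j"
        using N[OF rN(2) rN(1), of j] unfolding d_def by (intro mult_left_mono) auto
      also have "\<dots> = (1/2 :: real) ^ j" by (simp flip: power_mult_distrib)
      finally show "2 ^ j * (l2norm M (d j))\<^sup>2 \<le> (1/2) ^ j" .
    qed
    finally show "(\<integral>\<^sup>+x. ennreal (2 ^ j * (cmod (d j x))\<^sup>2) \<partial>M) \<le> ennreal ((1/2) ^ j)" .
  qed auto
  also have "\<dots> = ennreal (\<Sum>j. (1/2) ^ j)"
    by (rule suminf_ennreal2) (auto intro: summable_geometric)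
  also have "\<dots> < \<infinity>" by simp
  finally have "AE x in M. (\<Sum>j. ennreal (2 ^ j * (cmod (d j x))\<^sup>2)) \<noteq> \<infinity>"
    by (intro nn_integral_PInf_AE) auto
  then have conv: "AE x in M. convergent (\<lambda>k. g (r k) x)"
  proof eventually_elim
    case (elim x)
    have s1: "summable (\<lambda>j. 2 ^ j * (cmod (d j x))\<^sup>2)"
      using elim by (intro summable_suminf_not_top) auto
    have "summable (\<lambda>j. (1/2) ^ j + 2 ^ j * (cmod (d j x))\<^sup>2)"
      by (intro summable_add s1 summable_geometric) auto
    \<comment> \<open>From (1 - 2^j |d|)^2 >= 0: summability of the weighted squares yields absolute
      summability of the differences.\<close>
    moreover have "norm (d j x) \<le> (1/2) ^ j + 2 ^ j * (cmod (d j x))\<^sup>2" for j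
    proof -
      have "0 \<le> (1 - 2 ^ j * cmod (d j x))\<^sup>2" by simp
      then have "2 * (2 ^ j * cmod (d j x)) \<le> 1 + (2 ^ j)\<^sup>2 * (cmod (d j x))\<^sup>2"
        by (simp add: power2_diff power_mult_distrib)
      then have "(2 ^ j * cmod (d j x)) \<le> 1 + (2 ^ j)\<^sup>2 * (cmod (d j x))\<^sup>2"
        using mult_nonneg_nonneg[of "2 ^ j" "cmod (d j x)"] by (smt (verit) norm_ge_zero zero_le_power)
      then show ?thesis
        by (simp add: divide_simps power2_eq_square mult_ac)
    qed
    ultimately have "summable (\<lambda>j. d j x)" by (rule summable_comparison_test'[where N=0])
    then have "convergent (\<lambda>n. \<Sum>j<n. d j x)" by (simp add: summable_iff_convergent)
    then have "convergent (\<lambda>n. g (r n) x - g (r 0) x)"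
      unfolding d_def by (subst (asm) sum_lessThan_telescope)
    then have "convergent (\<lambda>n. (g (r n) x - g (r 0) x) + g (r 0) x)"
      by (intro convergent_add convergent_const)
    then show ?case by simp
  qed
  show ?thesis
  proof
    show "strict_mono r" by fact
    show "(\<lambda>x. lim (\<lambda>k. g (r k) x)) \<in> borel_measurable M" by measurable
    show "AE x in M. (\<lambda>k. g (r k) x) \<longlonglongrightarrow> lim (\<lambda>k. g (r k) x)"
      using conv by eventually_elim (simp add: convergent_LIMSEQ_iff)
  qed
qed

section \<open>The magnetic seminorm as an \<open>L\<^sup>2\<close> norm\<close>

text \<open>Tonelli reduces the measure of the preimage to its sections in the second
  variable.\<close>

lemma null_vimage_prod:
  fixes L :: "'a::euclidean_space \<times> 'b::euclidean_space \<Rightarrow> 'c::euclidean_space"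
  assumes L [measurable]: "L \<in> borel_measurable borel"
    and sec: "\<And>N. N \<in> null_sets lborel \<Longrightarrow> AE x in lborel. emeasure lborel {y. L (x, y) \<in> N} = 0"
    and N: "N \<in> null_sets lborel"
  shows "L -` N \<in> null_sets lborel"
proof
  have N' [measurable]: "N \<in> sets borel" using N by auto
  have L': "L \<in> borel_measurable (borel \<Otimes>\<^sub>M borel)" by (simp add: borel_prod L)
  have m: "L -` N \<in> sets (lborel \<Otimes>\<^sub>M lborel)"
    using measurable_sets[OF L' N'] by (simp add: space_pair_measure cong: sets_pair_measure_cong)
  then show "L -` N \<in> sets lborel" using measurable_sets[OF L N'] by simp
  have "emeasure lborel (L -` N) = emeasure (lborel \<Otimes>\<^sub>M lborel) (L -` N)"
    by (simp add: lborel_prod)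
  also have "\<dots> = (\<integral>\<^sup>+x. emeasure lborel (Pair x -` (L -` N)) \<partial>lborel)"
    by (rule lborel.emeasure_pair_measure_alt[OF m])
  also have "\<dots> = (\<integral>\<^sup>+x. 0 \<partial>(lborel :: 'a measure))"
  proof (rule nn_integral_cong_AE)
    show "AE x in lborel. emeasure lborel (Pair x -` (L -` N)) = 0"
      using sec[OF N] by eventually_elim (simp add: vimage_def)
  qed
  finally show "emeasure lborel (L -` N) = 0" by simp
qed

text \<open>Lebesgue measure on the product completes the Borel product, so a Borel map becomes
  measurable between the Lebesgue algebras once null sets pull back to null sets. The same fact
  transports almost everywhere statements, and this is how functions of x, y and the midpoint are
  changed on null sets.\<close>

lemma measurable_lebesgue_prod:
  fixes L :: "'a::euclidean_space \<times> 'b::euclidean_space \<Rightarrow> 'c::euclidean_space"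
  assumes L: "L \<in> borel_measurable borel"
    and sec: "\<And>N. N \<in> null_sets lborel \<Longrightarrow> AE x in lborel. emeasure lborel {y. L (x, y) \<in> N} = 0"
  shows "L \<in> lebesgue \<rightarrow>\<^sub>M lebesgue"
    and "(AE c in lebesgue. P c) \<Longrightarrow> AE z in lebesgue. P (L z)"
proof -
  have m: "L \<in> lebesgue \<rightarrow>\<^sub>M lborel"
    using L by (simp add: measurable_completion)
  show "L \<in> lebesgue \<rightarrow>\<^sub>M lebesgue"
  proof (rule completion.measurable_completion2[OF m])
    show "null_sets lborel \<subseteq> null_sets (distr lebesgue lborel L)"
      using null_vimage_prod[OF L sec] m
      by (auto simp: null_sets_def emeasure_distr measurable_sets[OF m] null_sets_completion_iff)
  qed
  show "AE z in lebesgue. P (L z)" if "AE c in lebesgue. P c"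
  proof -
    from that have "AE c in lborel. P c" by (simp add: AE_completion_iff)
    then obtain N where N: "N \<in> null_sets lborel" "{c. \<not> P c} \<subseteq> N" by (auto simp: eventually_ae_filter)
    from null_vimage_prod[OF L sec N(1)] have "AE z in lborel. z \<notin> L -` N" by (rule AE_not_in)
    then have "AE z in lborel. P (L z)" by eventually_elim (use N(2) in auto)
    then show ?thesis by (rule AE_completion)
  qed
qed

text \<open>For fixed x the section is empty or everything, and it is empty for almost every
  x.\<close>

lemma lebesgue_prod_fst:
  shows measurable_fst_lebesgue: "(fst :: 'a::euclidean_space \<times> 'b::euclidean_space \<Rightarrow> 'a) \<in> lebesgue \<rightarrow>\<^sub>M lebesgue"
    and AE_fst_lebesgue: "(AE c in lebesgue. P c) \<Longrightarrow> AE z in (lebesgue :: ('a \<times> 'b) measure). P (fst z)"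
proof -
  have 1: "(fst :: 'a \<times> 'b \<Rightarrow> 'a) \<in> borel_measurable borel"
    by (intro borel_measurable_continuous_onI continuous_intros)
  have 2: "AE x in lborel. emeasure lborel {y :: 'b. fst (x, y) \<in> N} = 0"
    if "N \<in> null_sets lborel" for N :: "'a set"
    using AE_not_in[OF that] by eventually_elim simp
  show "(fst :: 'a \<times> 'b \<Rightarrow> 'a) \<in> lebesgue \<rightarrow>\<^sub>M lebesgue"
    by (rule measurable_lebesgue_prod(1)[OF 1 2])
  show "(AE c in lebesgue. P c) \<Longrightarrow> AE z in (lebesgue :: ('a \<times> 'b) measure). P (fst z)"
    by (rule measurable_lebesgue_prod(2)[OF 1 2])
qed

lemma lebesgue_prod_snd:
  shows measurable_snd_lebesgue: "(snd :: 'a::euclidean_space \<times> 'b::euclidean_space \<Rightarrow> 'b) \<in> lebesgue \<rightarrow>\<^sub>M lebesgue"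
    and AE_snd_lebesgue: "(AE c in lebesgue. P c) \<Longrightarrow> AE z in (lebesgue :: ('a \<times> 'b) measure). P (snd z)"
proof -
  have 1: "(snd :: 'a \<times> 'b \<Rightarrow> 'b) \<in> borel_measurable borel"
    by (intro borel_measurable_continuous_onI continuous_intros)
  have 2: "AE x in lborel. emeasure lborel {y :: 'b. snd (x :: 'a, y) \<in> N} = 0"
    if "N \<in> null_sets lborel" for N :: "'b set"
    using that by (auto simp: null_sets_def)
  show "(snd :: 'a \<times> 'b \<Rightarrow> 'b) \<in> lebesgue \<rightarrow>\<^sub>M lebesgue"
    by (rule measurable_lebesgue_prod(1)[OF 1 2])
  show "(AE c in lebesgue. P c) \<Longrightarrow> AE z in (lebesgue :: ('a \<times> 'b) measure). P (snd z)"
    by (rule measurable_lebesgue_prod(2)[OF 1 2])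
qed

text \<open>\<open>A\<close> is evaluated at the midpoint, so this map too has to pull back null
  sets. For fixed x the section is an affine image of \<open>N\<close> with dilation 2, so its
  measure is 2^n times that of \<open>N\<close>.\<close>

lemma lebesgue_prod_midpoint:
  fixes P :: "'a::euclidean_space \<Rightarrow> bool"
  shows measurable_midpoint_lebesgue: "(\<lambda>z :: 'a \<times> 'a. (fst z + snd z) /\<^sub>R 2) \<in> lebesgue \<rightarrow>\<^sub>M lebesgue"
    and AE_midpoint_lebesgue: "(AE c in lebesgue. P c) \<Longrightarrow>
      AE z in (lebesgue :: ('a \<times> 'a) measure). P ((fst z + snd z) /\<^sub>R 2)"
proof -
  have 1: "(\<lambda>z :: 'a \<times> 'a. (fst z + snd z) /\<^sub>R 2) \<in> borel_measurable borel"
    by (intro borel_measurable_continuous_onI continuous_intros)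
  have 2: "AE x in lborel. emeasure lborel {y :: 'a. (fst (x, y) + snd (x, y)) /\<^sub>R 2 \<in> N} = 0"
    if N: "N \<in> null_sets lborel" for N :: "'a set"
  proof (rule AE_I2)
    fix x :: 'a
    have [measurable]: "N \<in> sets borel" using N by auto
    let ?S = "{y. (x + y) /\<^sub>R 2 \<in> N}"
    have [measurable]: "?S \<in> sets borel" by measurable
    have S: "(\<lambda>z. - x + 2 *\<^sub>R z) -` ?S = N" by (auto simp: scaleR_2)
    have "emeasure lborel ?S
        = emeasure (density (distr lborel borel (\<lambda>z. - x + 2 *\<^sub>R z)) (\<lambda>_. ennreal (\<bar>2\<bar> ^ DIM('a)))) ?S"
      using lborel_affine[of 2 "- x"] by (rule arg_cong[where f="\<lambda>M. emeasure M ?S"]) simp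
    also have "\<dots> = (\<integral>\<^sup>+y. ennreal (\<bar>2\<bar> ^ DIM('a)) * indicator ?S y \<partial>distr lborel borel (\<lambda>z. - x + 2 *\<^sub>R z))"
      by (subst emeasure_density) auto
    also have "\<dots> = ennreal (\<bar>2\<bar> ^ DIM('a)) * emeasure (distr lborel borel (\<lambda>z. - x + 2 *\<^sub>R z)) ?S"
      by (subst nn_integral_cmult_indicator) auto
    also have "\<dots> = ennreal (\<bar>2\<bar> ^ DIM('a)) * emeasure lborel N"
      by (subst emeasure_distr) (auto simp: S)
    also have "\<dots> = 0" using N by (simp add: null_sets_def)
    finally show "emeasure lborel {y :: 'a. (fst (x, y) + snd (x, y)) /\<^sub>R 2 \<in> N} = 0" by simp
  qed
  show "(\<lambda>z :: 'a \<times> 'a. (fst z + snd z) /\<^sub>R 2) \<in> lebesgue \<rightarrow>\<^sub>M lebesgue"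
    by (rule measurable_lebesgue_prod(1)[OF 1 2])
  show "(AE c in lebesgue. P c) \<Longrightarrow>
      AE z in (lebesgue :: ('a \<times> 'a) measure). P ((fst z + snd z) /\<^sub>R 2)"
    by (rule measurable_lebesgue_prod(2)[OF 1 2])
qed

text \<open>A coordinatewise correction on a null set. Tonelli on the product is applied to Borel
  functions, hence the change of representative.\<close>

lemma lebesgue_ex_borel:
  fixes g :: "'a::euclidean_space \<Rightarrow> 'b::euclidean_space"
  assumes g: "g \<in> borel_measurable lebesgue"
  obtains g' where "g' \<in> borel_measurable borel" "AE x in lebesgue. g x = g' x"
proof -
  have "\<exists>g'\<in>borel_measurable lborel. AE x in lborel. g x \<bullet> b = g' x" for b
    using g by (intro completion_ex_borel_measurable_real) simp
  then obtain h where h: "\<And>b. h b \<in> borel_measurable lborel"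
    and eq: "\<And>b. AE x in lborel. g x \<bullet> b = h b x" by metis
  have [measurable]: "h b \<in> borel_measurable borel" for b using h by simp
  show ?thesis
  proof
    show "(\<lambda>x. \<Sum>b\<in>Basis. h b x *\<^sub>R b) \<in> borel_measurable borel" by measurable
    have "AE x in lborel. \<forall>b\<in>Basis. g x \<bullet> b = h b x"
      using eq by (intro AE_finite_allI) auto
    then have "AE x in lborel. g x = (\<Sum>b\<in>Basis. h b x *\<^sub>R b)"
      by eventually_elim (metis (no_types, lifting) euclidean_representation sum.cong)
    then show "AE x in lebesgue. g x = (\<Sum>b\<in>Basis. h b x *\<^sub>R b)" by (rule AE_completion)
  qed
qed

text \<open>The square root of the kernel goes to each factor, so the energy form becomes the L2
  inner product of two such quotients and the seminorm an L2 norm on the product. On the diagonal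
  the kernel is 0, and division by zero makes the quotient 0.\<close>

definition mag_quot :: "real \<Rightarrow> (real^'n \<Rightarrow> real^'n) \<Rightarrow> (real^'n \<Rightarrow> complex) \<Rightarrow> (real^'n) \<times> (real^'n) \<Rightarrow> complex"
  where "mag_quot s A w z =
    mag_diff A w (fst z) (snd z) / of_real (sqrt (mag_kernel s (fst z) (snd z)))"

lemma mag_kernel_nonneg [simp]: "0 \<le> mag_kernel s x y"
  by (simp add: mag_kernel_def)

lemma mag_diff_diff: "mag_diff A (u - v) x y = mag_diff A u x y - mag_diff A v x y"
  by (simp add: mag_diff_def algebra_simps)

lemma mag_quot_diff: "mag_quot s A (u - v) = (\<lambda>z. mag_quot s A u z - mag_quot s A v z)"
  by (simp add: mag_quot_def mag_diff_diff diff_divide_distrib fun_eq_iff)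

lemma norm_mag_quot_sq:
  "(cmod (mag_quot s A w (x, y)))\<^sup>2 = (cmod (mag_diff A w x y))\<^sup>2 / mag_kernel s x y"
  by (simp add: mag_quot_def norm_divide power_divide)

lemma X_inner_eq: "X_inner s A u v = Re (l2inner lebesgue (mag_quot s A u) (mag_quot s A v))"
proof -
  have "mag_quot s A u z * cnj (mag_quot s A v z) = (case z of (x, y) \<Rightarrow>
      mag_diff A u x y * cnj (mag_diff A v x y) / of_real (mag_kernel s x y))" for z
    by (simp add: mag_quot_def case_prod_unfold flip: of_real_mult)
  then show ?thesis by (simp add: X_inner_def l2inner_def)
qed

lemma X_norm_eq: "X_norm s A u = l2norm lebesgue (mag_quot s A u)"
  by (simp add: X_norm_def X_inner_eq l2inner_self del: of_real_power)

lemma borel_measurable_mag_quot: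
  fixes A :: "real^'n \<Rightarrow> real^'n"
  assumes "A \<in> borel_measurable lebesgue" "w \<in> borel_measurable lebesgue"
  shows "mag_quot s A w \<in> borel_measurable lebesgue"
proof -
  have [measurable]: "(\<lambda>z :: (real^'n) \<times> (real^'n). w (fst z)) \<in> borel_measurable lebesgue"
    "(\<lambda>z :: (real^'n) \<times> (real^'n). w (snd z)) \<in> borel_measurable lebesgue"
    "(\<lambda>z :: (real^'n) \<times> (real^'n). A ((fst z + snd z) /\<^sub>R 2)) \<in> borel_measurable lebesgue"
    by (rule measurable_compose[OF measurable_fst_lebesgue assms(2)]
        measurable_compose[OF measurable_snd_lebesgue assms(2)]
        measurable_compose[OF measurable_midpoint_lebesgue assms(1)])+
  have b [measurable]: "(\<lambda>z :: (real^'n) \<times> (real^'n). fst z - snd z) \<in> borel_measurable lebesgue"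
    by (intro measurable_completion) (auto intro!: borel_measurable_continuous_onI continuous_intros)
  show ?thesis
    unfolding mag_quot_def mag_diff_def mag_kernel_def by measurable
qed

section \<open>The energy space and its seminorm\<close>

locale magnetic_space =
  fixes s :: real and A :: "real^'n \<Rightarrow> real^'n" and \<Omega> :: "(real^'n) set"
  assumes s_pos: "0 < s" and s_less_1: "s < 1" and s_dim: "2 * s < real CARD('n)"
    and open_\<Omega>: "open \<Omega>" and bounded_\<Omega>: "bounded \<Omega>"
    and A_Linf: "Linf_loc A"
begin

abbreviation "X \<equiv> X0A s A \<Omega>"
abbreviation "Xnorm \<equiv> X_norm s A"

lemma A_measurable: "A \<in> borel_measurable lebesgue"
  using A_Linf by (simp add: Linf_loc_def)

lemma X_iff:
  "w \<in> X \<longleftrightarrow> sq_integrable lebesgue w \<and> sq_integrable lebesgue (mag_quot s A w) \<and>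
     (AE x in lebesgue. x \<notin> \<Omega> \<longrightarrow> w x = 0)"
proof -
  have "(case z of (x, y) \<Rightarrow> (cmod (mag_diff A w x y))\<^sup>2 / mag_kernel s x y)
      = (cmod (mag_quot s A w z))\<^sup>2" for z
    by (cases z) (simp add: norm_mag_quot_sq)
  then have eq: "(\<lambda>z. case z of (x, y) \<Rightarrow> (cmod (mag_diff A w x y))\<^sup>2 / mag_kernel s x y)
      = (\<lambda>z. (cmod (mag_quot s A w z))\<^sup>2)" by (rule ext)
  have "set_integrable lebesgue (UNIV \<times> UNIV)
      (\<lambda>(x, y). (cmod (mag_diff A w x y))\<^sup>2 / mag_kernel s x y)
    \<longleftrightarrow> integrable lebesgue (\<lambda>z. (cmod (mag_quot s A w z))\<^sup>2)"
    unfolding set_integrable_def by (simp add: eq)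
  then show ?thesis
    unfolding X0A_def HsA_def L2_def sq_integrable_def set_borel_measurable_def
    using borel_measurable_mag_quot[OF A_measurable, of w s] by (auto simp: set_integrable_def)
qed

lemma X_D:
  assumes "w \<in> X"
  shows "sq_integrable lebesgue w" "sq_integrable lebesgue (mag_quot s A w)"
    "AE x in lebesgue. x \<notin> \<Omega> \<longrightarrow> w x = 0" "w \<in> borel_measurable lebesgue"
  using assms by (auto simp: X_iff sq_integrable_def)

lemma X_diff:
  assumes "u \<in> X" "v \<in> X"
  shows "u - v \<in> X"
  unfolding X_iff
proof (intro conjI)
  show "sq_integrable lebesgue (u - v)"
    using sq_integrable_diff[OF X_D(1)[OF assms(1)] X_D(1)[OF assms(2)]] by (simp add: fun_diff_def)
  show "sq_integrable lebesgue (mag_quot s A (u - v))"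
    unfolding mag_quot_diff by (intro sq_integrable_diff X_D assms)
  show "AE x in lebesgue. x \<notin> \<Omega> \<longrightarrow> (u - v) x = 0"
    using X_D(3)[OF assms(1)] X_D(3)[OF assms(2)] by eventually_elim simp
qed

lemma Xnorm_nonneg [simp]: "0 \<le> Xnorm w" by (simp add: X_norm_eq)

lemma X_inner_self: "X_inner s A w w = (Xnorm w)\<^sup>2"
  by (simp add: X_inner_eq X_norm_eq l2inner_self del: of_real_power)

lemma abs_X_inner_le:
  assumes "u \<in> X" "v \<in> X"
  shows "\<bar>X_inner s A u v\<bar> \<le> Xnorm u * Xnorm v"
  using norm_l2inner_le[OF X_D(2)[OF assms(1)] X_D(2)[OF assms(2)]] abs_Re_le_cmod order_trans
  unfolding X_inner_eq X_norm_eq by blast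

lemma X_inner_diff_left:
  assumes "u \<in> X" "v \<in> X" "w \<in> X"
  shows "X_inner s A (u - v) w = X_inner s A u w - X_inner s A v w"
  unfolding X_inner_eq mag_quot_diff using assms by (simp add: l2inner_diff_left X_D)

lemma X_inner_diff_right:
  assumes "u \<in> X" "v \<in> X" "w \<in> X"
  shows "X_inner s A w (u - v) = X_inner s A w u - X_inner s A w v"
  unfolding X_inner_eq mag_quot_diff using assms by (simp add: l2inner_diff_right X_D)

lemma Xnorm_diff_triangle:
  assumes "u \<in> X" "v \<in> X"
  shows "Xnorm (u - v) \<le> Xnorm u + Xnorm v"
  unfolding X_norm_eq mag_quot_diff using assms by (intro l2norm_diff_triangle X_D)

lemma Xnorm_diff_sq:
  assumes "u \<in> X" "v \<in> X"
  shows "(Xnorm (u - v))\<^sup>2 = (Xnorm u)\<^sup>2 + (Xnorm v)\<^sup>2 - 2 * X_inner s A u v"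
  unfolding X_norm_eq mag_quot_diff X_inner_eq using assms by (intro l2norm_diff_sq X_D)

end

section \<open>Poincare and Sobolev inequalities\<close>

text \<open>The ansatz K 2^(-rk) reproduces itself when r \<sigma> + 2 = r, which fixes r = 2 / (1 -
  \<sigma>). \<open>K\<close> must dominate \<open>V\<close> at the start and satisfy D 2^r <= K^(1
  - \<sigma>) in the step; since \<sigma> < 1, a large \<open>K\<close> does.\<close>

lemma level_decay:
  fixes a :: "nat \<Rightarrow> real"
  assumes a: "\<And>k. 0 \<le> a k" "a 0 \<le> V" and D: "0 < D" and \<sigma>: "0 < \<sigma>" "\<sigma> < 1"
    and rec: "\<And>k. a (Suc k) \<le> D * (1/4) ^ k * a k powr \<sigma>"
  defines "r \<equiv> 2 / (1 - \<sigma>)"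
  defines "K \<equiv> max V ((D * 2 powr r) powr (1 / (1 - \<sigma>)))"
  shows "a k \<le> K * (1 / 2 powr r) ^ k"
proof (induction k)
  case 0
  then show ?case using a by (simp add: K_def)
next
  case (Suc k)
  let ?L = "(D * 2 powr r) powr (1 / (1 - \<sigma>))"
  have L: "0 < ?L" using D by simp
  have K: "0 < K" "?L \<le> K" using L unfolding K_def by linarith+
  have "D * 2 powr r = ?L powr (1 - \<sigma>)" using D \<sigma> by (simp add: powr_powr)
  also have "\<dots> \<le> K powr (1 - \<sigma>)" using K L \<sigma> by (intro powr_mono2) auto
  finally have DK: "D * 2 powr r \<le> K powr (1 - \<sigma>)" .
  have q: "((1 / 2 powr r) ^ k) powr \<sigma> * (1/4) ^ k = (1 / 2 powr r) ^ k"
  proof -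
    have e1: "(1 / 2 powr r) ^ k = (2::real) powr (- r * k)"
      using powr_realpow[of "2 powr (- r)" k] by (simp add: powr_minus_divide[symmetric] powr_powr)
    have e2: "(1/4 :: real) ^ k = 2 powr (- 2 * k)"
      by (simp add: power_one_over powr_minus_divide powr_powr[symmetric] flip: powr_realpow)
    have "- r * k * \<sigma> + - 2 * k = - r * real k"
      using \<sigma> unfolding r_def by (simp add: field_simps)
    then show ?thesis unfolding e1 e2 powr_powr powr_add[symmetric] by simp
  qed
  have "a (Suc k) \<le> D * (1/4) ^ k * a k powr \<sigma>" by (rule rec)
  also have "\<dots> \<le> D * (1/4) ^ k * (K * (1 / 2 powr r) ^ k) powr \<sigma>"
    using Suc a \<sigma> D by (intro mult_left_mono powr_mono2) auto
  also have "\<dots> = D * K powr \<sigma> * (((1 / 2 powr r) ^ k) powr \<sigma> * (1/4) ^ k)"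
    using K by (simp add: powr_mult)
  also have "\<dots> = D * K powr \<sigma> * (1 / 2 powr r) ^ k" unfolding q ..
  also have "\<dots> = (D * 2 powr r) * K powr \<sigma> * (1 / 2 powr r) ^ Suc k" by simp
  also have "\<dots> \<le> K powr (1 - \<sigma>) * K powr \<sigma> * (1 / 2 powr r) ^ Suc k"
    using DK by (intro mult_right_mono) auto
  also have "\<dots> = K * (1 / 2 powr r) ^ Suc k" using K by (simp flip: powr_add)
  finally show ?case .
qed

text \<open>\<open>\<rho>\<close> is the radius of a ball of measure \<open>2 * a\<close>, so
  removing a set of measure \<open>a\<close> leaves at least \<open>a\<close>.\<close>

lemma emeasure_ball_diff_ge:
  fixes E :: "'a::euclidean_space set" and x :: 'a
  assumes E: "E \<in> sets borel" "emeasure lborel E = ennreal a" and a: "0 < a"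
  defines "\<rho> \<equiv> (2 * a / unit_ball_vol (DIM('a))) powr (1 / DIM('a))"
  shows "ennreal a \<le> emeasure lborel (ball x \<rho> - E)"
proof -
  let ?v = "unit_ball_vol (real DIM('a))"
  have v: "?v > 0" by (simp add: unit_ball_vol_pos)
  then have v0: "?v \<noteq> 0" by linarith
  have rho: "0 \<le> \<rho>" by (simp add: \<rho>_def)
  have "\<rho> ^ DIM('a) = 2 * a / ?v"
    using a v v0 powr_realpow[of \<rho> "DIM('a)"] unfolding \<rho>_def by (simp add: powr_powr)
  then have b: "emeasure lborel (ball x \<rho>) = ennreal (2 * a)"
    using v0 by (simp add: emeasure_ball rho)
  have "ennreal (2 * a) - ennreal a \<le> emeasure lborel (ball x \<rho>) - emeasure lborel (E \<inter> ball x \<rho>)"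
    unfolding b using E by (intro ennreal_minus_mono) (auto simp flip: E(2) intro!: emeasure_mono)
  also have "\<dots> = emeasure lborel (ball x \<rho> - E \<inter> ball x \<rho>)"
  proof (rule emeasure_Diff[symmetric])
    have "emeasure lborel (E \<inter> ball x \<rho>) \<le> ennreal a"
      unfolding E(2)[symmetric] using E by (intro emeasure_mono) auto
    then show "emeasure lborel (E \<inter> ball x \<rho>) \<noteq> \<infinity>" by (auto simp: top_unique)
  qed (use E in auto)
  also have "ball x \<rho> - E \<inter> ball x \<rho> = ball x \<rho> - E" by auto
  also have "ennreal (2 * a) - ennreal a = ennreal a" using a by (subst ennreal_minus) auto
  finally show ?thesis .
qed

section \<open>Bounds by the seminorm: Poincare, level sets, Sobolev\<close>

context magnetic_space
begin

lemma X_borel_rep: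
  assumes w: "w \<in> X"
  obtains w' where "w' \<in> borel_measurable borel" "AE x in lebesgue. w x = w' x"
    "\<And>x. x \<notin> \<Omega> \<Longrightarrow> w' x = 0"
proof -
  obtain w1 where w1 [measurable]: "w1 \<in> borel_measurable borel" and eq: "AE x in lebesgue. w x = w1 x"
    by (rule lebesgue_ex_borel[OF X_D(4)[OF w]])
  have [measurable]: "\<Omega> \<in> sets borel" using open_\<Omega> by simp
  show ?thesis
  proof
    show "(\<lambda>x. if x \<in> \<Omega> then w1 x else 0) \<in> borel_measurable borel" by measurable
    show "AE x in lebesgue. w x = (if x \<in> \<Omega> then w1 x else 0)"
      using eq X_D(3)[OF w] by eventually_elim auto
  qed auto
qed

text \<open>Resetting the exceptional values to 0 turns the essential bound on \<open>K\<close> into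
  a pointwise one, as needed when it is used at every midpoint of a cube.\<close>

lemma A_borel_rep:
  fixes K :: "(real^'n) set"
  assumes K: "compact K"
  obtains A' b where "A' \<in> borel_measurable borel" "AE x in lebesgue. A x = A' x" "0 \<le> b"
    "\<And>x. x \<in> K \<Longrightarrow> norm (A' x) \<le> b"
proof -
  obtain A1 where A1 [measurable]: "A1 \<in> borel_measurable borel" and eq: "AE x in lebesgue. A x = A1 x"
    by (rule lebesgue_ex_borel[OF A_measurable])
  obtain b where b: "AE x in lebesgue. x \<in> K \<longrightarrow> norm (A x) \<le> b"
    using A_Linf K unfolding Linf_loc_def by blast
  have [measurable]: "K \<in> sets borel" using K by (simp add: borel_compact)
  show ?thesis
  proof
    show "(\<lambda>x. if x \<in> K \<and> norm (A1 x) > \<bar>b\<bar> then 0 else A1 x) \<in> borel_measurable borel"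
      by measurable
    show "AE x in lebesgue. A x = (if x \<in> K \<and> norm (A1 x) > \<bar>b\<bar> then 0 else A1 x)"
      using eq b by eventually_elim auto
    show "norm (if x \<in> K \<and> norm (A1 x) > \<bar>b\<bar> then 0 else A1 x) \<le> \<bar>b\<bar>" if "x \<in> K" for x
      using that by auto
  qed simp
qed

text \<open>Tonelli for Borel representatives; the iterated form lets the inner integral be bounded
  below for each x separately.\<close>

lemma Xnorm_sq_nn_integral:
  assumes w: "w \<in> X" and w' [measurable]: "w' \<in> borel_measurable borel"
    and eq: "AE x in lebesgue. w x = w' x"
    and A' [measurable]: "A' \<in> borel_measurable borel" and eqA: "AE x in lebesgue. A x = A' x"
  shows "(\<integral>\<^sup>+x. \<integral>\<^sup>+y. ennreal ((cmod (mag_diff A' w' x y))\<^sup>2 / mag_kernel s x y) \<partial>lborel \<partial>lborel)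
    = ennreal ((Xnorm w)\<^sup>2)"
proof -
  let ?q = "\<lambda>z. ennreal ((cmod (mag_quot s A' w' z))\<^sup>2)"
  have ae: "AE z in lebesgue. mag_quot s A w z = mag_quot s A' w' z"
    using AE_fst_lebesgue[OF eq] AE_snd_lebesgue[OF eq] AE_midpoint_lebesgue[OF eqA]
    by eventually_elim (simp add: mag_quot_def mag_diff_def)
  have [measurable]: "mag_quot s A' w' \<in> borel_measurable (borel \<Otimes>\<^sub>M borel)"
    unfolding mag_quot_def mag_diff_def mag_kernel_def by measurable
  have "ennreal ((Xnorm w)\<^sup>2) = (\<integral>\<^sup>+z. ennreal ((cmod (mag_quot s A w z))\<^sup>2) \<partial>lebesgue)"
    using X_D(2)[OF w] unfolding X_norm_eq l2norm_sq
    by (subst nn_integral_eq_integral) (auto simp: sq_integrable_def)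
  also have "\<dots> = (\<integral>\<^sup>+z. ?q z \<partial>lebesgue)"
    using ae by (intro nn_integral_cong_AE) (auto elim: eventually_mono)
  also have "\<dots> = (\<integral>\<^sup>+z. ?q z \<partial>(lborel \<Otimes>\<^sub>M lborel))"
    by (simp add: nn_integral_completion lborel_prod)
  also have "\<dots> = (\<integral>\<^sup>+x. \<integral>\<^sup>+y. ?q (x, y) \<partial>lborel \<partial>lborel)"
    by (intro lborel.nn_integral_fst[symmetric]) measurable
  finally show ?thesis by (simp add: norm_mag_quot_sq)
qed

text \<open>The diamagnetic inequality: the phase has modulus one, so the difference of moduli never
  exceeds the magnetic difference. Restricting x to \<open>S\<close> then turns a lower bound on the
  inner integral into a lower bound on the seminorm.\<close>

lemma nn_integral_X_ge:
  assumes w: "w \<in> X" and w' [measurable]: "w' \<in> borel_measurable borel"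
    and eq: "AE x in lebesgue. w x = w' x"
    and S [measurable]: "S \<in> sets borel" and g [measurable]: "g \<in> borel_measurable borel"
    and le: "\<And>x. x \<in> S \<Longrightarrow>
      ennreal (g x) \<le> (\<integral>\<^sup>+y. ennreal ((cmod (w' x) - cmod (w' y))\<^sup>2 / mag_kernel s x y) \<partial>lborel)"
  shows "(\<integral>\<^sup>+x\<in>S. ennreal (g x) \<partial>lborel) \<le> ennreal ((Xnorm w)\<^sup>2)"
proof -
  obtain A' where A' [measurable]: "A' \<in> borel_measurable borel" "AE x in lebesgue. A x = A' x"
    by (rule lebesgue_ex_borel[OF A_measurable])
  have pt: "(cmod (w' x) - cmod (w' y))\<^sup>2 \<le> (cmod (mag_diff A' w' x y))\<^sup>2" for x y
  proof -
    have "\<bar>cmod (w' x) - cmod (w' y)\<bar> \<le> cmod (mag_diff A' w' x y)"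
      using norm_triangle_ineq3[of "w' x" "exp (\<i> * of_real ((x - y) \<bullet> A' ((x + y) /\<^sub>R 2))) * w' y"]
      by (simp add: mag_diff_def norm_mult)
    then show ?thesis by (metis abs_ge_zero power2_abs power_mono)
  qed
  have "(\<integral>\<^sup>+x\<in>S. ennreal (g x) \<partial>lborel) \<le>
    (\<integral>\<^sup>+x. \<integral>\<^sup>+y. ennreal ((cmod (mag_diff A' w' x y))\<^sup>2 / mag_kernel s x y) \<partial>lborel \<partial>lborel)"
  proof (rule nn_integral_mono)
    fix x
    show "ennreal (g x) * indicator S x
      \<le> (\<integral>\<^sup>+y. ennreal ((cmod (mag_diff A' w' x y))\<^sup>2 / mag_kernel s x y) \<partial>lborel)"
    proof (cases "x \<in> S")
      case True
      then have "ennreal (g x) * indicator S x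
        \<le> (\<integral>\<^sup>+y. ennreal ((cmod (w' x) - cmod (w' y))\<^sup>2 / mag_kernel s x y) \<partial>lborel)"
        using le by simp
      also have "\<dots> \<le> (\<integral>\<^sup>+y. ennreal ((cmod (mag_diff A' w' x y))\<^sup>2 / mag_kernel s x y) \<partial>lborel)"
        by (intro nn_integral_mono ennreal_leI divide_right_mono pt) simp
      finally show ?thesis .
    qed simp
  qed
  also have "\<dots> = ennreal ((Xnorm w)\<^sup>2)"
    by (rule Xnorm_sq_nn_integral[OF w w' eq A'])
  finally show ?thesis .
qed

text \<open>A point of \<open>\<Omega>\<close> paired with a point of a unit ball outside
  \<open>\<Omega>\<close> shows the full value of \<open>w'\<close>, which vanishes in that ball,
  and the distance of the two points is bounded. These pairs alone control the L2 norm.\<close>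

lemma X_poincare:
  obtains C where "0 < C" "\<And>w. w \<in> X \<Longrightarrow> l2norm lebesgue w \<le> C * Xnorm w"
proof -
  obtain R where R: "R > 0" "\<Omega> \<subseteq> cball 0 R"
    using bounded_\<Omega> unfolding bounded_pos by (auto simp: subset_iff)
  \<comment> \<open>The unit ball around \<open>c\<close> lies outside the ball of radius R that
    contains \<open>\<Omega>\<close>, and inside the ball of radius R + 2.\<close>
  obtain c :: "real^'n" where c: "norm c = R + 1"
    using vector_choose_size[of "R + 1"] R by auto
  \<comment> \<open>The kernel at the distance R + (R + 2), which bounds the distance of the two
    points.\<close>
  define \<kappa> where "\<kappa> = (2 * R + 2) powr (real CARD('n) + 2 * s)"
  define b where "b = measure lborel (ball c 1)"
  have kap: "0 < \<kappa>" using R by (simp add: \<kappa>_def)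
  have b: "0 < b" unfolding b_def by (simp add: content_ball_pos)
  have [measurable]: "\<Omega> \<in> sets borel" using open_\<Omega> by simp
  have main: "b / \<kappa> * (l2norm lebesgue w)\<^sup>2 \<le> (Xnorm w)\<^sup>2" if w: "w \<in> X" for w
  proof -
    obtain w' where w' [measurable]: "w' \<in> borel_measurable borel" and eq: "AE x in lebesgue. w x = w' x"
      and z: "\<And>x. x \<notin> \<Omega> \<Longrightarrow> w' x = 0" using X_borel_rep[OF w] by blast
    have "(\<integral>\<^sup>+x\<in>\<Omega>. ennreal (b / \<kappa> * (cmod (w' x))\<^sup>2) \<partial>lborel) \<le> ennreal ((Xnorm w)\<^sup>2)"
    proof (rule nn_integral_X_ge[OF w w' eq])
      fix x assume x: "x \<in> \<Omega>"
      have "ennreal (b / \<kappa> * (cmod (w' x))\<^sup>2) = (\<integral>\<^sup>+y\<in>ball c 1. ennreal ((cmod (w' x))\<^sup>2 / \<kappa>) \<partial>lborel)"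
      proof -
        have "ennreal (b / \<kappa> * (cmod (w' x))\<^sup>2) = ennreal ((cmod (w' x))\<^sup>2 / \<kappa>) * ennreal b"
          using kap b by (subst ennreal_mult[symmetric]) (auto simp: mult_ac)
        also have "ennreal b = emeasure lborel (ball c 1)"
          unfolding b_def using emeasure_bounded_finite[of "ball c 1"]
          by (intro emeasure_eq_ennreal_measure[symmetric]) auto
        finally show ?thesis by (simp add: nn_integral_cmult_indicator)
      qed
      also have "\<dots> \<le> (\<integral>\<^sup>+y. ennreal ((cmod (w' x) - cmod (w' y))\<^sup>2 / mag_kernel s x y) \<partial>lborel)"
      proof (rule nn_integral_mono)
        fix y
        show "ennreal ((cmod (w' x))\<^sup>2 / \<kappa>) * indicator (ball c 1) y
          \<le> ennreal ((cmod (w' x) - cmod (w' y))\<^sup>2 / mag_kernel s x y)"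
        proof (cases "y \<in> ball c 1")
          case True
          have ny: "R < norm y" "norm y \<le> R + 2"
            using True c norm_triangle_ineq3[of c y] by (auto simp: dist_norm)
          then have "y \<notin> \<Omega>" using R by auto
          have nx: "norm x \<le> R" using R x by auto
          have "norm (x - y) \<le> 2 * R + 2" using ny nx norm_triangle_ineq4[of x y] by linarith
          then have k: "mag_kernel s x y \<le> \<kappa>"
            unfolding mag_kernel_def \<kappa>_def using s_pos by (intro powr_mono2) auto
          have "x \<noteq> y" using nx ny by auto
          then have "0 < mag_kernel s x y" by (simp add: mag_kernel_def)
          then have "(cmod (w' x))\<^sup>2 / \<kappa> \<le> (cmod (w' x))\<^sup>2 / mag_kernel s x y"
            using k by (intro divide_left_mono) auto
          then show ?thesis using True z[OF \<open>y \<notin> \<Omega>\<close>] by (simp add: ennreal_leI)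
        qed simp
      qed
      finally show "ennreal (b / \<kappa> * (cmod (w' x))\<^sup>2)
        \<le> (\<integral>\<^sup>+y. ennreal ((cmod (w' x) - cmod (w' y))\<^sup>2 / mag_kernel s x y) \<partial>lborel)" .
    qed measurable
    also have "(\<integral>\<^sup>+x\<in>\<Omega>. ennreal (b / \<kappa> * (cmod (w' x))\<^sup>2) \<partial>lborel)
      = (\<integral>\<^sup>+x. ennreal (b / \<kappa> * (cmod (w' x))\<^sup>2) \<partial>lebesgue)"
      unfolding nn_integral_completion by (intro nn_integral_cong) (auto simp: indicator_def z)
    also have "\<dots> = (\<integral>\<^sup>+x. ennreal (b / \<kappa> * (cmod (w x))\<^sup>2) \<partial>lebesgue)"
      using eq by (intro nn_integral_cong_AE) (auto elim!: eventually_mono)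
    also have "\<dots> = ennreal (b / \<kappa> * (l2norm lebesgue w)\<^sup>2)"
      using X_D(1)[OF w] kap b unfolding l2norm_sq
      by (subst nn_integral_eq_integral) (auto simp: sq_integrable_def)
    finally show ?thesis by simp
  qed
  show ?thesis
  proof
    show "0 < sqrt (\<kappa> / b)" using kap b by simp
    fix w assume w: "w \<in> X"
    have "(l2norm lebesgue w)\<^sup>2 \<le> \<kappa> / b * (Xnorm w)\<^sup>2"
      using main[OF w] kap b by (simp add: field_simps)
    also have "\<dots> = (sqrt (\<kappa> / b) * Xnorm w)\<^sup>2"
      using kap b by (simp add: power_mult_distrib)
    finally show "l2norm lebesgue w \<le> sqrt (\<kappa> / b) * Xnorm w"
      by (rule power2_le_imp_le) (use kap b in simp)
  qed
qed

text \<open>A ball of twice the measure of the lower level set contains, around each point of the higher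
  level set, a large set of points with much smaller values; these pairs alone are controlled by
  the seminorm.\<close>

lemma level_set_decay:
  assumes w: "w \<in> X" and B: "Xnorm w \<le> B"
    and w' [measurable]: "w' \<in> borel_measurable borel"
    and eq: "AE x in lebesgue. w x = w' x" and z: "\<And>x. x \<notin> \<Omega> \<Longrightarrow> w' x = 0"
  defines "\<sigma> \<equiv> 2 * s / real CARD('n)"
  defines "a \<equiv> \<lambda>k. measure lborel {x. 2 ^ k < cmod (w' x)}"
  shows "a (Suc k) \<le> (B\<^sup>2 * (2 / unit_ball_vol CARD('n)) powr (1 + \<sigma>)) * (1/4) ^ k * a k powr \<sigma>"
proof -
  let ?E = "\<lambda>k. {x. 2 ^ k < cmod (w' x)}"
  let ?v = "unit_ball_vol (real CARD('n))"
  have v: "0 < ?v" by simp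
  have sub: "?E k \<subseteq> \<Omega>" for k using z by (force simp: not_less)
  have [measurable]: "?E k \<in> sets borel" for k by measurable
  have fin: "emeasure lborel (?E k) = ennreal (a k)" for k
  proof -
    have "emeasure lborel (?E k) < \<infinity>"
      using bounded_subset[OF bounded_\<Omega> sub] by (rule emeasure_bounded_finite)
    then show ?thesis unfolding a_def by (intro emeasure_eq_ennreal_measure) simp
  qed
  have a0: "0 \<le> a k" for k by (simp add: a_def)
  have B0: "0 \<le> B" using B Xnorm_nonneg[of w] by linarith
  show ?thesis
  \<comment> \<open>A null level set would give radius 0; in that case the higher level set is null
    by inclusion.\<close>
  proof (cases "a k = 0")
    case True
    have "?E (Suc k) \<subseteq> ?E k"
    proof
      fix x assume "x \<in> ?E (Suc k)"
      moreover have "(2::real) ^ k \<le> 2 ^ Suc k" by simp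
      ultimately show "x \<in> ?E k" by (smt (verit) mem_Collect_eq)
    qed
    then have "emeasure lborel (?E (Suc k)) \<le> emeasure lborel (?E k)"
      by (intro emeasure_mono) auto
    then have "a (Suc k) \<le> 0" unfolding fin True using a0 by (simp add: a_def)
    also have "\<dots> \<le> (B\<^sup>2 * (2 / ?v) powr (1 + \<sigma>)) * (1/4) ^ k * a k powr \<sigma>" by simp
    finally show ?thesis .
  next
    case False
    then have ak: "0 < a k" using a0[of k] by simp
    \<comment> \<open>The radius of a ball of measure \<open>2 * a k\<close>. The kernel bound
      \<open>\<kappa>\<close> becomes a multiple of the power 1 + \<sigma> of \<open>a k\<close>,
      and division by \<open>a k\<close> leaves the power \<sigma> of the recursion.\<close>
    define \<rho> where "\<rho> = (2 * a k / ?v) powr (1 / CARD('n))"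
    define \<kappa> where "\<kappa> = \<rho> powr (real CARD('n) + 2 * s)"
    have rho: "0 < \<rho>" using ak v by (simp add: \<rho>_def less_imp_neq[symmetric])
    have kap: "0 < \<kappa>" using rho by (simp add: \<kappa>_def)
    have kap_eq: "\<kappa> = (2 * a k / ?v) powr (1 + \<sigma>)"
    proof -
      have "1 / real CARD('n) * (real CARD('n) + 2 * s) = 1 + \<sigma>"
        by (simp add: \<sigma>_def field_simps)
      then show ?thesis unfolding \<kappa>_def \<rho>_def powr_powr by simp
    qed
    have "(\<integral>\<^sup>+x\<in>?E (Suc k). ennreal (4 ^ k / \<kappa> * a k) \<partial>lborel) \<le> ennreal ((Xnorm w)\<^sup>2)"
    proof (rule nn_integral_X_ge[OF w w' eq])
      fix x assume x: "x \<in> ?E (Suc k)"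
      have "ennreal (4 ^ k / \<kappa> * a k) = ennreal (4 ^ k / \<kappa>) * ennreal (a k)"
        using kap a0 by (intro ennreal_mult) auto
      also have "\<dots> \<le> ennreal (4 ^ k / \<kappa>) * emeasure lborel (ball x \<rho> - ?E k)"
        using emeasure_ball_diff_ge[OF _ fin ak, of x] unfolding \<rho>_def
        by (intro mult_left_mono) auto
      also have "\<dots> = (\<integral>\<^sup>+y\<in>ball x \<rho> - ?E k. ennreal (4 ^ k / \<kappa>) \<partial>lborel)"
        by (simp add: nn_integral_cmult_indicator)
      also have "\<dots> \<le> (\<integral>\<^sup>+y. ennreal ((cmod (w' x) - cmod (w' y))\<^sup>2 / mag_kernel s x y) \<partial>lborel)"
      proof (rule nn_integral_mono)
        fix y
        show "ennreal (4 ^ k / \<kappa>) * indicator (ball x \<rho> - ?E k) y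
          \<le> ennreal ((cmod (w' x) - cmod (w' y))\<^sup>2 / mag_kernel s x y)"
        proof (cases "y \<in> ball x \<rho> - ?E k")
          case True
          \<comment> \<open>Above 2^(k+1) at x and at most 2^k at y: the gap is at least 2^k, and
            its square is the source of the factor (1/4)^k.\<close>
          have d: "2 ^ k \<le> cmod (w' x) - cmod (w' y)" using True x by auto
          then have "(2 ^ k)\<^sup>2 \<le> (cmod (w' x) - cmod (w' y))\<^sup>2" by (intro power_mono) auto
          moreover have "((2::real) ^ k)\<^sup>2 = 4 ^ k" by (simp add: power_mult[symmetric] mult.commute[of k] power_mult)
          ultimately have num: "4 ^ k \<le> (cmod (w' x) - cmod (w' y))\<^sup>2" by simp
          have "(0::real) < 2 ^ k" by simp
          then have "0 < cmod (w' x) - cmod (w' y)" using d by linarith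
          then have "x \<noteq> y" by auto
          then have pos: "0 < mag_kernel s x y" by (simp add: mag_kernel_def)
          have "mag_kernel s x y \<le> \<kappa>"
            unfolding mag_kernel_def \<kappa>_def using True s_pos by (intro powr_mono2) (auto simp: dist_norm)
          then have "4 ^ k / \<kappa> \<le> (cmod (w' x) - cmod (w' y))\<^sup>2 / mag_kernel s x y"
            using num pos by (intro frac_le) auto
          then show ?thesis using True by (simp add: ennreal_leI)
        qed simp
      qed
      finally show "ennreal (4 ^ k / \<kappa> * a k)
        \<le> (\<integral>\<^sup>+y. ennreal ((cmod (w' x) - cmod (w' y))\<^sup>2 / mag_kernel s x y) \<partial>lborel)" .
    qed measurable
    also have "(\<integral>\<^sup>+x\<in>?E (Suc k). ennreal (4 ^ k / \<kappa> * a k) \<partial>lborel)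
      = ennreal (4 ^ k / \<kappa> * a k * a (Suc k))"
    proof -
      have "(\<integral>\<^sup>+x\<in>?E (Suc k). ennreal (4 ^ k / \<kappa> * a k) \<partial>lborel)
        = ennreal (4 ^ k / \<kappa> * a k) * ennreal (a (Suc k))"
        unfolding fin[symmetric] by (rule nn_integral_cmult_indicator) simp
      also have "\<dots> = ennreal (4 ^ k / \<kappa> * a k * a (Suc k))"
        using kap a0 a0[of "Suc k"] by (intro ennreal_mult[symmetric]) (auto simp: a_def)
      finally show ?thesis .
    qed
    also have "ennreal ((Xnorm w)\<^sup>2) \<le> ennreal (B\<^sup>2)"
      using B by (intro ennreal_leI power_mono) auto
    finally have "4 ^ k / \<kappa> * a k * a (Suc k) \<le> B\<^sup>2" by simp
    then have "a (Suc k) \<le> B\<^sup>2 * \<kappa> / (4 ^ k * a k)"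
      using kap ak by (simp add: field_simps)
    also have "\<dots> = (B\<^sup>2 * (2 / ?v) powr (1 + \<sigma>)) * (1/4) ^ k * (a k powr (1 + \<sigma>) / a k)"
      using ak v unfolding kap_eq by (simp add: powr_mult powr_divide power_one_over field_simps)
    also have "a k powr (1 + \<sigma>) / a k = a k powr \<sigma>" using ak by (simp add: powr_add)
    finally show ?thesis .
  qed
qed

text \<open>A dyadic layer cake: |w|^q is at most the indicator of \<open>\<Omega>\<close> plus the
  sum of 2^(q(k+1)) times the indicators of the level sets, whose measures decay like 2^(-rk). The
  decay exponent \<open>r\<close> is the critical exponent, so for subcritical q the series is
  geometric with ratio 2^(q-r) < 1.\<close>

lemma X_sobolev:
  assumes q: "0 < q" "q < crit_exp CARD('n) s"
  obtains K where "\<And>w. w \<in> X \<Longrightarrow> Xnorm w \<le> B \<Longrightarrow>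
    integrable lebesgue (\<lambda>x. cmod (w x) powr q) \<and> (\<integral>x. cmod (w x) powr q \<partial>lebesgue) \<le> K"
proof -
  define \<sigma> where "\<sigma> = 2 * s / real CARD('n)"
  define r where "r = 2 / (1 - \<sigma>)"
  define V where "V = measure lborel \<Omega>"
  \<comment> \<open>The added 1 keeps \<open>D\<close> positive when \<open>B\<close> is 0, as the
    recursion lemma requires.\<close>
  define D where "D = B\<^sup>2 * (2 / unit_ball_vol CARD('n)) powr (1 + \<sigma>) + 1"
  define K where "K = max V ((D * 2 powr r) powr (1 / (1 - \<sigma>)))"
  have sig: "0 < \<sigma>" "\<sigma> < 1" using s_pos s_dim by (auto simp: \<sigma>_def)
  have r: "r = crit_exp CARD('n) s" "q < r"
  proof -
    show "r = crit_exp CARD('n) s"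
      using s_dim unfolding r_def \<sigma>_def crit_exp_def by (simp add: field_simps)
    then show "q < r" using q by simp
  qed
  have D: "0 < D" unfolding D_def by (intro add_nonneg_pos) auto
  have K0: "0 \<le> K" unfolding K_def by (simp add: le_max_iff_disj)
  define c where "c k = 2 powr q * K * ((2 powr q / 2 powr r) ^ k)" for k :: nat
  have ratio: "2 powr q / 2 powr r < 1" using r by simp
  have sum_c: "summable c"
    unfolding c_def using ratio by (intro summable_mult summable_geometric) auto
  have [measurable]: "\<Omega> \<in> sets borel" using open_\<Omega> by simp
  have V: "emeasure lborel \<Omega> = ennreal V"
    unfolding V_def using emeasure_bounded_finite[OF bounded_\<Omega>] by (intro emeasure_eq_ennreal_measure) simp
  show ?thesis
  proof (rule that)
    fix w assume w: "w \<in> X" and B: "Xnorm w \<le> B"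
    obtain w' where w' [measurable]: "w' \<in> borel_measurable borel" and eq: "AE x in lebesgue. w x = w' x"
      and z: "\<And>x. x \<notin> \<Omega> \<Longrightarrow> w' x = 0" using X_borel_rep[OF w] by blast
    let ?E = "\<lambda>k. {x. 2 ^ k < cmod (w' x)}"
    define a where "a = (\<lambda>k::nat. measure lborel (?E k))"
    have sub: "?E k \<subseteq> \<Omega>" for k :: nat using z by (force simp: not_less)
    have [measurable]: "?E k \<in> sets borel" for k :: nat by measurable
    have fin: "emeasure lborel (?E k) = ennreal (a k)" for k
    proof -
      have "emeasure lborel (?E k) < \<infinity>"
        using bounded_subset[OF bounded_\<Omega> sub] by (rule emeasure_bounded_finite)
      then show ?thesis unfolding a_def by (intro emeasure_eq_ennreal_measure) simp
    qed
    have a0: "0 \<le> a k" for k by (simp add: a_def)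
    have decay: "a k \<le> K * (1 / 2 powr r) ^ k" for k
      unfolding K_def r_def
    proof (rule level_decay[OF a0 _ D sig])
      have "emeasure lborel (?E 0) \<le> emeasure lborel \<Omega>" using sub[of 0] by (intro emeasure_mono) auto
      then show "a 0 \<le> V" unfolding fin V by (simp add: V_def)
      fix k
      have "a (Suc k) \<le> (D - 1) * (1/4) ^ k * a k powr \<sigma>"
        using level_set_decay[OF w B w' eq z, of k] unfolding a_def D_def \<sigma>_def by simp
      also have "\<dots> \<le> D * (1/4) ^ k * a k powr \<sigma>"
        by (intro mult_right_mono) auto
      finally show "a (Suc k) \<le> D * (1/4) ^ k * a k powr \<sigma>" .
    qed
    have pt: "ennreal (cmod (w' x) powr q)
        \<le> indicator \<Omega> x + (\<Sum>k. ennreal (2 powr (q * (k + 1))) * indicator (?E k) x)" for x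
    proof (cases "cmod (w' x) \<le> 1")
      case True
      show ?thesis
      proof (cases "x \<in> \<Omega>")
        case x: True
        have "cmod (w' x) powr q \<le> 1 powr q" using True q by (intro powr_mono2) auto
        then have "ennreal (cmod (w' x) powr q) \<le> indicator \<Omega> x" using x by simp
        then show ?thesis by (rule order_trans) simp
      next
        case False
        then show ?thesis using z by simp
      qed
    next
      case False
      have "\<exists>k. cmod (w' x) \<le> 2 ^ k" by (meson less_imp_le one_less_numeral_iff real_arch_pow semiring_norm(76))
      \<comment> \<open>The least dyadic bound is not \<open>2 ^ 0\<close>, since the modulus
        exceeds 1; one level below it the point belongs to the level set.\<close>
      define m where "m = (LEAST k. cmod (w' x) \<le> 2 ^ k)"
      have m: "cmod (w' x) \<le> 2 ^ m" unfolding m_def by (rule LeastI_ex) fact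
      have "m \<noteq> 0" using m False by (intro notI) auto
      then obtain k where k: "m = Suc k" by (cases m) auto
      have "\<not> cmod (w' x) \<le> 2 ^ k" using not_less_Least[of k "\<lambda>k. cmod (w' x) \<le> 2 ^ k"] k
        unfolding m_def by auto
      then have xk: "x \<in> ?E k" by simp
      have "cmod (w' x) powr q \<le> (2 ^ Suc k) powr q" using m k q by (intro powr_mono2) auto
      also have "(2 ^ Suc k) powr q = 2 powr (q * (k + 1))"
      proof -
        have "(2::real) ^ Suc k = 2 powr (real k + 1)" by (subst powr_realpow[symmetric]) (auto simp: add.commute)
        then show ?thesis by (simp add: powr_powr mult.commute add.commute)
      qed
      finally have "ennreal (cmod (w' x) powr q) \<le> ennreal (2 powr (q * (k + 1))) * indicator (?E k) x"
        using xk by (simp add: ennreal_leI)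
      also have "\<dots> \<le> (\<Sum>k. ennreal (2 powr (q * (k + 1))) * indicator (?E k) x)"
      proof -
        define h :: "nat \<Rightarrow> ennreal"
          where "h = (\<lambda>k. ennreal (2 powr (q * real (k + 1))) * indicator (?E k) x)"
        have "h k \<le> suminf h" using sum_le_suminf[of h "{k}"] by simp
        then show ?thesis unfolding h_def .
      qed
      finally show ?thesis by (rule order_trans) simp
    qed
    have "(\<integral>\<^sup>+x. ennreal (cmod (w x) powr q) \<partial>lebesgue) = (\<integral>\<^sup>+x. ennreal (cmod (w' x) powr q) \<partial>lebesgue)"
      using eq by (intro nn_integral_cong_AE) (auto elim!: eventually_mono)
    also have "\<dots> = (\<integral>\<^sup>+x. ennreal (cmod (w' x) powr q) \<partial>lborel)" by (rule nn_integral_completion)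
    also have "\<dots> \<le> (\<integral>\<^sup>+x. indicator \<Omega> x + (\<Sum>k. ennreal (2 powr (q * (k + 1))) * indicator (?E k) x) \<partial>lborel)"
      by (intro nn_integral_mono pt)
    also have "\<dots> = emeasure lborel \<Omega> + (\<Sum>k. \<integral>\<^sup>+x. ennreal (2 powr (q * (k + 1))) * indicator (?E k) x \<partial>lborel)"
      by (subst nn_integral_add, measurable) (simp add: nn_integral_suminf)
    also have "\<dots> = ennreal V + (\<Sum>k. ennreal (2 powr (q * (k + 1)) * a k))"
      using a0 by (simp add: nn_integral_cmult_indicator fin V ennreal_mult)
    also have "\<dots> \<le> ennreal V + (\<Sum>k. ennreal (c k))"
    proof (intro add_left_mono suminf_le ennreal_leI)
      fix k
      have e: "2 powr (q * (real k + 1)) = 2 powr q * (2 powr q) ^ k"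
        by (simp add: distrib_left powr_add powr_powr flip: powr_realpow)
      have "2 powr q * (2 powr q) ^ k * a k \<le> 2 powr q * (2 powr q) ^ k * (K * (1 / 2 powr r) ^ k)"
        using decay by (intro mult_left_mono) auto
      also have "\<dots> = c k" by (simp add: c_def power_divide power_one_over)
      finally have "2 powr (q * (real k + 1)) * a k \<le> c k" unfolding e .
      then show "2 powr (q * real (k + 1)) * a k \<le> c k" by (simp add: add.commute)
    qed auto
    also have "\<dots> = ennreal (V + (\<Sum>k. c k))"
      using sum_c K0 by (subst suminf_ennreal2) (auto simp: c_def V_def ennreal_plus suminf_nonneg)
    finally have nn: "(\<integral>\<^sup>+x. ennreal (cmod (w x) powr q) \<partial>lebesgue) \<le> ennreal (V + (\<Sum>k. c k))" .
    have [measurable]: "w \<in> borel_measurable lebesgue" by (rule X_D[OF w])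
    have int: "integrable lebesgue (\<lambda>x. cmod (w x) powr q)"
      by (rule integrableI_bounded) (use nn in \<open>auto intro: order_le_less_trans\<close>)
    moreover have "(\<integral>x. cmod (w x) powr q \<partial>lebesgue) \<le> V + (\<Sum>k. c k)"
    proof -
      have "0 \<le> suminf c" by (rule suminf_nonneg[OF sum_c]) (simp add: c_def K0)
      then have "0 \<le> V + suminf c" by (simp add: V_def)
      then show ?thesis using nn int by (subst (asm) nn_integral_eq_integral) auto
    qed
    ultimately show "integrable lebesgue (\<lambda>x. cmod (w x) powr q) \<and>
        (\<integral>x. cmod (w x) powr q \<partial>lebesgue) \<le> V + (\<Sum>k. c k)" by blast
  qed
qed

end

section \<open>Compactness\<close>

text \<open>The variance identity, by expanding the square. It recovers the L2 norm on a cube from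
  oscillation and a single linear functional, the integral of \<open>g\<close>.\<close>

lemma nn_integral_diff_sq:
  assumes fin: "finite_measure N" and g: "sq_integrable N g"
  shows "(\<integral>\<^sup>+x. \<integral>\<^sup>+y. ennreal ((cmod (g x - g y))\<^sup>2) \<partial>N \<partial>N)
    = ennreal (2 * measure N (space N) * (l2norm N g)\<^sup>2 - 2 * (cmod (\<integral>x. g x \<partial>N))\<^sup>2)"
proof -
  interpret finite_measure N by (rule fin)
  define m where "m = measure N (space N)"
  define S where "S = (l2norm N g)\<^sup>2"
  define c where "c = (\<integral>x. g x \<partial>N)"
  have [measurable]: "g \<in> borel_measurable N" and int2: "integrable N (\<lambda>x. (cmod (g x))\<^sup>2)"
    using g by (auto simp: sq_integrable_def)
  have int1: "integrable N g"
  proof (rule Bochner_Integration.integrable_bound)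
    show "integrable N (\<lambda>x. 1 + (cmod (g x))\<^sup>2)" using int2 by simp
    have "t \<le> 1 + t\<^sup>2" for t :: real
    proof -
      have "0 \<le> (t - 1)\<^sup>2" "0 \<le> t\<^sup>2" by simp_all
      moreover have "(t - 1)\<^sup>2 = t\<^sup>2 + 1 - 2 * t" by (simp add: power2_diff)
      ultimately show ?thesis by linarith
    qed
    then show "AE x in N. norm (g x) \<le> norm (1 + (cmod (g x))\<^sup>2)" by simp
  qed simp
  have expand: "(cmod (a - b))\<^sup>2 = (cmod a)\<^sup>2 + (cmod b)\<^sup>2 - 2 * Re (cnj a * b)" for a b :: complex
    by (simp add: cmod_power2 power2_diff algebra_simps)
  have S: "(\<integral>x. (cmod (g x))\<^sup>2 \<partial>N) = S" by (simp add: S_def l2norm_sq)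
  have int_re: "integrable N (\<lambda>y. Re (a * g y))" "(\<integral>y. Re (a * g y) \<partial>N) = Re (a * c)" for a
  proof -
    have "integrable N (\<lambda>y. a * g y)" using int1 by simp
    then show "integrable N (\<lambda>y. Re (a * g y))" "(\<integral>y. Re (a * g y) \<partial>N) = Re (a * c)"
      using int1 by (auto simp del: times_complex.sel simp: c_def)
  qed
  have i: "integrable N (\<lambda>y. (cmod (g x - g y))\<^sup>2)"
    and sq_eq: "(\<integral>y. (cmod (g x - g y))\<^sup>2 \<partial>N) = m * (cmod (g x))\<^sup>2 + S - 2 * Re (cnj (g x) * c)" for x
  proof -
    show "integrable N (\<lambda>y. (cmod (g x - g y))\<^sup>2)"
      unfolding expand using int2 int_re(1)[of "cnj (g x)"]
      by (intro Bochner_Integration.integrable_diff Bochner_Integration.integrable_add integrable_mult_right) auto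
    show "(\<integral>y. (cmod (g x - g y))\<^sup>2 \<partial>N) = m * (cmod (g x))\<^sup>2 + S - 2 * Re (cnj (g x) * c)"
      unfolding expand using int2 int_re[of "cnj (g x)"]
      by (subst Bochner_Integration.integral_diff) (auto simp: S m_def simp del: times_complex.sel)
  qed
  have inner: "(\<integral>\<^sup>+y. ennreal ((cmod (g x - g y))\<^sup>2) \<partial>N) = ennreal (m * (cmod (g x))\<^sup>2 + S - 2 * Re (cnj (g x) * c))" for x
    using i by (subst nn_integral_eq_integral) (auto simp: sq_eq)
  have nonneg: "0 \<le> m * (cmod (g x))\<^sup>2 + S - 2 * Re (cnj (g x) * c)" for x
    unfolding sq_eq[symmetric] by simp
  have re2: "integrable N (\<lambda>x. Re (cnj (g x) * c))" "(\<integral>x. Re (cnj (g x) * c) \<partial>N) = (cmod c)\<^sup>2"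
  proof -
    have eq: "Re (cnj (g x) * c) = Re (cnj c * g x)" for x by (simp add: mult_ac)
    show "integrable N (\<lambda>x. Re (cnj (g x) * c))" unfolding eq by (rule int_re)
    have "(\<integral>x. Re (cnj (g x) * c) \<partial>N) = Re (cnj c * c)" unfolding eq by (rule int_re)
    also have "\<dots> = (cmod c)\<^sup>2"
      by (simp add: cmod_power2 power2_eq_square[of "Re c"] power2_eq_square[of "Im c"])
    finally show "(\<integral>x. Re (cnj (g x) * c) \<partial>N) = (cmod c)\<^sup>2" .
  qed
  have "(\<integral>\<^sup>+x. \<integral>\<^sup>+y. ennreal ((cmod (g x - g y))\<^sup>2) \<partial>N \<partial>N)
      = (\<integral>\<^sup>+x. ennreal (m * (cmod (g x))\<^sup>2 + S - 2 * Re (cnj (g x) * c)) \<partial>N)"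
    unfolding inner ..
  also have "\<dots> = ennreal (\<integral>x. m * (cmod (g x))\<^sup>2 + S - 2 * Re (cnj (g x) * c) \<partial>N)"
    using nonneg int2 re2(1)
    by (intro nn_integral_eq_integral Bochner_Integration.integrable_diff Bochner_Integration.integrable_add integrable_mult_right) auto
  also have "(\<integral>x. m * (cmod (g x))\<^sup>2 + S - 2 * Re (cnj (g x) * c) \<partial>N) = m * S + m * S - 2 * (cmod c)\<^sup>2"
    using int2 re2
    by (subst Bochner_Integration.integral_diff) (auto simp: S m_def mult.commute simp del: times_complex.sel)
  finally show ?thesis by (simp add: m_def S_def c_def mult.assoc)
qed

text \<open>Half-open cubes tile the space without overlap, and the index of the cube containing a
  point is its vector of floors.\<close>

definition cell :: "real \<Rightarrow> ('n \<Rightarrow> int) \<Rightarrow> (real^'n) set" where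
  "cell \<delta> j = {x. \<forall>i. of_int (j i) * \<delta> \<le> x $ i \<and> x $ i < (of_int (j i) + 1) * \<delta>}"

lemma cell_iff:
  assumes "0 < \<delta>"
  shows "x \<in> cell \<delta> j \<longleftrightarrow> j = (\<lambda>i. \<lfloor>x $ i / \<delta>\<rfloor>)"
proof -
  have "of_int k * \<delta> \<le> t \<and> t < (of_int k + 1) * \<delta> \<longleftrightarrow> k = \<lfloor>t / \<delta>\<rfloor>" for k t
    using assms floor_eq_iff[of "t / \<delta>" k] by (auto simp: field_simps)
  then show ?thesis unfolding cell_def by (auto simp: fun_eq_iff)
qed

lemma borel_cell [measurable]: "cell \<delta> j \<in> sets borel"
proof -
  have "(\<lambda>x::real^'n. x $ i) \<in> borel_measurable borel" for i
    by (intro borel_measurable_continuous_onI continuous_intros)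
  note [measurable] = this
  show ?thesis unfolding cell_def by measurable
qed

lemma emeasure_cell:
  assumes "0 < \<delta>"
  shows "emeasure lborel (cell \<delta> j :: (real^'n) set) = ennreal (\<delta> ^ CARD('n))"
proof -
  define a b :: "real^'n" where "a = (\<chi> i. of_int (j i) * \<delta>)" and "b = (\<chi> i. (of_int (j i) + 1) * \<delta>)"
  have ab: "a $ i \<le> b $ i" "b $ i - a $ i = \<delta>" for i using assms by (auto simp: a_def b_def algebra_simps)
  have le: "a \<bullet> i \<le> b \<bullet> i" if "i \<in> Basis" for i
    using that ab(1) by (auto simp: Basis_vec_def inner_axis)
  have prod: "(\<Prod>i\<in>Basis. (b - a) \<bullet> i) = \<delta> ^ CARD('n)"
  proof -
    have "(\<Prod>i\<in>Basis. (b - a) \<bullet> i) = (\<Prod>i\<in>(Basis::(real^'n) set). \<delta>)"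
      by (intro prod.cong) (auto simp: Basis_vec_def inner_axis ab)
    then show ?thesis by simp
  qed
  have sub: "box a b \<subseteq> cell \<delta> j" "cell \<delta> j \<subseteq> cbox a b"
    by (auto simp: cell_def mem_box_cart a_def b_def less_imp_le)
  have eq: "emeasure lborel (box a b) = ennreal (\<delta> ^ CARD('n))"
    "emeasure lborel (cbox a b) = ennreal (\<delta> ^ CARD('n))"
    using le by (auto simp: emeasure_lborel_box emeasure_lborel_cbox prod)
  show ?thesis
    using emeasure_mono[OF sub(1), of lborel] emeasure_mono[OF sub(2), of lborel] eq by auto
qed

lemma norm_diff_cell_le:
  fixes x y :: "real^'n"
  assumes "x \<in> cell \<delta> j" "y \<in> cell \<delta> j"
  shows "norm (x - y) \<le> real CARD('n) * \<delta>"
proof -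
  have "norm (x - y) \<le> (\<Sum>i\<in>UNIV. \<bar>(x - y) $ i\<bar>)" by (rule norm_le_l1_cart)
  also have "\<dots> \<le> (\<Sum>i\<in>(UNIV::'n set). \<delta>)"
  proof (rule sum_mono)
    fix i
    have "of_int (j i) * \<delta> \<le> x $ i" "x $ i < of_int (j i) * \<delta> + \<delta>"
      "of_int (j i) * \<delta> \<le> y $ i" "y $ i < of_int (j i) * \<delta> + \<delta>"
      using assms by (auto simp: cell_def distrib_right)
    then show "\<bar>(x - y) $ i\<bar> \<le> \<delta>" by auto
  qed
  finally show ?thesis by simp
qed

abbreviation cell_ind :: "real \<Rightarrow> ('n \<Rightarrow> int) \<Rightarrow> real^'n \<Rightarrow> complex" where
  "cell_ind \<delta> j \<equiv> \<lambda>x. of_real (indicator (cell \<delta> j) x)"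

section \<open>Compactness through averages over small cubes\<close>

context magnetic_space
begin

text \<open>A Poincare inequality with mean on a cube. The variance identity involves plain
  differences; inside the cube these are magnetic differences up to a phase error, at most the
  angle, which is at most the diameter bound n \<delta> times \<open>b\<close>. The kernel is at
  most its value at distance n \<delta>.\<close>

lemma cell_estimate:
  fixes w :: "real^'n \<Rightarrow> complex" and A' :: "real^'n \<Rightarrow> real^'n"
  assumes \<delta>: "0 < \<delta>" and w [measurable]: "w \<in> borel_measurable borel"
    and A' [measurable]: "A' \<in> borel_measurable borel"
    and int: "integrable lborel (\<lambda>x. (cmod (w x))\<^sup>2 * indicator (cell \<delta> j) x)"
    and b: "0 \<le> b" "\<And>x y. x \<in> cell \<delta> j \<Longrightarrow> y \<in> cell \<delta> j \<Longrightarrow> norm (A' ((x + y) /\<^sub>R 2)) \<le> b"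
  defines "n \<equiv> real CARD('n)" and "m \<equiv> \<delta> ^ CARD('n)"
    and "S \<equiv> \<integral>x. (cmod (w x))\<^sup>2 * indicator (cell \<delta> j) x \<partial>lborel"
    and "c \<equiv> \<integral>x. indicator (cell \<delta> j) x *\<^sub>R w x \<partial>lborel"
  shows "ennreal (2 * m * S) \<le> ennreal (2 * (n * \<delta>) powr (n + 2 * s)) *
      (\<integral>\<^sup>+x\<in>cell \<delta> j. (\<integral>\<^sup>+y. ennreal ((cmod (mag_diff A' w x y))\<^sup>2 / mag_kernel s x y) \<partial>lborel) \<partial>lborel)
      + ennreal (2 * (n * \<delta> * b)\<^sup>2 * m * S + 2 * (cmod c)\<^sup>2)"
proof -
  let ?D = "\<lambda>x y. ennreal ((cmod (mag_diff A' w x y))\<^sup>2 / mag_kernel s x y)"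
  let ?DD = "\<lambda>x. \<integral>\<^sup>+y. ?D x y \<partial>lborel"
  let ?k = "ennreal (2 * (n * \<delta>) powr (n + 2 * s))"
  have m: "0 < m" using \<delta> by (simp add: m_def)
  let ?Q = "cell \<delta> j"
  let ?N = "restrict_space lborel ?Q"
  have sp: "space ?N = ?Q" by (simp add: space_restrict_space)
  have fm: "finite_measure ?N"
    by (rule finite_measureI) (use \<delta> in \<open>simp add: sp emeasure_restrict_space emeasure_cell\<close>)
  have mN: "measure ?N (space ?N) = m"
    using \<delta> by (simp add: sp measure_restrict_space) (simp add: measure_def emeasure_cell m_def)
  have sq: "sq_integrable ?N w"
    unfolding sq_integrable_def using int
    by (auto simp: integrable_restrict_space mult.commute intro!: measurable_restrict_space1)
  have N2: "(l2norm ?N w)\<^sup>2 = S"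
    unfolding l2norm_sq S_def by (subst integral_restrict_space) (auto simp: mult.commute)
  have cN: "(\<integral>x. w x \<partial>?N) = c" unfolding c_def by (subst integral_restrict_space) auto
  have "ennreal (2 * m * S - 2 * (cmod c)\<^sup>2)
    = (\<integral>\<^sup>+x. \<integral>\<^sup>+y. ennreal ((cmod (w x - w y))\<^sup>2) \<partial>?N \<partial>?N)"
    using nn_integral_diff_sq[OF fm sq] unfolding mN N2 cN by simp
  also have "\<dots> = (\<integral>\<^sup>+x\<in>?Q. \<integral>\<^sup>+y\<in>?Q. ennreal ((cmod (w x - w y))\<^sup>2) \<partial>lborel \<partial>lborel)"
    by (simp add: nn_integral_restrict_space)
  also have "\<dots> \<le> (\<integral>\<^sup>+x\<in>?Q. (?k * ?DD x
      + ennreal (2 * (n * \<delta> * b)\<^sup>2 * S)) \<partial>lborel)"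
  proof (rule nn_integral_mono)
    fix x
    show "(\<integral>\<^sup>+y\<in>?Q. ennreal ((cmod (w x - w y))\<^sup>2) \<partial>lborel) * indicator ?Q x
      \<le> (?k * ?DD x
        + ennreal (2 * (n * \<delta> * b)\<^sup>2 * S)) * indicator ?Q x"
    proof (cases "x \<in> ?Q")
      case x: True
      have "(\<integral>\<^sup>+y\<in>?Q. ennreal ((cmod (w x - w y))\<^sup>2) \<partial>lborel)
        \<le> (\<integral>\<^sup>+y. ?k * ?D x y
             + ennreal (2 * (n * \<delta> * b)\<^sup>2 * ((cmod (w y))\<^sup>2 * indicator ?Q y)) \<partial>lborel)"
      proof (rule nn_integral_mono)
        fix y
        show "ennreal ((cmod (w x - w y))\<^sup>2) * indicator ?Q y
          \<le> ?k * ?D x y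
             + ennreal (2 * (n * \<delta> * b)\<^sup>2 * ((cmod (w y))\<^sup>2 * indicator ?Q y))"
        proof (cases "y \<in> ?Q")
          case y: True
          define \<theta> where "\<theta> = (x - y) \<bullet> A' ((x + y) /\<^sub>R 2)"
          have nxy: "norm (x - y) \<le> n * \<delta>" unfolding n_def by (rule norm_diff_cell_le[OF x y])
          have "norm (A' ((x + y) /\<^sub>R 2)) \<le> b" by (rule b(2)[OF x y])
          then have "\<bar>\<theta>\<bar> \<le> n * \<delta> * b"
            unfolding \<theta>_def using Cauchy_Schwarz_ineq2[of "x - y" "A' ((x + y) /\<^sub>R 2)"] nxy b(1) \<delta>
            by (meson mult_mono norm_ge_zero order_trans mult_nonneg_nonneg)
          moreover have "cmod (exp (\<i> * of_real \<theta>) - 1) \<le> \<bar>\<theta>\<bar>"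
            using dist_exp_i_1[of \<theta>] abs_sin_le_one abs_sin_x_le_abs_x[of "\<theta> / 2"]
            by (simp add: mult.commute)
          ultimately have e: "cmod (exp (\<i> * of_real \<theta>) - 1) \<le> n * \<delta> * b" by linarith
          \<comment> \<open>Splits off the phase: the plain difference is the magnetic one minus a
            term with the small factor 1 - exp(i \<theta>).\<close>
          have "w x - w y = mag_diff A' w x y - (1 - exp (\<i> * of_real \<theta>)) * w y"
            by (simp add: mag_diff_def \<theta>_def algebra_simps)
          then have "(cmod (w x - w y))\<^sup>2 \<le> 2 * (cmod (mag_diff A' w x y))\<^sup>2
              + 2 * (cmod ((1 - exp (\<i> * of_real \<theta>)) * w y))\<^sup>2"
            by (metis cmod_diff_sq_le)
          also have "(cmod ((1 - exp (\<i> * of_real \<theta>)) * w y))\<^sup>2 \<le> (n * \<delta> * b)\<^sup>2 * (cmod (w y))\<^sup>2"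
            using power_mono[OF e, of 2] unfolding norm_mult power_mult_distrib[of "cmod _"] norm_minus_commute[of 1]
            by (intro mult_right_mono) auto
          also have "(cmod (mag_diff A' w x y))\<^sup>2
              \<le> (n * \<delta>) powr (n + 2 * s) * ((cmod (mag_diff A' w x y))\<^sup>2 / mag_kernel s x y)"
          proof (cases "x = y")
            case True
            then show ?thesis by (simp add: mag_diff_def)
          next
            case False
            then have k: "0 < mag_kernel s x y" by (simp add: mag_kernel_def)
            have "mag_kernel s x y \<le> (n * \<delta>) powr (n + 2 * s)"
              unfolding mag_kernel_def n_def[symmetric] using nxy s_pos by (intro powr_mono2) (auto simp: n_def)
            then have "(cmod (mag_diff A' w x y))\<^sup>2 / mag_kernel s x y * mag_kernel s x y
              \<le> (cmod (mag_diff A' w x y))\<^sup>2 / mag_kernel s x y * (n * \<delta>) powr (n + 2 * s)"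
              using k by (intro mult_left_mono) auto
            then show ?thesis using k by (simp add: mult.commute)
          qed
          finally have "(cmod (w x - w y))\<^sup>2
            \<le> 2 * (n * \<delta>) powr (n + 2 * s) * ((cmod (mag_diff A' w x y))\<^sup>2 / mag_kernel s x y)
              + 2 * (n * \<delta> * b)\<^sup>2 * (cmod (w y))\<^sup>2" by simp
          then show ?thesis using y
            by (simp add: ennreal_mult[symmetric] ennreal_plus[symmetric] ennreal_leI del: ennreal_plus)
        qed simp
      qed
      also have "\<dots> = ?k * ?DD x
        + ennreal (2 * (n * \<delta> * b)\<^sup>2 * S)"
      proof -
        have [measurable]: "(\<lambda>y. (cmod (mag_diff A' w x y))\<^sup>2 / mag_kernel s x y) \<in> borel_measurable borel"
          unfolding mag_diff_def mag_kernel_def by measurable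
        have "(\<integral>\<^sup>+y. ennreal (2 * (n * \<delta> * b)\<^sup>2 * ((cmod (w y))\<^sup>2 * indicator ?Q y)) \<partial>lborel)
            = ennreal (2 * (n * \<delta> * b)\<^sup>2 * S)"
          unfolding S_def using int by (subst nn_integral_eq_integral) auto
        then show ?thesis by (subst nn_integral_add) (auto intro!: nn_integral_cmult)
      qed
      finally show ?thesis using x by simp
    qed simp
  qed
  also have "\<dots> = ?k * (\<integral>\<^sup>+x\<in>?Q. ?DD x \<partial>lborel)
      + ennreal (2 * (n * \<delta> * b)\<^sup>2 * m * S)"
  proof -
    have [measurable]: "(\<lambda>x. ?DD x) \<in> borel_measurable borel"
      unfolding mag_diff_def mag_kernel_def by measurable
    have "ennreal (2 * (n * \<delta> * b)\<^sup>2 * m * S) = ennreal (2 * (n * \<delta> * b)\<^sup>2 * S) * ennreal m"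
      using m by (subst ennreal_mult[symmetric]) (auto simp: S_def mult_ac)
    then show ?thesis using \<delta>
      by (simp add: distrib_right nn_integral_add nn_integral_cmult nn_integral_cmult_indicator
          emeasure_cell m_def mult.assoc)
  qed
  finally have *: "ennreal (2 * m * S - 2 * (cmod c)\<^sup>2) \<le>
    ?k * (\<integral>\<^sup>+x\<in>?Q. ?DD x \<partial>lborel)
      + ennreal (2 * (n * \<delta> * b)\<^sup>2 * m * S)" .
  have S0: "0 \<le> S" by (simp add: S_def)
  \<comment> \<open>Truncation of negative reals to 0 in \<open>ennreal\<close> does no harm: in
    that case 2 m S is already below the mean term.\<close>
  have "ennreal (2 * m * S) \<le> ennreal (2 * m * S - 2 * (cmod c)\<^sup>2) + ennreal (2 * (cmod c)\<^sup>2)"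
  proof (cases "0 \<le> 2 * m * S - 2 * (cmod c)\<^sup>2")
    case True
    then show ?thesis by (subst ennreal_plus[symmetric]) auto
  next
    case False
    then show ?thesis by (simp add: ennreal_neg ennreal_leI)
  qed
  also have "\<dots> \<le> ?k * (\<integral>\<^sup>+x\<in>?Q. ?DD x \<partial>lborel)
      + ennreal (2 * (n * \<delta> * b)\<^sup>2 * m * S) + ennreal (2 * (cmod c)\<^sup>2)"
    by (intro add_right_mono *)
  also have "\<dots> = ?k * (\<integral>\<^sup>+x\<in>?Q. ?DD x \<partial>lborel)
      + ennreal (2 * (n * \<delta> * b)\<^sup>2 * m * S + 2 * (cmod c)\<^sup>2)"
    using m S0 by (simp add: ennreal_plus add.assoc)
  finally show ?thesis .
qed

text \<open>Summation over cubes: they are disjoint, so the restricted energies add up to at most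
  the whole seminorm, and the averages are pairings with indicators of cubes. The phase error,
  \<delta>^2 times the squared L2 norm, is absorbed by the Poincare inequality.\<close>

lemma X_cell_estimate:
  obtains C where "0 \<le> C"
    "\<And>\<delta>. 0 < \<delta> \<Longrightarrow> \<delta> \<le> 1 \<Longrightarrow> \<exists>J. finite J \<and> (\<forall>z\<in>X. (l2norm lebesgue z)\<^sup>2 \<le>
      C * (\<delta> powr (2 * s) + \<delta>\<^sup>2) * (Xnorm z)\<^sup>2
        + (\<Sum>j\<in>J. (cmod (l2inner lebesgue z (cell_ind \<delta> j)))\<^sup>2) / \<delta> ^ CARD('n))"
proof -
  obtain R where R: "R > 0" "\<Omega> \<subseteq> cball 0 R"
    using bounded_\<Omega> unfolding bounded_pos by (auto simp: subset_iff)
  let ?n = "real CARD('n)"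
  \<comment> \<open>In the cubes used below every coordinate is at most R + 1 in modulus, because
    \<delta> <= 1; passing from coordinates to the norm costs the factor n.\<close>
  define \<rho> where "\<rho> = ?n * (R + 1)"
  obtain A' b where A' [measurable]: "A' \<in> borel_measurable borel" and eqA: "AE x in lebesgue. A x = A' x"
    and b: "0 \<le> b" "\<And>x. x \<in> cball 0 \<rho> \<Longrightarrow> norm (A' x) \<le> b"
    using A_borel_rep[of "cball 0 \<rho>"] by auto
  obtain P where P: "0 < P" "\<And>w. w \<in> X \<Longrightarrow> l2norm lebesgue w \<le> P * Xnorm w"
    using X_poincare by blast
  define C where "C = ?n powr (?n + 2 * s) + (?n * b)\<^sup>2 * P\<^sup>2"
  show ?thesis
  proof
    show "0 \<le> C" by (simp add: C_def)
    fix \<delta> :: real assume \<delta>: "0 < \<delta>" "\<delta> \<le> 1"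
    \<comment> \<open>The index vectors whose entries lie between the floors of -R/\<delta> and
      R/\<delta>: a finite box whose cubes cover \<Omega>.\<close>
    define J :: "('n \<Rightarrow> int) set" where "J = {j. \<forall>i. j i \<in> {\<lfloor>- R / \<delta>\<rfloor>..\<lfloor>R / \<delta>\<rfloor>}}"
    define m where "m = \<delta> ^ CARD('n)"
    have m: "0 < m" using \<delta> by (simp add: m_def)
    have J: "finite J"
    proof -
      have "finite {j :: 'n \<Rightarrow> int. \<forall>x. (x \<in> UNIV \<longrightarrow> j x \<in> {\<lfloor>- R / \<delta>\<rfloor>..\<lfloor>R / \<delta>\<rfloor>}) \<and> (x \<notin> UNIV \<longrightarrow> j x = 0)}"
        by (rule finite_set_of_finite_funs) auto
      then show ?thesis by (simp add: J_def)
    qed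
    have cover: "\<exists>j\<in>J. x \<in> cell \<delta> j" if x: "x \<in> \<Omega>" for x
    proof
      have "norm x \<le> R" using R x by auto
      then have "\<bar>x $ i\<bar> \<le> R" for i using component_le_norm_cart[of x i] by linarith
      then have "- R \<le> x $ i" "x $ i \<le> R" for i by (auto simp: abs_le_iff minus_le_iff)
      then have "- R / \<delta> \<le> x $ i / \<delta>" "x $ i / \<delta> \<le> R / \<delta>" for i
        using \<delta> by (intro divide_right_mono; simp)+
      then show "(\<lambda>i. \<lfloor>x $ i / \<delta>\<rfloor>) \<in> J" by (auto simp: J_def intro: floor_mono)
      show "x \<in> cell \<delta> (\<lambda>i. \<lfloor>x $ i / \<delta>\<rfloor>)" using \<delta> by (simp add: cell_iff)
    qed
    have disj: "(\<Sum>j\<in>J. indicator (cell \<delta> j) x) \<le> (1::ennreal)" for x :: "real^'n"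
    proof -
      have "(\<Sum>j\<in>J. indicator (cell \<delta> j) x) = (\<Sum>j\<in>J. if j = (\<lambda>i. \<lfloor>x $ i / \<delta>\<rfloor>) then 1 else (0::ennreal))"
        using \<delta> by (intro sum.cong) (auto simp: indicator_def cell_iff)
      also have "\<dots> \<le> 1" using J by simp
      finally show ?thesis .
    qed
    have in_ball: "x \<in> cball 0 \<rho>" if "x \<in> cell \<delta> j" "j \<in> J" for x j
    proof -
      have "norm x \<le> (\<Sum>i\<in>UNIV. \<bar>x $ i\<bar>)" by (rule norm_le_l1_cart)
      also have "\<dots> \<le> (\<Sum>i\<in>(UNIV::'n set). R + 1)"
      proof (rule sum_mono)
        fix i
        have j: "\<lfloor>- R / \<delta>\<rfloor> \<le> j i" "j i \<le> \<lfloor>R / \<delta>\<rfloor>" using that by (auto simp: J_def)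
        have "of_int (j i) \<le> R / \<delta>" using j(2) by linarith
        then have u: "of_int (j i) * \<delta> \<le> R" using \<delta> by (simp add: field_simps)
        have "- R / \<delta> - 1 \<le> of_int (j i)" using j(1) by linarith
        then have l: "- R - \<delta> \<le> of_int (j i) * \<delta>" using \<delta> by (simp add: field_simps)
        have "of_int (j i) * \<delta> \<le> x $ i" "x $ i < of_int (j i) * \<delta> + \<delta>"
          using that by (auto simp: cell_def distrib_right)
        then show "\<bar>x $ i\<bar> \<le> R + 1" using u l \<delta> by auto
      qed
      finally show ?thesis by (simp add: \<rho>_def)
    qed
    show "\<exists>J. finite J \<and> (\<forall>z\<in>X. (l2norm lebesgue z)\<^sup>2 \<le>
      C * (\<delta> powr (2 * s) + \<delta>\<^sup>2) * (Xnorm z)\<^sup>2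
        + (\<Sum>j\<in>J. (cmod (l2inner lebesgue z (cell_ind \<delta> j)))\<^sup>2) / \<delta> ^ CARD('n))"
    proof (intro exI conjI ballI)
      show "finite J" by (rule J)
      fix z assume zX: "z \<in> X"
      obtain w where w [measurable]: "w \<in> borel_measurable borel" and eq: "AE x in lebesgue. z x = w x"
        and w0: "\<And>x. x \<notin> \<Omega> \<Longrightarrow> w x = 0" using X_borel_rep[OF zX] by blast
      define c where "c j = l2inner lebesgue z (cell_ind \<delta> j)" for j
      define S where "S j = (\<integral>x. (cmod (w x))\<^sup>2 * indicator (cell \<delta> j) x \<partial>lborel)" for j
      let ?D = "\<lambda>x. \<integral>\<^sup>+y. ennreal ((cmod (mag_diff A' w x y))\<^sup>2 / mag_kernel s x y) \<partial>lborel"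
      let ?k = "ennreal (2 * (?n * \<delta>) powr (?n + 2 * s))"
      have z2: "integrable lebesgue (\<lambda>x. (cmod (z x))\<^sup>2)" and [measurable]: "z \<in> borel_measurable lebesgue"
        using X_D(1)[OF zX] by (auto simp: sq_integrable_def)
      have wl [measurable]: "w \<in> borel_measurable lebesgue" by (simp add: measurable_completion)
      have w2': "integrable lebesgue (\<lambda>x. (cmod (w x))\<^sup>2)"
        using eq by (intro integrable_cong_AE_imp[OF z2]) (auto elim!: eventually_mono)
      then have w2: "integrable lborel (\<lambda>x. (cmod (w x))\<^sup>2)"
        by (simp add: integrable_completion)
      have S_int: "integrable lborel (\<lambda>x. (cmod (w x))\<^sup>2 * indicator (cell \<delta> j) x)" for j
        using integrable_mult_indicator[OF _ w2, of "cell \<delta> j"] by (simp add: mult.commute)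
      have norm_eq: "(l2norm lebesgue z)\<^sup>2 = (\<integral>x. (cmod (w x))\<^sup>2 \<partial>lborel)"
      proof -
        have "(l2norm lebesgue z)\<^sup>2 = (\<integral>x. (cmod (w x))\<^sup>2 \<partial>lebesgue)"
          unfolding l2norm_sq using eq by (intro integral_cong_AE) (auto elim!: eventually_mono)
        then show ?thesis by (simp add: integral_completion)
      qed
      have sumS: "(\<Sum>j\<in>J. S j) = (l2norm lebesgue z)\<^sup>2"
      proof -
        have "(\<Sum>j\<in>J. S j) = (\<integral>x. (\<Sum>j\<in>J. (cmod (w x))\<^sup>2 * indicator (cell \<delta> j) x) \<partial>lborel)"
          unfolding S_def using S_int by (subst Bochner_Integration.integral_sum) auto
        also have "\<dots> = (\<integral>x. (cmod (w x))\<^sup>2 \<partial>lborel)"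
        proof (rule Bochner_Integration.integral_cong[OF refl])
          fix x
          show "(\<Sum>j\<in>J. (cmod (w x))\<^sup>2 * indicator (cell \<delta> j) x) = (cmod (w x))\<^sup>2"
          proof (cases "x \<in> \<Omega>")
            case True
            have ix: "(\<lambda>i. \<lfloor>x $ i / \<delta>\<rfloor>) \<in> J" using cover[OF True] \<delta> by (auto simp: cell_iff)
            have "(\<Sum>j\<in>J. (cmod (w x))\<^sup>2 * indicator (cell \<delta> j) x)
                = (\<Sum>j\<in>J. if j = (\<lambda>i. \<lfloor>x $ i / \<delta>\<rfloor>) then (cmod (w x))\<^sup>2 else 0)"
              using \<delta> by (intro sum.cong) (auto simp: indicator_def cell_iff)
            also have "\<dots> = (cmod (w x))\<^sup>2" using J ix by simp
            finally show ?thesis .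
          qed (simp add: w0)
        qed
        finally show ?thesis using norm_eq by simp
      qed
      have c_eq: "c j = (\<integral>x. indicator (cell \<delta> j) x *\<^sub>R w x \<partial>lborel)" for j
      proof -
        have "c j = (\<integral>x. indicator (cell \<delta> j) x *\<^sub>R w x \<partial>lebesgue)"
          unfolding c_def l2inner_def
        proof (rule integral_cong_AE)
          have [measurable]: "cell \<delta> j \<in> sets lebesgue" by simp
          show "(\<lambda>x. z x * cnj (of_real (indicator (cell \<delta> j) x))) \<in> borel_measurable lebesgue"
            "(\<lambda>x. indicator (cell \<delta> j) x *\<^sub>R w x) \<in> borel_measurable lebesgue" by measurable
          show "AE x in lebesgue. z x * cnj (of_real (indicator (cell \<delta> j) x)) = indicator (cell \<delta> j) x *\<^sub>R w x"
            using eq by eventually_elim (simp add: indicator_def)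
        qed
        also have "\<dots> = (\<integral>x. indicator (cell \<delta> j) x *\<^sub>R w x \<partial>lborel)"
          by (rule integral_completion) measurable
        finally show ?thesis .
      qed
      have cell_est: "ennreal (2 * m * S j) \<le> ?k * (\<integral>\<^sup>+x\<in>cell \<delta> j. ?D x \<partial>lborel)
          + ennreal (2 * (?n * \<delta> * b)\<^sup>2 * m * S j + 2 * (cmod (c j))\<^sup>2)" if j: "j \<in> J" for j
      proof -
        have "norm (A' ((x + y) /\<^sub>R 2)) \<le> b" if "x \<in> cell \<delta> j" "y \<in> cell \<delta> j" for x y
        proof (rule b(2))
          show "(x + y) /\<^sub>R 2 \<in> cball 0 \<rho>"
            using in_ball[OF that(1) j] in_ball[OF that(2) j] norm_triangle_ineq[of x y] by simp
        qed
        from cell_estimate[OF \<delta>(1) w A' S_int b(1) this]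
        show ?thesis by (simp only: S_def m_def c_eq)
      qed
      have [measurable]: "(\<lambda>x. ?D x) \<in> borel_measurable borel"
        unfolding mag_diff_def mag_kernel_def by measurable
      let ?N = "(l2norm lebesgue z)\<^sup>2"
      have S0: "0 \<le> S j" for j by (simp add: S_def)
      have "ennreal (2 * m * ?N) = (\<Sum>j\<in>J. ennreal (2 * m * S j))"
        unfolding sumS[symmetric] sum_distrib_left using m S0 by (subst sum_ennreal) auto
      also have "\<dots> \<le> (\<Sum>j\<in>J. ?k * (\<integral>\<^sup>+x\<in>cell \<delta> j. ?D x \<partial>lborel)
          + ennreal (2 * (?n * \<delta> * b)\<^sup>2 * m * S j + 2 * (cmod (c j))\<^sup>2))"
        by (intro sum_mono cell_est)
      also have "\<dots> = ?k * (\<Sum>j\<in>J. \<integral>\<^sup>+x\<in>cell \<delta> j. ?D x \<partial>lborel)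
          + ennreal (2 * (?n * \<delta> * b)\<^sup>2 * m * ?N + 2 * (\<Sum>j\<in>J. (cmod (c j))\<^sup>2))"
        unfolding sum.distrib sum_distrib_left[symmetric] sumS[symmetric]
        using m S0 by (subst sum_ennreal) (auto simp: sum.distrib sum_distrib_left)
      also have "(\<Sum>j\<in>J. \<integral>\<^sup>+x\<in>cell \<delta> j. ?D x \<partial>lborel)
          = (\<integral>\<^sup>+x. ?D x * (\<Sum>j\<in>J. indicator (cell \<delta> j) x) \<partial>lborel)"
        unfolding sum_distrib_left by (subst nn_integral_sum) auto
      also have "\<dots> \<le> (\<integral>\<^sup>+x. ?D x * 1 \<partial>lborel)"
        by (intro nn_integral_mono mult_left_mono disj) auto
      also have "\<dots> = ennreal ((Xnorm z)\<^sup>2)"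
        using Xnorm_sq_nn_integral[OF zX w eq A' eqA] by simp
      finally have "ennreal (2 * m * ?N) \<le> ?k * ennreal ((Xnorm z)\<^sup>2)
          + ennreal (2 * (?n * \<delta> * b)\<^sup>2 * m * ?N + 2 * (\<Sum>j\<in>J. (cmod (c j))\<^sup>2))"
        by (simp add: mult_left_mono)
      then have "ennreal (2 * m * ?N) \<le> ennreal (2 * (?n * \<delta>) powr (?n + 2 * s) * (Xnorm z)\<^sup>2
          + (2 * (?n * \<delta> * b)\<^sup>2 * m * ?N + 2 * (\<Sum>j\<in>J. (cmod (c j))\<^sup>2)))"
        using m by (subst ennreal_plus) (auto simp: ennreal_mult sum_nonneg)
      then have "2 * m * ?N \<le> 2 * (?n * \<delta>) powr (?n + 2 * s) * (Xnorm z)\<^sup>2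
          + (2 * (?n * \<delta> * b)\<^sup>2 * m * ?N + 2 * (\<Sum>j\<in>J. (cmod (c j))\<^sup>2))"
        using m by (subst (asm) ennreal_le_iff) (auto intro!: add_nonneg_nonneg sum_nonneg mult_nonneg_nonneg)
      then have "m * ?N \<le> (?n * \<delta>) powr (?n + 2 * s) * (Xnorm z)\<^sup>2
          + ((?n * \<delta> * b)\<^sup>2 * m * ?N + (\<Sum>j\<in>J. (cmod (c j))\<^sup>2))" by linarith
      also have "(?n * \<delta>) powr (?n + 2 * s) = m * (?n powr (?n + 2 * s) * \<delta> powr (2 * s))"
        using \<delta> by (simp add: powr_mult powr_add m_def powr_realpow mult_ac)
      finally have "m * ?N \<le> m * (?n powr (?n + 2 * s) * \<delta> powr (2 * s) * (Xnorm z)\<^sup>2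
          + (?n * \<delta> * b)\<^sup>2 * ?N + (\<Sum>j\<in>J. (cmod (c j))\<^sup>2) / m)"
        using m by (simp add: algebra_simps)
      then have "?N \<le> ?n powr (?n + 2 * s) * \<delta> powr (2 * s) * (Xnorm z)\<^sup>2
          + (?n * \<delta> * b)\<^sup>2 * ?N + (\<Sum>j\<in>J. (cmod (c j))\<^sup>2) / m"
        using m by simp
      also have "(?n * \<delta> * b)\<^sup>2 * ?N \<le> (?n * \<delta> * b)\<^sup>2 * (P * Xnorm z)\<^sup>2"
        using P(2)[OF zX] by (intro mult_left_mono power_mono) auto
      also have "?n powr (?n + 2 * s) * \<delta> powr (2 * s) * (Xnorm z)\<^sup>2 + (?n * \<delta> * b)\<^sup>2 * (P * Xnorm z)\<^sup>2
        \<le> C * (\<delta> powr (2 * s) + \<delta>\<^sup>2) * (Xnorm z)\<^sup>2"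
        unfolding C_def by (simp add: algebra_simps power_mult_distrib)
      finally show "?N \<le> C * (\<delta> powr (2 * s) + \<delta>\<^sup>2) * (Xnorm z)\<^sup>2
        + (\<Sum>j\<in>J. (cmod (l2inner lebesgue z (cell_ind \<delta> j)))\<^sup>2) / \<delta> ^ CARD('n)"
        unfolding c_def m_def by simp
    qed
  qed
qed

text \<open>An Ehrling-type inequality: a small \<delta> pushes the energy factor below
  \<open>e\<close>, at the price of a large constant in front of finitely many functionals. It
  expresses compactness of the embedding without sequences.\<close>

lemma X_finite_rank_estimate:
  assumes "0 < e"
  shows "\<exists>(J :: ('n \<Rightarrow> int) set) h c. finite J \<and> 0 \<le> c \<and>
    (\<forall>j. sq_integrable lebesgue (h j) \<and> l2norm lebesgue (h j) \<le> 1) \<and>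
    (\<forall>z\<in>X. (l2norm lebesgue z)\<^sup>2 \<le> e * (Xnorm z)\<^sup>2 + c * (\<Sum>j\<in>J. (cmod (l2inner lebesgue z (h j)))\<^sup>2))"
proof -
  obtain C where C: "0 \<le> C"
    "\<And>\<delta>. 0 < \<delta> \<Longrightarrow> \<delta> \<le> 1 \<Longrightarrow> \<exists>J. finite J \<and> (\<forall>z\<in>X. (l2norm lebesgue z)\<^sup>2 \<le>
      C * (\<delta> powr (2 * s) + \<delta>\<^sup>2) * (Xnorm z)\<^sup>2
        + (\<Sum>j\<in>J. (cmod (l2inner lebesgue z (cell_ind \<delta> j)))\<^sup>2) / \<delta> ^ CARD('n))"
    using X_cell_estimate by blast
  have "((\<lambda>\<delta>. C * (\<delta> powr (2 * s) + \<delta>\<^sup>2)) \<longlongrightarrow> C * (0 powr (2 * s) + 0\<^sup>2)) (at_right 0)"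
    using s_pos by (intro tendsto_intros) (auto simp: eventually_at_filter)
  then have "\<forall>\<^sub>F \<delta> in at_right 0. C * (\<delta> powr (2 * s) + \<delta>\<^sup>2) < e"
    using assms by (intro order_tendstoD(2)) auto
  moreover have "\<forall>\<^sub>F \<delta>::real in at_right 0. \<delta> \<in> {0<..<1}"
    by (rule eventually_at_right_real) simp
  ultimately have "\<forall>\<^sub>F \<delta> in at_right 0. C * (\<delta> powr (2 * s) + \<delta>\<^sup>2) < e \<and> \<delta> \<in> {0<..<1}"
    by eventually_elim simp
  then obtain \<delta> where \<delta>: "C * (\<delta> powr (2 * s) + \<delta>\<^sup>2) < e" "0 < \<delta>" "\<delta> < 1"
    using eventually_happens'[OF trivial_limit_at_right_real] by force
  obtain J where J: "finite J" "\<And>z. z \<in> X \<Longrightarrow> (l2norm lebesgue z)\<^sup>2 \<le>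
      C * (\<delta> powr (2 * s) + \<delta>\<^sup>2) * (Xnorm z)\<^sup>2
        + (\<Sum>j\<in>J. (cmod (l2inner lebesgue z (cell_ind \<delta> j)))\<^sup>2) / \<delta> ^ CARD('n)"
    using C(2)[of \<delta>] \<delta> by auto
  have h: "sq_integrable lebesgue (cell_ind \<delta> j) \<and>
      l2norm lebesgue (cell_ind \<delta> j) \<le> 1" for j :: "'n \<Rightarrow> int"
  proof
    have sq: "(cmod (of_real (indicator (cell \<delta> j) x)))\<^sup>2 = indicator (cell \<delta> j) x" for x
      by (simp add: indicator_def)
    have m: "cell \<delta> j \<in> sets lebesgue" by simp
    have e: "emeasure lebesgue (cell \<delta> j) = ennreal (\<delta> ^ CARD('n))"
      using \<delta> by (simp add: emeasure_cell)
    then have int: "integrable lebesgue (indicator (cell \<delta> j) :: _ \<Rightarrow> real)"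
      using m by (intro integrable_real_indicator) auto
    show "sq_integrable lebesgue (cell_ind \<delta> j)"
      unfolding sq_integrable_def sq using int m by simp
    have "measure lebesgue (cell \<delta> j) = \<delta> ^ CARD('n)"
      using e \<delta> by (simp add: measure_def)
    also have "\<dots> \<le> 1" using \<delta> by (intro power_le_one) auto
    finally show "l2norm lebesgue (cell_ind \<delta> j) \<le> 1"
      unfolding l2norm_def sq using m by simp
  qed
  show ?thesis
  proof (intro exI conjI allI ballI)
    show "finite J" by (rule J)
    show "0 \<le> 1 / \<delta> ^ CARD('n)" using \<delta> by simp
    show "sq_integrable lebesgue (cell_ind \<delta> j)"
      "l2norm lebesgue (cell_ind \<delta> j) \<le> 1" for j :: "'n \<Rightarrow> int"
      using h by auto
    fix z assume z: "z \<in> X"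
    have "C * (\<delta> powr (2 * s) + \<delta>\<^sup>2) * (Xnorm z)\<^sup>2 \<le> e * (Xnorm z)\<^sup>2"
      using \<delta> by (intro mult_right_mono) auto
    then show "(l2norm lebesgue z)\<^sup>2 \<le> e * (Xnorm z)\<^sup>2 + 1 / \<delta> ^ CARD('n) *
        (\<Sum>j\<in>J. (cmod (l2inner lebesgue z (cell_ind \<delta> j)))\<^sup>2)"
      using J(2)[OF z] by simp
  qed
qed

text \<open>Fatou, once for the functions, bounded in L2 by Poincare, and once for their quotients.
  Almost everywhere convergence passes to the quotients because null sets of x and of y are null in
  the product.\<close>

lemma X_AE_limit:
  assumes w: "\<And>k. w k \<in> X" "\<And>k. Xnorm (w k) \<le> B"
    and v [measurable]: "v \<in> borel_measurable lebesgue"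
    and lim: "AE x in lebesgue. (\<lambda>k. w k x) \<longlonglongrightarrow> v x"
  shows "v \<in> X" and "AE z in lebesgue. (\<lambda>k. mag_quot s A (w k) z) \<longlonglongrightarrow> mag_quot s A v z"
proof -
  show lim': "AE z in lebesgue. (\<lambda>k. mag_quot s A (w k) z) \<longlonglongrightarrow> mag_quot s A v z"
    using AE_fst_lebesgue[OF lim] AE_snd_lebesgue[OF lim]
  proof eventually_elim
    case (elim z)
    show ?case
    proof (cases "mag_kernel s (fst z) (snd z) = 0")
      case True
      then show ?thesis by (simp add: mag_quot_def)
    next
      case False
      then show ?thesis unfolding mag_quot_def mag_diff_def by (intro tendsto_intros elim) auto
    qed
  qed
  obtain P where P: "0 < P" "\<And>w. w \<in> X \<Longrightarrow> l2norm lebesgue w \<le> P * Xnorm w"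
    using X_poincare by blast
  show "v \<in> X"
    unfolding X_iff
  proof (intro conjI)
    show "sq_integrable lebesgue v"
    proof (rule sq_integrable_AE_limit[OF _ _ lim v])
      show "l2norm lebesgue (w k) \<le> P * B" for k
        using P(2)[OF w(1)[of k]] w(2)[of k] P(1) by (meson mult_le_cancel_left_pos order_trans)
    qed (rule X_D[OF w(1)])
    show "sq_integrable lebesgue (mag_quot s A v)"
      by (rule sq_integrable_AE_limit[OF X_D(2)[OF w(1)] _ lim' borel_measurable_mag_quot[OF A_measurable v]])
        (use w(2) in \<open>simp add: X_norm_eq\<close>)
    have "AE x in lebesgue. \<forall>k. x \<notin> \<Omega> \<longrightarrow> w k x = 0"
      unfolding AE_all_countable by (intro allI X_D(3)[OF w(1)])
    then show "AE x in lebesgue. x \<notin> \<Omega> \<longrightarrow> v x = 0"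
      using lim by eventually_elim (auto simp: LIMSEQ_const_iff)
  qed
qed

lemma X_inner_AE_limit:
  assumes w: "\<And>k. w k \<in> X" "\<And>k. Xnorm (w k) \<le> B"
    and v: "v \<in> borel_measurable lebesgue"
    and lim: "AE x in lebesgue. (\<lambda>k. w k x) \<longlonglongrightarrow> v x" and \<phi>: "\<phi> \<in> X"
  shows "(\<lambda>k. X_inner s A (w k) \<phi>) \<longlonglongrightarrow> X_inner s A v \<phi>"
  unfolding X_inner_eq
  using w(2) X_AE_limit[OF w v lim]
  by (intro tendsto_Re l2inner_tendsto_if_AE_bounded[where B=B] X_D w \<phi>) (auto simp: X_norm_eq)

text \<open>The functionals of the Ehrling inequalities with factors 1 / (m + 1) form a countable
  family; a diagonal subsequence makes each of them converge. The inequalities then make this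
  subsequence Cauchy in L2, and a further one converges almost everywhere.\<close>

lemma X_compact:
  assumes w: "\<And>k. w k \<in> X" "\<And>k. Xnorm (w k) \<le> B"
  obtains r v where "strict_mono (r :: nat \<Rightarrow> nat)" "v \<in> X"
    "AE x in lebesgue. (\<lambda>k. w (r k) x) \<longlonglongrightarrow> v x"
proof -
  obtain P where P: "0 < P" "\<And>w. w \<in> X \<Longrightarrow> l2norm lebesgue w \<le> P * Xnorm w"
    using X_poincare by blast
  have "\<forall>m::nat. \<exists>(J :: ('n \<Rightarrow> int) set) h c. finite J \<and> 0 \<le> c \<and>
    (\<forall>j. sq_integrable lebesgue (h j) \<and> l2norm lebesgue (h j) \<le> 1) \<and>
    (\<forall>z\<in>X. (l2norm lebesgue z)\<^sup>2 \<le> 1 / real (Suc m) * (Xnorm z)\<^sup>2 + c * (\<Sum>j\<in>J. (cmod (l2inner lebesgue z (h j)))\<^sup>2))"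
    by (intro allI X_finite_rank_estimate) simp
  then obtain J :: "nat \<Rightarrow> ('n \<Rightarrow> int) set" and h c where J: "\<And>m. finite (J m)" and c: "\<And>m. 0 \<le> c m"
    and h: "\<And>m j. sq_integrable lebesgue (h m j)" "\<And>m j. l2norm lebesgue (h m j) \<le> 1"
    and est: "\<And>m z. z \<in> X \<Longrightarrow> (l2norm lebesgue z)\<^sup>2 \<le> 1 / real (Suc m) * (Xnorm z)\<^sup>2
        + c m * (\<Sum>j\<in>J m. (cmod (l2inner lebesgue z (h m j)))\<^sup>2)"
    unfolding choice_iff by blast
  define F where "F k = (\<lambda>(m, j). l2inner lebesgue (w k) (h m j))" for k
  have B0: "0 \<le> B" using w(2)[of 0] Xnorm_nonneg[of "w 0"] by linarith
  have ctb: "countable (Sigma UNIV J)" using J by (intro countable_SIGMA) (auto intro: countable_finite)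
  have bd: "norm (F n x) \<le> P * B" if "x \<in> Sigma UNIV J" for n x
  proof -
    obtain m j where x: "x = (m, j)" by (cases x)
    have "cmod (F n x) \<le> l2norm lebesgue (w n) * l2norm lebesgue (h m j)"
      unfolding F_def x prod.case by (intro norm_l2inner_le X_D w h)
    also have "\<dots> \<le> l2norm lebesgue (w n) * 1" by (intro mult_left_mono h) simp
    also have "\<dots> \<le> P * B" using P(2)[OF w(1)[of n]] w(2)[of n] P(1)
      by (simp add: order_trans[OF _ mult_left_mono])
    finally show "norm (F n x) \<le> P * B" .
  qed
  obtain k0 where k0: "strict_mono (k0 :: nat \<Rightarrow> nat)"
    and conv: "\<And>x. x \<in> Sigma UNIV J \<Longrightarrow> \<exists>l. (\<lambda>n. F (k0 n) x) \<longlonglongrightarrow> l"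
    using function_convergent_subsequence[of "Sigma UNIV J" F "P * B", OF ctb bd] by blast
  have "\<exists>N. \<forall>k\<ge>N. \<forall>l\<ge>N. (l2norm lebesgue (\<lambda>x. w (k0 k) x - w (k0 l) x))\<^sup>2 \<le> e" if e: "0 < e" for e
  proof -
    \<comment> \<open>Differences have seminorm at most 2 B, so this \<open>m\<close> pushes the
      energy term below e / 2; the functionals supply the other half.\<close>
    obtain m where m: "4 * B\<^sup>2 / e * 2 < real m" using reals_Archimedean2 by blast
    have m': "1 / real (Suc m) * (2 * B)\<^sup>2 \<le> e / 2"
    proof -
      have "(2 * B)\<^sup>2 * 2 \<le> e * real m" using m e by (simp add: field_simps power2_eq_square)
      then have "(2 * B)\<^sup>2 * 2 \<le> e * real (Suc m)" using e by (simp add: distrib_left)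
      then show ?thesis by (simp add: field_simps)
    qed
    \<comment> \<open>The outer summand 1 keeps the denominator positive even if \<open>c m\<close>
      is 0.\<close>
    define \<eta> where "\<eta> = e / (2 * (c m * (real (card (J m)) + 1) + 1))"
    have eta: "0 < \<eta>" "c m * (real (card (J m)) * \<eta>) \<le> e / 2"
    proof -
      have d: "0 < c m * (real (card (J m)) + 1) + 1" using c[of m] by (intro add_nonneg_pos mult_nonneg_nonneg) auto
      show "0 < \<eta>" unfolding \<eta>_def using e d by simp
      have "c m * (real (card (J m)) * \<eta>) \<le> (c m * (real (card (J m)) + 1) + 1) * \<eta>"
        using \<open>0 < \<eta>\<close> c[of m] by (simp add: algebra_simps)
      also have "\<dots> = e / 2" unfolding \<eta>_def using d by (simp add: field_simps)
      finally show "c m * (real (card (J m)) * \<eta>) \<le> e / 2" .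
    qed
    have "\<exists>N. \<forall>k\<ge>N. \<forall>l\<ge>N. (cmod (l2inner lebesgue (w (k0 k) - w (k0 l)) (h m j)))\<^sup>2 \<le> \<eta>" if j: "j \<in> J m" for j
    proof -
      have "Cauchy (\<lambda>n. F (k0 n) (m, j))"
        using conv[of "(m, j)"] j by (auto intro: LIMSEQ_imp_Cauchy)
      then obtain N where N: "\<And>k l. k \<ge> N \<Longrightarrow> l \<ge> N \<Longrightarrow> norm (F (k0 k) (m, j) - F (k0 l) (m, j)) < sqrt \<eta>"
        using CauchyD[of _ "sqrt \<eta>"] eta by (metis real_sqrt_gt_zero)
      have "(cmod (l2inner lebesgue (w (k0 k) - w (k0 l)) (h m j)))\<^sup>2 \<le> \<eta>" if "k \<ge> N" "l \<ge> N" for k l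
      proof -
        have "l2inner lebesgue (w (k0 k) - w (k0 l)) (h m j) = F (k0 k) (m, j) - F (k0 l) (m, j)"
          unfolding fun_diff_def F_def prod.case by (intro l2inner_diff_left X_D w h)
        then show ?thesis using N[OF that] power_mono[of "norm (F (k0 k) (m, j) - F (k0 l) (m, j))" "sqrt \<eta>" 2] eta
          by simp
      qed
      then show ?thesis by blast
    qed
    then obtain N where N: "\<And>j k l. j \<in> J m \<Longrightarrow> k \<ge> N j \<Longrightarrow> l \<ge> N j \<Longrightarrow>
        (cmod (l2inner lebesgue (w (k0 k) - w (k0 l)) (h m j)))\<^sup>2 \<le> \<eta>" by metis
    define N0 where "N0 = (\<Sum>j\<in>J m. N j)"
    have N0: "N j \<le> N0" if "j \<in> J m" for j unfolding N0_def using that J by (intro member_le_sum) auto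
    show ?thesis
    proof (intro exI allI impI)
      fix k l assume kl: "N0 \<le> k" "N0 \<le> l"
      let ?z = "w (k0 k) - w (k0 l)"
      have z: "?z \<in> X" by (intro X_diff w)
      have "Xnorm ?z \<le> 2 * B"
        using Xnorm_diff_triangle[OF w(1) w(1), of "k0 k" "k0 l"] w(2)[of "k0 k"] w(2)[of "k0 l"] by linarith
      then have "1 / real (Suc m) * (Xnorm ?z)\<^sup>2 \<le> 1 / real (Suc m) * (2 * B)\<^sup>2"
        by (intro mult_left_mono power_mono) auto
      also note m'
      finally have a1: "1 / real (Suc m) * (Xnorm ?z)\<^sup>2 \<le> e / 2" .
      have "(\<Sum>j\<in>J m. (cmod (l2inner lebesgue ?z (h m j)))\<^sup>2) \<le> (\<Sum>j\<in>J m. \<eta>)"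
        using kl N0 by (intro sum_mono N) (auto intro: order_trans)
      then have "c m * (\<Sum>j\<in>J m. (cmod (l2inner lebesgue ?z (h m j)))\<^sup>2) \<le> c m * (real (card (J m)) * \<eta>)"
        using c by (intro mult_left_mono) auto
      also note eta(2)
      finally have "(l2norm lebesgue ?z)\<^sup>2 \<le> e" using est[OF z, of m] a1 by linarith
      then show "(l2norm lebesgue (\<lambda>x. w (k0 k) x - w (k0 l) x))\<^sup>2 \<le> e" by (simp add: fun_diff_def)
    qed
  qed
  from l2_Cauchy_AE_subseq[where g="\<lambda>n. w (k0 n)", OF X_D(1)[OF w(1)] this]
  obtain r v where r: "strict_mono (r :: nat \<Rightarrow> nat)" and v: "v \<in> borel_measurable lebesgue"
    and lim: "AE x in lebesgue. (\<lambda>k. w (k0 (r k)) x) \<longlonglongrightarrow> v x" by blast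
  show ?thesis
  proof
    show "strict_mono (k0 \<circ> r)" using k0 r by (rule strict_mono_o)
    show "AE x in lebesgue. (\<lambda>k. w ((k0 \<circ> r) k) x) \<longlonglongrightarrow> v x" using lim by simp
    show "v \<in> X" by (rule X_AE_limit[OF w v lim])
  qed
qed

end

section \<open>Continuity of the derivative and the Palais-Smale condition\<close>

text \<open>Otherwise some subsequence stays at a fixed distance from \<open>l\<close>, and none of
  its subsequences can converge to \<open>l\<close>.\<close>

lemma LIMSEQ_if_subseq_subseq:
  fixes a :: "nat \<Rightarrow> 'a::metric_space"
  assumes "\<And>r :: nat \<Rightarrow> nat. strict_mono r \<Longrightarrow> \<exists>r' :: nat \<Rightarrow> nat. strict_mono r' \<and> (\<lambda>k. a (r (r' k))) \<longlonglongrightarrow> l"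
  shows "a \<longlonglongrightarrow> l"
proof (rule ccontr)
  assume "\<not> a \<longlonglongrightarrow> l"
  then obtain e where e: "0 < e" "\<forall>N. \<exists>k\<ge>N. e \<le> dist (a k) l"
    unfolding lim_sequentially by (auto simp: not_less)
  then have inf: "infinite {k. e \<le> dist (a k) l}"
    unfolding infinite_nat_iff_unbounded_le by auto
  define r where "r = enumerate {k. e \<le> dist (a k) l}"
  have r: "strict_mono r" unfolding r_def using inf by (rule strict_mono_enumerate)
  have far: "e \<le> dist (a (r k)) l" for k
    using enumerate_in_set[OF inf, of k] by (simp add: r_def)
  obtain r' where r': "strict_mono (r' :: nat \<Rightarrow> nat)" "(\<lambda>k. a (r (r' k))) \<longlonglongrightarrow> l"
    using assms[OF r] by blast
  have "\<forall>\<^sub>F k in sequentially. dist (a (r (r' k))) l < e" using r'(2) e(1) by (rule tendstoD)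
  then obtain k where "dist (a (r (r' k))) l < e" by (auto simp: eventually_sequentially)
  then show False using far[of "r' k"] by simp
qed

text \<open>The constant is T^p for the threshold T at which \<epsilon> T^(q-p) equals 1: below it
  the p-th power is bounded, above it the q-th power takes over.\<close>

lemma powr_interpolate:
  fixes \<sigma> p q \<epsilon> :: real
  assumes "0 < p" "p < q" "0 < \<epsilon>" "0 \<le> \<sigma>"
  shows "\<sigma> powr p \<le> ((1 / \<epsilon>) powr (1 / (q - p))) powr p + \<epsilon> * \<sigma> powr q"
proof -
  define T where "T = (1 / \<epsilon>) powr (1 / (q - p))"
  have T: "0 < T" using assms by (simp add: T_def)
  show ?thesis
  proof (cases "\<sigma> \<le> T")
    case True
    then have "\<sigma> powr p \<le> T powr p" using assms by (intro powr_mono2) auto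
    also have "\<dots> \<le> T powr p + \<epsilon> * \<sigma> powr q" using assms by simp
    finally show ?thesis by (simp add: T_def)
  next
    case False
    then have "T powr (q - p) \<le> \<sigma> powr (q - p)" using assms T by (intro powr_mono2) auto
    also have "T powr (q - p) = 1 / \<epsilon>" unfolding T_def using assms by (simp add: powr_powr)
    finally have "1 \<le> \<epsilon> * \<sigma> powr (q - p)" using assms by (simp add: field_simps)
    then have "\<sigma> powr p * 1 \<le> \<sigma> powr p * (\<epsilon> * \<sigma> powr (q - p))" by (intro mult_left_mono) auto
    also have "\<dots> = \<epsilon> * \<sigma> powr q" using False T by (simp flip: powr_add)
    also have "\<dots> \<le> T powr p + \<epsilon> * \<sigma> powr q" by simp
    finally show ?thesis by (simp add: T_def)
  qed
qed

section \<open>The reaction term and the derivative of the energy functional\<close>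

locale kirchhoff = magnetic_space s A \<Omega>
  for s :: real and A :: "real^'n \<Rightarrow> real^'n" and \<Omega> :: "(real^'n) set" +
  fixes p C m\<^sub>0 \<theta> :: real and f M :: "real \<Rightarrow> real"
  assumes p: "2 < p" "p < crit_exp CARD('n) s"
    and C: "0 < C"
    and f_nonneg: "\<And>\<sigma>. 0 \<le> \<sigma> \<Longrightarrow> 0 \<le> f \<sigma>"
    and f_cont: "continuous_on {0..} f"
    and f_growth: "\<And>\<sigma>. 0 \<le> \<sigma> \<Longrightarrow> f \<sigma> * \<sigma>\<^sup>2 \<le> p * C * \<sigma> powr p"
    and M_cont: "continuous_on {0..} M"
    and m0: "0 < m\<^sub>0"
    and M_lower: "\<And>\<sigma>. 0 \<le> \<sigma> \<Longrightarrow> m\<^sub>0 * \<sigma> powr (\<theta> - 1) \<le> M \<sigma>"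
begin

abbreviation "J' \<equiv> J_deriv s A \<Omega> M f"

definition reaction :: "(real^'n \<Rightarrow> complex) \<Rightarrow> (real^'n \<Rightarrow> complex) \<Rightarrow> complex" where
  "reaction w \<phi> = (LINT x:\<Omega>|lebesgue. of_real (f (cmod (w x))) * w x * cnj (\<phi> x))"

abbreviation "reaction_dens w \<phi> \<equiv> \<lambda>x. indicator \<Omega> x *\<^sub>R (of_real (f (cmod (w x))) * w x * cnj (\<phi> x))"

lemma J_deriv_eq:
  "J' w \<phi> = M ((Xnorm w)\<^sup>2) * X_inner s A w \<phi> - Re (reaction w \<phi>)"
  by (simp add: J_deriv_def reaction_def)

text \<open>The growth bound concerns f(\<sigma>) \<sigma>^2, whereas testing produces f(\<sigma>)
  \<sigma> \<tau>. The larger argument absorbs the other: either \<tau> is raised to \<sigma>, or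
  \<tau>/\<sigma> is factored out and \<sigma>^(p-1) is raised to \<tau>^(p-1).\<close>

lemma f_growth_mult:
  assumes "0 \<le> \<sigma>" "0 \<le> \<tau>"
  shows "f \<sigma> * \<sigma> * \<tau> \<le> p * C * (\<sigma> powr p + \<tau> powr p)"
proof -
  have pC: "0 < p * C" using p C by simp
  consider "\<sigma> = 0" | "\<sigma> > 0" "\<tau> \<le> \<sigma>" | "\<sigma> > 0" "\<sigma> < \<tau>" using assms by linarith
  then show ?thesis
  proof cases
    case 1
    then show ?thesis using pC by simp
  next
    case 2
    have "f \<sigma> * \<sigma> * \<tau> \<le> f \<sigma> * \<sigma> * \<sigma>" using 2 f_nonneg[of \<sigma>] by (intro mult_left_mono) auto
    also have "\<dots> \<le> p * C * \<sigma> powr p" using f_growth[of \<sigma>] 2 by (simp add: power2_eq_square mult_ac)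
    also have "\<dots> \<le> p * C * (\<sigma> powr p + \<tau> powr p)" using pC by (intro mult_left_mono) auto
    finally show ?thesis .
  next
    case 3
    have "f \<sigma> * \<sigma> * \<tau> = f \<sigma> * \<sigma>\<^sup>2 * (\<tau> / \<sigma>)" using 3 by (simp add: power2_eq_square)
    also have "\<dots> \<le> p * C * \<sigma> powr p * (\<tau> / \<sigma>)" using f_growth[of \<sigma>] 3 by (intro mult_right_mono) auto
    also have "\<dots> = p * C * (\<sigma> powr (p - 1) * \<tau>)" using 3 by (simp add: powr_diff)
    also have "\<dots> \<le> p * C * (\<tau> powr (p - 1) * \<tau>)"
      using 3 p pC by (intro mult_left_mono mult_right_mono powr_mono2) auto
    also have "\<tau> powr (p - 1) * \<tau> = \<tau> powr p" using 3 by (simp add: powr_diff)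
    also have "p * C * \<tau> powr p \<le> p * C * (\<sigma> powr p + \<tau> powr p)" using pC by (intro mult_left_mono) auto
    finally show ?thesis .
  qed
qed

text \<open>Continuity is given on the half-line; composing with \<open>max 0\<close> makes it
  global and changes nothing at moduli.\<close>

lemma f_isCont: "isCont (\<lambda>\<sigma>. f (max 0 \<sigma>)) \<sigma>"
proof -
  have "continuous_on UNIV (\<lambda>\<sigma>. f (max 0 \<sigma>))"
    by (rule continuous_on_compose2[OF f_cont]) (auto intro!: continuous_intros)
  then show ?thesis by (simp add: continuous_on_eq_continuous_at)
qed

lemma reaction_integrand_bound:
  "cmod (of_real (f (cmod a)) * a * cnj b) \<le> p * C * (cmod a powr p + cmod b powr p)"
  using f_growth_mult[of "cmod a" "cmod b"] f_nonneg[of "cmod a"] by (simp add: norm_mult)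

lemma borel_measurable_reaction:
  assumes "w \<in> borel_measurable lebesgue" "\<phi> \<in> borel_measurable lebesgue"
  shows "reaction_dens w \<phi> \<in> borel_measurable lebesgue"
proof -
  have [measurable]: "(\<lambda>\<sigma>. f (max 0 \<sigma>)) \<in> borel_measurable borel"
    by (intro borel_measurable_continuous_onI) (simp add: continuous_on_eq_continuous_at f_isCont)
  have [measurable]: "\<Omega> \<in> sets lebesgue" using open_\<Omega> by simp
  note [measurable] = assms
  have "(\<lambda>x. indicator \<Omega> x *\<^sub>R (of_real (f (max 0 (cmod (w x)))) * w x * cnj (\<phi> x))) \<in> borel_measurable lebesgue"
    by measurable
  then show ?thesis by simp
qed

lemma X_integrable_powr:
  assumes "w \<in> X" "0 < q" "q < crit_exp CARD('n) s"
  shows "integrable lebesgue (\<lambda>x. cmod (w x) powr q)"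
proof -
  obtain K where "\<And>v. v \<in> X \<Longrightarrow> Xnorm v \<le> Xnorm w \<Longrightarrow>
      integrable lebesgue (\<lambda>x. cmod (v x) powr q) \<and> (\<integral>x. cmod (v x) powr q \<partial>lebesgue) \<le> K"
    using X_sobolev[OF assms(2,3)] by blast
  from this[OF assms(1)] show ?thesis by simp
qed

lemma integrable_reaction:
  assumes w: "w \<in> X" and \<phi>: "\<phi> \<in> X"
  shows "integrable lebesgue (reaction_dens w \<phi>)"
proof (rule Bochner_Integration.integrable_bound)
  show "integrable lebesgue (\<lambda>x. p * C * (cmod (w x) powr p + cmod (\<phi> x) powr p))"
    using p by (intro integrable_mult_right Bochner_Integration.integrable_add X_integrable_powr w \<phi>) auto
  show "reaction_dens w \<phi> \<in> borel_measurable lebesgue"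
    by (intro borel_measurable_reaction X_D w \<phi>)
  show "AE x in lebesgue. norm (reaction_dens w \<phi> x)
    \<le> norm (p * C * (cmod (w x) powr p + cmod (\<phi> x) powr p))"
  proof (rule AE_I2)
    fix x
    have "norm (reaction_dens w \<phi> x)
        \<le> norm (of_real (f (cmod (w x))) * w x * cnj (\<phi> x))" by (simp add: indicator_def)
    also note reaction_integrand_bound
    finally show "norm (reaction_dens w \<phi> x)
      \<le> norm (p * C * (cmod (w x) powr p + cmod (\<phi> x) powr p))" by simp
  qed
qed

text \<open>The growth has exponent p, while norms are bounded for a q strictly between p and the
  critical exponent. Interpolation bounds each p-th power by a constant plus a small multiple of the
  q-th power; the constant is integrable over the bounded set \<open>\<Omega>\<close>, so this is
  domination with an error.\<close>

lemma reaction_AE_limit: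
  assumes w: "\<And>k. w k \<in> X" "\<And>k. Xnorm (w k) \<le> B" "v \<in> X"
    and lim: "AE x in lebesgue. (\<lambda>k. w k x) \<longlonglongrightarrow> v x"
    and \<phi>: "\<And>k. \<phi> k \<in> X" "\<And>k. Xnorm (\<phi> k) \<le> B" "\<psi> \<in> X"
    and lim\<phi>: "AE x in lebesgue. (\<lambda>k. \<phi> k x) \<longlonglongrightarrow> \<psi> x"
  shows "(\<lambda>k. reaction (w k) (\<phi> k)) \<longlonglongrightarrow> reaction v \<psi>"
proof -
  define q where "q = (p + crit_exp CARD('n) s) / 2"
  have q: "p < q" "q < crit_exp CARD('n) s" "0 < p" "0 < q" using p by (auto simp: q_def)
  define B' where "B' = max B (max (Xnorm v) (Xnorm \<psi>))"
  obtain K where K: "\<And>w. w \<in> X \<Longrightarrow> Xnorm w \<le> B' \<Longrightarrow>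
    integrable lebesgue (\<lambda>x. cmod (w x) powr q) \<and> (\<integral>x. cmod (w x) powr q \<partial>lebesgue) \<le> K"
    using X_sobolev[OF q(4,2)] by blast
  have Kw: "integrable lebesgue (\<lambda>x. cmod (w k x) powr q)" "(\<integral>x. cmod (w k x) powr q \<partial>lebesgue) \<le> K"
    "integrable lebesgue (\<lambda>x. cmod (\<phi> k x) powr q)" "(\<integral>x. cmod (\<phi> k x) powr q \<partial>lebesgue) \<le> K" for k
    using K[OF w(1)[of k]] w(2)[of k] K[OF \<phi>(1)[of k]] \<phi>(2)[of k] by (auto simp: B'_def)
  have Kv: "integrable lebesgue (\<lambda>x. cmod (v x) powr q)" "(\<integral>x. cmod (v x) powr q \<partial>lebesgue) \<le> K"
    "integrable lebesgue (\<lambda>x. cmod (\<psi> x) powr q)" "(\<integral>x. cmod (\<psi> x) powr q \<partial>lebesgue) \<le> K"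
    using K[OF w(3)] K[OF \<phi>(3)] by (auto simp: B'_def)
  define g where "g w \<phi> x = indicator \<Omega> x *\<^sub>R (of_real (f (cmod (w x))) * w x * cnj (\<phi> x))"
    for w \<phi> :: "real^'n \<Rightarrow> complex" and x
  have reaction: "reaction w \<phi> = (\<integral>x. g w \<phi> x \<partial>lebesgue)" for w \<phi>
    by (simp add: reaction_def g_def set_lebesgue_integral_def)
  have int: "integrable lebesgue (g (w k) (\<phi> k))" "integrable lebesgue (g v \<psi>)" for k
    unfolding g_def by (intro integrable_reaction w \<phi>)+
  \<comment> \<open>Sequence and limit enter with two functions each, hence the bound
    \<open>4 * K\<close> on the integrals.\<close>
  define P where "P k x = cmod (w k x) powr q + cmod (\<phi> k x) powr q + (cmod (v x) powr q + cmod (\<psi> x) powr q)" for k x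
  have "(\<lambda>k. \<integral>x. cmod (g (w k) (\<phi> k) x - g v \<psi> x) \<partial>lebesgue) \<longlonglongrightarrow> 0"
  proof (rule integral_tendsto_0_if_almost_dominated[where P=P and K="4 * K"])
    show "integrable lebesgue (\<lambda>x. cmod (g (w k) (\<phi> k) x - g v \<psi> x))" for k
      using int by (intro integrable_norm Bochner_Integration.integrable_diff)
    show "AE x in lebesgue. (\<lambda>k. cmod (g (w k) (\<phi> k) x - g v \<psi> x)) \<longlonglongrightarrow> 0"
      using lim lim\<phi>
    proof eventually_elim
      case (elim x)
      have "(\<lambda>k. f (max 0 (cmod (w k x)))) \<longlonglongrightarrow> f (max 0 (cmod (v x)))"
        by (rule isCont_tendsto_compose[OF f_isCont]) (intro tendsto_intros elim)
      then have "(\<lambda>k. f (cmod (w k x))) \<longlonglongrightarrow> f (cmod (v x))" by simp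
      then have "(\<lambda>k. g (w k) (\<phi> k) x) \<longlonglongrightarrow> g v \<psi> x"
        unfolding g_def by (intro tendsto_intros elim)
      then show ?case by (intro tendsto_norm_zero) (simp add: LIM_zero)
    qed
    show "integrable lebesgue (P k)" for k
      unfolding P_def by (intro Bochner_Integration.integrable_add Kw Kv)
    show "(\<integral>x. P k x \<partial>lebesgue) \<le> 4 * K" for k
      unfolding P_def using Kw[of k] Kv by simp
    fix \<epsilon> :: real assume \<epsilon>: "0 < \<epsilon>"
    have pC: "0 < p * C" using p C by simp
    define e where "e = \<epsilon> / (p * C)"
    have e: "0 < e" "p * C * e = \<epsilon>" using \<epsilon> pC by (auto simp: e_def)
    define T where "T = ((1 / e) powr (1 / (q - p))) powr p"
    have T: "t powr p \<le> T + e * t powr q" if "0 \<le> t" for t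
      unfolding T_def using that e q by (intro powr_interpolate) auto
    show "\<exists>D. integrable lebesgue D \<and> (\<forall>k. AE x in lebesgue. 0 \<le> P k x \<and>
        cmod (g (w k) (\<phi> k) x - g v \<psi> x) \<le> D x + \<epsilon> * P k x)"
    proof (intro exI conjI allI AE_I2)
      have "emeasure lebesgue \<Omega> < \<infinity>" using emeasure_bounded_finite[OF bounded_\<Omega>] open_\<Omega> by simp
      then show "integrable lebesgue (\<lambda>x. indicator \<Omega> x * (4 * (p * C * T)))"
        using open_\<Omega> by (intro integrable_mult_left integrable_real_indicator) auto
      fix k x
      show P0: "0 \<le> P k x" by (simp add: P_def)
      show "cmod (g (w k) (\<phi> k) x - g v \<psi> x) \<le> indicator \<Omega> x * (4 * (p * C * T)) + \<epsilon> * P k x"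
      proof (cases "x \<in> \<Omega>")
        case True
        have b: "cmod (of_real (f (cmod a)) * a * cnj c) \<le> 2 * (p * C * T) + \<epsilon> * (cmod a powr q + cmod c powr q)" for a c
        proof -
          have "cmod (of_real (f (cmod a)) * a * cnj c) \<le> p * C * (cmod a powr p + cmod c powr p)"
            by (rule reaction_integrand_bound)
          also have "\<dots> \<le> p * C * ((T + e * cmod a powr q) + (T + e * cmod c powr q))"
            using pC by (intro mult_left_mono add_mono T) auto
          also have "\<dots> = 2 * (p * C * T) + (p * C * e) * (cmod a powr q + cmod c powr q)"
            by (simp add: algebra_simps)
          finally show ?thesis unfolding e(2) .
        qed
        have "cmod (g (w k) (\<phi> k) x - g v \<psi> x) \<le> cmod (g (w k) (\<phi> k) x) + cmod (g v \<psi> x)"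
          by (rule norm_triangle_ineq4)
        also have "\<dots> \<le> (2 * (p * C * T) + \<epsilon> * (cmod (w k x) powr q + cmod (\<phi> k x) powr q))
            + (2 * (p * C * T) + \<epsilon> * (cmod (v x) powr q + cmod (\<psi> x) powr q))"
          using add_mono[OF b[of "w k x" "\<phi> k x"] b[of "v x" "\<psi> x"]] True
          by (simp only: g_def indicator_simps scaleR_one)
        also have "\<dots> = indicator \<Omega> x * (4 * (p * C * T)) + \<epsilon> * P k x"
          using True by (simp add: P_def algebra_simps)
        finally show ?thesis .
      next
        case False
        then show ?thesis using P0 \<epsilon> by (simp add: g_def)
      qed
    qed
  qed auto
  then have "(\<lambda>k. \<integral>x. g (w k) (\<phi> k) x - g v \<psi> x \<partial>lebesgue) \<longlonglongrightarrow> 0"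
    by (rule Lim_null_comparison[rotated]) (auto simp: integral_norm_bound)
  then have "(\<lambda>k. (\<integral>x. g (w k) (\<phi> k) x \<partial>lebesgue) - (\<integral>x. g v \<psi> x \<partial>lebesgue)) \<longlonglongrightarrow> 0"
    using int by simp
  then show ?thesis unfolding reaction by (rule LIM_zero_cancel)
qed

end

section \<open>Convergence in the seminorm\<close>

context magnetic_space
begin

lemma X_eq_0_AE:
  assumes "w \<in> X" "Xnorm w = 0"
  shows "AE x in lebesgue. w x = 0"
proof -
  obtain P where P: "0 < P" "\<And>w. w \<in> X \<Longrightarrow> l2norm lebesgue w \<le> P * Xnorm w"
    using X_poincare by blast
  have "l2norm lebesgue w = 0" using P(2)[OF assms(1)] assms(2) l2norm_nonneg[of lebesgue w] by simp
  then have "(\<integral>x. (cmod (w x))\<^sup>2 \<partial>lebesgue) = 0" by (simp add: l2norm_def)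
  then have "AE x in lebesgue. (cmod (w x))\<^sup>2 = 0"
    using X_D(1)[OF assms(1)] by (subst (asm) integral_nonneg_eq_0_iff_AE) (auto simp: sq_integrable_def)
  then show ?thesis by eventually_elim simp
qed

lemma Xnorm_tendsto:
  assumes w: "\<And>k. w k \<in> X" "v \<in> X" and lim: "(\<lambda>k. Xnorm (w k - v)) \<longlonglongrightarrow> 0"
  shows "(\<lambda>k. Xnorm (w k)) \<longlonglongrightarrow> Xnorm v"
proof -
  have "\<bar>Xnorm (w k) - Xnorm v\<bar> \<le> Xnorm (w k - v)" for k
  proof (rule power2_le_imp_le)
    have "\<bar>X_inner s A (w k) v\<bar> \<le> Xnorm (w k) * Xnorm v" by (intro abs_X_inner_le w)
    then show "\<bar>Xnorm (w k) - Xnorm v\<bar>\<^sup>2 \<le> (Xnorm (w k - v))\<^sup>2"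
      unfolding Xnorm_diff_sq[OF w] by (simp add: power2_diff)
  qed simp
  then have "\<forall>\<^sub>F k in sequentially. norm (Xnorm (w k) - Xnorm v) \<le> Xnorm (w k - v)" by simp
  then have "(\<lambda>k. Xnorm (w k) - Xnorm v) \<longlonglongrightarrow> 0"
    using lim by (rule Lim_null_comparison)
  then show ?thesis by (rule LIM_zero_cancel)
qed

lemma X_inner_tendsto:
  assumes w: "\<And>k. w k \<in> X" "v \<in> X" "\<phi> \<in> X" and lim: "(\<lambda>k. Xnorm (w k - v)) \<longlonglongrightarrow> 0"
  shows "(\<lambda>k. X_inner s A (w k) \<phi>) \<longlonglongrightarrow> X_inner s A v \<phi>"
proof -
  have "\<bar>X_inner s A (w k) \<phi> - X_inner s A v \<phi>\<bar> \<le> Xnorm (w k - v) * Xnorm \<phi>" for k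
    using abs_X_inner_le[OF X_diff[OF w(1,2)] w(3), of k] by (simp add: X_inner_diff_left w)
  then have "\<forall>\<^sub>F k in sequentially. norm (X_inner s A (w k) \<phi> - X_inner s A v \<phi>) \<le> Xnorm (w k - v) * Xnorm \<phi>"
    by simp
  then have "(\<lambda>k. X_inner s A (w k) \<phi> - X_inner s A v \<phi>) \<longlonglongrightarrow> 0"
    by (rule Lim_null_comparison) (rule tendsto_mult_left_zero[OF lim])
  then show ?thesis by (rule LIM_zero_cancel)
qed

text \<open>Compactness supplies some almost everywhere limit. Both it and \<open>v\<close> give the
  limit of every energy pairing along the subsequence, so their difference has seminorm 0 and
  vanishes almost everywhere by Poincare.\<close>

lemma Xnorm_tendsto_AE_subseq:
  assumes w: "\<And>k. w k \<in> X" "v \<in> X" and lim: "(\<lambda>k. Xnorm (w k - v)) \<longlonglongrightarrow> 0"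
  obtains r where "strict_mono (r :: nat \<Rightarrow> nat)" "AE x in lebesgue. (\<lambda>k. w (r k) x) \<longlonglongrightarrow> v x"
proof -
  have "convergent (\<lambda>k. Xnorm (w k))" by (rule convergentI[OF Xnorm_tendsto[OF w lim]])
  then have "Bseq (\<lambda>k. Xnorm (w k))" by (rule convergent_imp_Bseq)
  then obtain B where "\<forall>k. norm (Xnorm (w k)) \<le> B" unfolding Bseq_def by blast
  then have B: "\<And>k. Xnorm (w k) \<le> B" by simp
  obtain r v' where r: "strict_mono (r :: nat \<Rightarrow> nat)" and v': "v' \<in> X"
    and lim': "AE x in lebesgue. (\<lambda>k. w (r k) x) \<longlonglongrightarrow> v' x"
    by (rule X_compact[OF w(1) B])
  have "X_inner s A v' \<phi> = X_inner s A v \<phi>" if \<phi>: "\<phi> \<in> X" for \<phi>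
  proof (rule LIMSEQ_unique)
    show "(\<lambda>k. X_inner s A (w (r k)) \<phi>) \<longlonglongrightarrow> X_inner s A v' \<phi>"
      by (rule X_inner_AE_limit[OF w(1) B X_D(4)[OF v'] lim' \<phi>])
    show "(\<lambda>k. X_inner s A (w (r k)) \<phi>) \<longlonglongrightarrow> X_inner s A v \<phi>"
      using LIMSEQ_subseq_LIMSEQ[OF X_inner_tendsto[OF w \<phi> lim] r] by (simp add: o_def)
  qed
  then have "X_inner s A (v' - v) (v' - v) = 0"
    using v' w(2) by (simp add: X_inner_diff_left X_diff)
  then have "Xnorm (v' - v) = 0" by (simp add: X_inner_self)
  from X_eq_0_AE[OF X_diff[OF v' w(2)] this] lim'
  have "AE x in lebesgue. (\<lambda>k. w (r k) x) \<longlonglongrightarrow> v x" by eventually_elim simp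
  with r show ?thesis by (rule that)
qed

end

section \<open>The Palais-Smale condition\<close>

context kirchhoff
begin

text \<open>Convergence in the seminorm gives pointwise convergence along subsequences, so the limit
  of the whole sequence is recovered from subsequences of subsequences.\<close>

lemma reaction_tendsto:
  assumes w: "\<And>k. w k \<in> X" "v \<in> X" "\<phi> \<in> X" and lim: "(\<lambda>k. Xnorm (w k - v)) \<longlonglongrightarrow> 0"
  shows "(\<lambda>k. reaction (w k) \<phi>) \<longlonglongrightarrow> reaction v \<phi>"
proof (rule LIMSEQ_if_subseq_subseq)
  fix r :: "nat \<Rightarrow> nat" assume r: "strict_mono r"
  have lim_r: "(\<lambda>k. Xnorm (w (r k) - v)) \<longlonglongrightarrow> 0"
    using LIMSEQ_subseq_LIMSEQ[OF lim r] by (simp add: o_def)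
  have "convergent (\<lambda>k. Xnorm (w k))" by (rule convergentI[OF Xnorm_tendsto[OF w(1,2) lim]])
  then have "Bseq (\<lambda>k. Xnorm (w k))" by (rule convergent_imp_Bseq)
  then obtain B where "\<forall>k. norm (Xnorm (w k)) \<le> B" unfolding Bseq_def by blast
  then have B: "\<And>k. Xnorm (w k) \<le> B" by simp
  obtain r' where r': "strict_mono (r' :: nat \<Rightarrow> nat)" "AE x in lebesgue. (\<lambda>k. w (r (r' k)) x) \<longlonglongrightarrow> v x"
    using Xnorm_tendsto_AE_subseq[of "\<lambda>k. w (r k)", OF w(1,2) lim_r] by blast
  have "(\<lambda>k. reaction (w (r (r' k))) \<phi>) \<longlonglongrightarrow> reaction v \<phi>"
    by (rule reaction_AE_limit[where B="max B (Xnorm \<phi>)" and \<phi>="\<lambda>_. \<phi>"])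
      (use w B r'(2) in \<open>auto simp: le_max_iff_disj\<close>)
  with r'(1) show "\<exists>r'. strict_mono r' \<and> (\<lambda>k. reaction (w (r (r' k))) \<phi>) \<longlonglongrightarrow> reaction v \<phi>" by blast
qed

lemma M_tendsto:
  assumes "a \<longlonglongrightarrow> l"
  shows "(\<lambda>k. M ((a k)\<^sup>2)) \<longlonglongrightarrow> M (l\<^sup>2)"
  using continuous_on_tendsto_compose[OF M_cont tendsto_power[OF assms, of 2]] by simp

lemma J_deriv_tendsto:
  assumes w: "\<And>k. w k \<in> X" "v \<in> X" "\<phi> \<in> X" and lim: "(\<lambda>k. Xnorm (w k - v)) \<longlonglongrightarrow> 0"
  shows "(\<lambda>k. J' (w k) \<phi>) \<longlonglongrightarrow> J' v \<phi>"
  unfolding J_deriv_eq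
  by (intro tendsto_diff tendsto_mult tendsto_Re M_tendsto Xnorm_tendsto X_inner_tendsto reaction_tendsto assms)

text \<open>Along a subsequence the norms tend to some \<open>l\<close>, and strong convergence
  amounts to \<open>l\<close> being the norm of the weak limit \<open>v\<close>. If \<open>l\<close>
  is 0, the weak limit has norm 0. Otherwise the Kirchhoff coefficient has a positive limit; testing
  with \<open>y k - v\<close>, where the reaction disappears in the limit, and dividing by the
  coefficient gives the equality of norms.\<close>

lemma palais_smale:
  assumes w: "\<And>k. w k \<in> X" "\<And>k. Xnorm (w k) \<le> B"
    and e: "e \<longlonglongrightarrow> 0"
    and J: "\<And>k \<phi>. \<phi> \<in> X \<Longrightarrow> \<bar>J' (w k) \<phi>\<bar> \<le> e k * Xnorm \<phi>"
  obtains r v where "strict_mono (r :: nat \<Rightarrow> nat)" "stationary_solution s A \<Omega> M f v"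
    "(\<lambda>k. Xnorm (w (r k) - v)) \<longlonglongrightarrow> 0"
proof -
  obtain r1 v where r1: "strict_mono (r1 :: nat \<Rightarrow> nat)" and v: "v \<in> X"
    and lim1: "AE x in lebesgue. (\<lambda>k. w (r1 k) x) \<longlonglongrightarrow> v x"
    by (rule X_compact[OF w])
  have "bounded (range (\<lambda>k. Xnorm (w (r1 k))))"
    using w(2) by (intro boundedI[of _ B]) auto
  then obtain l r2 where r2: "strict_mono (r2 :: nat \<Rightarrow> nat)"
    and l: "((\<lambda>k. Xnorm (w (r1 k))) \<circ> r2) \<longlonglongrightarrow> l"
    using bounded_imp_convergent_subsequence by blast
  define r where "r = r1 \<circ> r2"
  have r: "strict_mono r" unfolding r_def using r1 r2 by (rule strict_mono_o)
  define y where "y k = w (r k)" for k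
  have y: "y k \<in> X" "Xnorm (y k) \<le> B" for k by (simp_all add: y_def w)
  have lim: "AE x in lebesgue. (\<lambda>k. y k x) \<longlonglongrightarrow> v x"
    using lim1
  proof eventually_elim
    case (elim x)
    from LIMSEQ_subseq_LIMSEQ[OF this r2] show ?case by (simp add: y_def r_def o_def)
  qed
  have ylim: "(\<lambda>k. Xnorm (y k)) \<longlonglongrightarrow> l" using l by (simp add: y_def r_def o_def)
  have e': "(\<lambda>k. e (r k)) \<longlonglongrightarrow> 0" using LIMSEQ_subseq_LIMSEQ[OF e r] by (simp add: o_def)
  have l0: "0 \<le> l" using ylim by (rule LIMSEQ_le_const) simp
  have weak: "(\<lambda>k. X_inner s A (y k) v) \<longlonglongrightarrow> (Xnorm v)\<^sup>2"
    using X_inner_AE_limit[OF y X_D(4)[OF v] lim v] by (simp add: X_inner_self)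
  have "l\<^sup>2 = (Xnorm v)\<^sup>2"
  proof (cases "l = 0")
    case True
    have "(\<lambda>k. X_inner s A (y k) v) \<longlonglongrightarrow> 0"
    proof (rule Lim_null_comparison)
      show "(\<lambda>k. Xnorm (y k) * Xnorm v) \<longlonglongrightarrow> 0"
        using ylim unfolding True by (rule tendsto_mult_left_zero)
      show "\<forall>\<^sub>F k in sequentially. norm (X_inner s A (y k) v) \<le> Xnorm (y k) * Xnorm v"
        by (rule always_eventually) (simp add: abs_X_inner_le y v)
    qed
    then show ?thesis using LIMSEQ_unique[OF weak] True by simp
  next
    case False
    then have l: "0 < l" using l0 by simp
    have d: "y k - v \<in> X" "Xnorm (y k - v) \<le> (B + Xnorm v)" for k
      using X_diff[OF y(1) v] Xnorm_diff_triangle[OF y(1) v, of k] y(2)[of k] by auto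
    have a: "(\<lambda>k. J' (y k) (y k - v)) \<longlonglongrightarrow> 0"
    proof (rule Lim_null_comparison)
      show "(\<lambda>k. \<bar>e (r k)\<bar> * (B + Xnorm v)) \<longlonglongrightarrow> 0"
        by (intro tendsto_mult_left_zero tendsto_rabs_zero e')
      show "\<forall>\<^sub>F k in sequentially. norm (J' (y k) (y k - v)) \<le> \<bar>e (r k)\<bar> * (B + Xnorm v)"
      proof (rule always_eventually, rule allI)
        fix k
        have "\<bar>J' (y k) (y k - v)\<bar> \<le> e (r k) * Xnorm (y k - v)"
          using J[OF d(1)] by (simp add: y_def)
        also have "\<dots> \<le> \<bar>e (r k)\<bar> * (B + Xnorm v)"
          using d(2)[of k] by (intro mult_mono) auto
        finally show "norm (J' (y k) (y k - v)) \<le> \<bar>e (r k)\<bar> * (B + Xnorm v)" by simp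
      qed
    qed
    have b: "(\<lambda>k. reaction (y k) (y k - v)) \<longlonglongrightarrow> reaction v (v - v)"
    proof (rule reaction_AE_limit[OF y(1) _ v lim d X_diff[OF v v]])
      show "Xnorm (y k) \<le> (B + Xnorm v)" for k using y(2)[of k] Xnorm_nonneg[of v] by linarith
      show "AE x in lebesgue. (\<lambda>k. (y k - v) x) \<longlonglongrightarrow> (v - v) x"
        using lim by eventually_elim (simp add: LIM_zero)
    qed
    have "reaction v (v - v) = 0" by (simp add: reaction_def)
    then have prod: "(\<lambda>k. M ((Xnorm (y k))\<^sup>2) * X_inner s A (y k) (y k - v)) \<longlonglongrightarrow> 0"
      using tendsto_add[OF a tendsto_Re[OF b]] by (simp add: J_deriv_eq)
    have Mlim: "(\<lambda>k. M ((Xnorm (y k))\<^sup>2)) \<longlonglongrightarrow> M (l\<^sup>2)" by (rule M_tendsto[OF ylim])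
    have "0 < m\<^sub>0 * (l\<^sup>2) powr (\<theta> - 1)" using l m0 by simp
    \<comment> \<open>The point where degeneracy is excluded: the power of \<open>l\<^sup>2\<close>
      in the lower bound is positive because \<open>l\<close> is.\<close>
    then have Ml: "0 < M (l\<^sup>2)" using M_lower[of "l\<^sup>2"] by simp
    have "(\<lambda>k. M ((Xnorm (y k))\<^sup>2) * X_inner s A (y k) (y k - v) / M ((Xnorm (y k))\<^sup>2)) \<longlonglongrightarrow> 0 / M (l\<^sup>2)"
      using Ml by (intro tendsto_divide prod Mlim) auto
    moreover have "\<forall>\<^sub>F k in sequentially. 0 < M ((Xnorm (y k))\<^sup>2)"
      using Mlim Ml by (rule order_tendstoD)
    then have "\<forall>\<^sub>F k in sequentially. M ((Xnorm (y k))\<^sup>2) * X_inner s A (y k) (y k - v) / M ((Xnorm (y k))\<^sup>2)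
        = X_inner s A (y k) (y k - v)"
      by eventually_elim simp
    ultimately have "(\<lambda>k. X_inner s A (y k) (y k - v)) \<longlonglongrightarrow> 0"
      by (simp add: tendsto_cong)
    moreover have "X_inner s A (y k) (y k - v) = (Xnorm (y k))\<^sup>2 - X_inner s A (y k) v" for k
      by (simp add: X_inner_diff_right y v X_inner_self)
    ultimately have l1: "(\<lambda>k. (Xnorm (y k))\<^sup>2 - X_inner s A (y k) v) \<longlonglongrightarrow> 0" by simp
    have "(\<lambda>k. (Xnorm (y k))\<^sup>2 - X_inner s A (y k) v) \<longlonglongrightarrow> l\<^sup>2 - (Xnorm v)\<^sup>2"
      by (intro tendsto_intros ylim weak)
    from LIMSEQ_unique[OF this l1] show ?thesis by simp
  qed
  \<comment> \<open>Weak convergence together with convergence of the norms gives strong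
    convergence, by expanding the square.\<close>
  then have "(\<lambda>k. (Xnorm (y k - v))\<^sup>2) \<longlonglongrightarrow> 0"
    unfolding Xnorm_diff_sq[OF y(1) v]
    using tendsto_diff[OF tendsto_add[OF tendsto_power[OF ylim, of 2] tendsto_const[of "(Xnorm v)\<^sup>2"]]
        tendsto_mult_left[OF weak, of 2]] by simp
  then have "(\<lambda>k. sqrt ((Xnorm (y k - v))\<^sup>2)) \<longlonglongrightarrow> sqrt 0" by (rule tendsto_real_sqrt)
  then have strong: "(\<lambda>k. Xnorm (y k - v)) \<longlonglongrightarrow> 0" by simp
  have "J' v \<phi> = 0" if \<phi>: "\<phi> \<in> X" for \<phi>
  proof (rule LIMSEQ_unique)
    show "(\<lambda>k. J' (y k) \<phi>) \<longlonglongrightarrow> J' v \<phi>"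
      by (rule J_deriv_tendsto[OF y(1) v \<phi> strong])
    show "(\<lambda>k. J' (y k) \<phi>) \<longlonglongrightarrow> 0"
    proof (rule Lim_null_comparison)
      show "(\<lambda>k. e (r k) * Xnorm \<phi>) \<longlonglongrightarrow> 0" by (rule tendsto_mult_left_zero[OF e'])
      show "\<forall>\<^sub>F k in sequentially. norm (J' (y k) \<phi>) \<le> e (r k) * Xnorm \<phi>"
        using J[OF \<phi>] by (simp add: y_def)
    qed
  qed
  then have "stationary_solution s A \<Omega> M f v" using v by (simp add: stationary_solution_def)
  with r show ?thesis using strong unfolding y_def by (rule that)
qed

end

section \<open>Smooth test functions on the line\<close>

text \<open>For fixed \<open>q\<close> this family is closed under differentiation; smoothness follows by induction.\<close>

definition bump :: "real poly \<Rightarrow> real poly \<Rightarrow> nat \<Rightarrow> real \<Rightarrow> real" where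
  "bump q P k t = (if 0 < poly q t then poly P t * (1 / poly q t) ^ k * exp (- (1 / poly q t)) else 0)"

text \<open>One term of the exponential series gives x^(k+2) <= (k+2)! exp x at x = 1/q, so
  exp(-1/q) cancels k poles and leaves a double zero.\<close>

lemma abs_bump_le: "\<bar>bump q P k t\<bar> \<le> \<bar>poly P t\<bar> * fact (k + 2) * (poly q t)\<^sup>2"
proof (cases "0 < poly q t")
  case True
  define x where "x = 1 / poly q t"
  have x: "0 < x" using True by (simp add: x_def)
  have "(\<Sum>i\<in>{k + 2}. x ^ i /\<^sub>R fact i) \<le> (\<Sum>i. x ^ i /\<^sub>R fact i)"
    using x by (intro sum_le_suminf summable_exp_generic) auto
  then have "x ^ (k + 2) /\<^sub>R fact (k + 2) \<le> exp x" unfolding exp_def by (simp del: fact_Suc)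
  then have "x ^ (k + 2) \<le> fact (k + 2) * exp x" by (simp add: field_simps del: fact_Suc)
  then have "x ^ (k + 2) * exp (- x) \<le> fact (k + 2) * exp x * exp (- x)" by (intro mult_right_mono) auto
  then have "x ^ (k + 2) * exp (- x) \<le> fact (k + 2)" by (simp add: mult.assoc flip: exp_add del: fact_Suc)
  then have "x ^ k * exp (- x) * x\<^sup>2 \<le> fact (k + 2)"
    by (simp only: power_add mult_ac)
  then have "x ^ k * exp (- x) \<le> fact (k + 2) * (poly q t)\<^sup>2"
    using True by (simp add: x_def field_simps del: fact_Suc)
  then have "\<bar>poly P t\<bar> * (x ^ k * exp (- x)) \<le> \<bar>poly P t\<bar> * (fact (k + 2) * (poly q t)\<^sup>2)"
    by (intro mult_left_mono) auto
  then show ?thesis using True x by (simp add: bump_def x_def[symmetric] abs_mult mult_ac del: fact_Suc)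
qed (simp add: bump_def)

text \<open>Where q > 0 this is the product rule, written over the common power k + 2 of 1/q. At a
  zero of q the quadratic bound makes the difference quotient a locally bounded factor times q,
  which tends to 0.\<close>

lemma bump_has_derivative:
  "(bump q P k has_real_derivative
      bump q (pderiv P * q\<^sup>2 - smult (real k) (P * pderiv q * q) + P * pderiv q) (k + 2) t) (at t)"
  (is "(_ has_real_derivative ?D) _")
proof -
  have cont: "continuous_on UNIV (poly q)" by (intro continuous_intros)
  consider "0 < poly q t" | "poly q t < 0" | "poly q t = 0" by linarith
  then show ?thesis
  proof cases
    case 1
    define x where "x = poly q t"
    have x: "0 < x" using 1 by (simp add: x_def)
    have r: "((\<lambda>t. 1 / poly q t) has_real_derivative - (poly (pderiv q) t / x\<^sup>2)) (at t)"
      using DERIV_inverse_fun[OF poly_DERIV[of q t]] x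
      by (simp add: x_def inverse_eq_divide power2_eq_square)
    have "((\<lambda>t. poly P t * (1 / poly q t) ^ k * exp (- (1 / poly q t))) has_real_derivative ?D) (at t)"
    proof (rule DERIV_cong)
      show "((\<lambda>t. poly P t * (1 / poly q t) ^ k * exp (- (1 / poly q t))) has_real_derivative
        (poly (pderiv P) t * (1 / poly q t) ^ k
          + real k * (- (poly (pderiv q) t / x\<^sup>2) * (1 / poly q t) ^ (k - Suc 0)) * poly P t) * exp (- (1 / poly q t))
        + exp (- (1 / poly q t)) * (- (- (poly (pderiv q) t / x\<^sup>2))) * (poly P t * (1 / poly q t) ^ k)) (at t)"
        by (intro DERIV_mult DERIV_power DERIV_fun_exp DERIV_minus poly_DERIV r)
      have alg: "(P' * r + K * (- (Q / x\<^sup>2)) * r * x * R) * e + e * (- (- (Q / x\<^sup>2))) * (R * r)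
          = (P' * x\<^sup>2 - K * (R * Q * x) + R * Q) * (r * (1 / x)\<^sup>2) * e" for P' r K Q R e :: real
        using x by (simp add: field_simps power2_eq_square)
      have k: "real k * (c * (1 / x) ^ (k - Suc 0)) = real k * c * (1 / x) ^ k * x" for c
        using x by (cases k) auto
      show "(poly (pderiv P) t * (1 / poly q t) ^ k
          + real k * (- (poly (pderiv q) t / x\<^sup>2) * (1 / poly q t) ^ (k - Suc 0)) * poly P t) * exp (- (1 / poly q t))
        + exp (- (1 / poly q t)) * (- (- (poly (pderiv q) t / x\<^sup>2))) * (poly P t * (1 / poly q t) ^ k) = ?D"
        unfolding bump_def x_def[symmetric] k alg
        using x by (simp add: x_def[symmetric] power_add) (simp add: power2_eq_square)
    qed
    then show ?thesis
    proof (rule has_field_derivative_transform_within_open)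
      show "open {t. 0 < poly q t}" using cont by (intro open_Collect_less) auto
    qed (use 1 in \<open>auto simp: bump_def\<close>)
  next
    case 2
    have "((\<lambda>t. 0) has_real_derivative 0) (at t)" by simp
    then have "(bump q P k has_real_derivative 0) (at t)"
    proof (rule has_field_derivative_transform_within_open)
      show "open {t. poly q t < 0}" using cont by (intro open_Collect_less) auto
    qed (use 2 in \<open>auto simp: bump_def\<close>)
    then show ?thesis using 2 by (simp add: bump_def)
  next
    case 3
    have "((\<lambda>y. (bump q P k y - bump q P k t) / (y - t)) \<longlongrightarrow> 0) (at t)"
    proof (rule Lim_null_comparison)
      have "((\<lambda>y. \<bar>poly P y\<bar> * fact (k + 2) * \<bar>(poly q y - poly q t) / (y - t)\<bar> * \<bar>poly q y\<bar>) \<longlongrightarrow>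
          \<bar>poly P t\<bar> * fact (k + 2) * \<bar>poly (pderiv q) t\<bar> * \<bar>poly q t\<bar>) (at t)"
        using poly_DERIV[of q t] unfolding has_field_derivative_iff
        by (intro tendsto_mult tendsto_rabs tendsto_const poly_isCont[THEN isContD])
      then show "((\<lambda>y. \<bar>poly P y\<bar> * fact (k + 2) * \<bar>(poly q y - poly q t) / (y - t)\<bar> * \<bar>poly q y\<bar>) \<longlongrightarrow> 0) (at t)"
        using 3 by simp
      have "\<bar>bump q P k y / (y - t)\<bar> \<le> \<bar>poly P y\<bar> * fact (k + 2) * \<bar>poly q y / (y - t)\<bar> * \<bar>poly q y\<bar>" for y
      proof -
        have "\<bar>bump q P k y\<bar> / \<bar>y - t\<bar> \<le> \<bar>poly P y\<bar> * fact (k + 2) * (poly q y)\<^sup>2 / \<bar>y - t\<bar>"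
          by (intro divide_right_mono abs_bump_le) simp
        also have "\<dots> = \<bar>poly P y\<bar> * fact (k + 2) * \<bar>poly q y / (y - t)\<bar> * \<bar>poly q y\<bar>"
          unfolding power2_eq_square abs_divide abs_mult_self_eq[of "poly q y", symmetric] by simp
        finally show ?thesis by (simp add: abs_divide)
      qed
      then show "\<forall>\<^sub>F y in at t. norm ((bump q P k y - bump q P k t) / (y - t))
          \<le> \<bar>poly P y\<bar> * fact (k + 2) * \<bar>(poly q y - poly q t) / (y - t)\<bar> * \<bar>poly q y\<bar>"
        using 3 by (simp add: bump_def[of q P k t] del: fact_Suc)
    qed
    then show ?thesis using 3 unfolding has_field_derivative_iff by (simp add: bump_def[of q _ _ t])
  qed
qed

text \<open>The scalar \<open>c\<close> is carried through the induction because a Frechet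
  derivative in direction \<open>v\<close> multiplies by \<open>v\<close>.\<close>

lemma smooth_on_bump: "smooth_on (bump q P k) UNIV"
proof -
  have "Ck_on j (\<lambda>t. c * bump q P k t) UNIV" for j c P k
  proof (induction j arbitrary: c P k)
    case 0
    have "isCont (bump q P k) t" for t by (rule DERIV_isCont[OF bump_has_derivative])
    then show ?case by (auto intro!: continuous_intros simp: continuous_on_eq_continuous_at)
  next
    case (Suc j)
    define P' where "P' = pderiv P * q\<^sup>2 - smult (real k) (P * pderiv q * q) + P * pderiv q"
    have d: "((\<lambda>t. c * bump q P k t) has_real_derivative c * bump q P' (k + 2) t) (at t)" for t
      unfolding P'_def by (rule DERIV_cmult[OF bump_has_derivative])
    then have "frechet_derivative (\<lambda>t. c * bump q P k t) (at t) = (*) (c * bump q P' (k + 2) t)" for t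
      by (intro frechet_derivative_at[symmetric]) (simp add: has_field_derivative_def)
    then have "(\<lambda>t. frechet_derivative (\<lambda>t. c * bump q P k t) (at t) v) = (\<lambda>t. (v * c) * bump q P' (k + 2) t)" for v
      by (simp add: mult_ac)
    moreover have "(\<lambda>t. c * bump q P k t) differentiable at t" for t
      using d by (auto simp: differentiable_def has_field_derivative_def)
    ultimately show ?case using Suc.IH[of "_ * c" P' "k + 2"] by simp
  qed
  from this[of _ 1] show ?thesis unfolding smooth_on_def by simp
qed

text \<open>The functions exp(-1 / (m (t - a)(b - t))), extended by 0; on the open interval they
  increase to 1 as m grows.\<close>

lemma test_function_approx:
  fixes a b :: real
  assumes "a < b"
  obtains \<psi> :: "nat \<Rightarrow> real \<Rightarrow> real" where "\<And>m. smooth_on (\<psi> m) UNIV" "\<And>m t. t \<notin> {a..b} \<Longrightarrow> \<psi> m t = 0"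
    "\<And>m t. \<bar>\<psi> m t\<bar> \<le> 1" "\<And>t. (\<lambda>m. \<psi> m t) \<longlonglongrightarrow> indicator {a<..<b} t"
proof -
  define q where "q m = smult (real m) ([:-a, 1:] * [:b, -1:])" for m
  have q: "poly (q m) t = real m * ((t - a) * (b - t))" for m t by (simp add: q_def algebra_simps)
  show ?thesis
  proof (rule that[of "\<lambda>m. bump (q m) 1 0"])
    show "smooth_on (bump (q m) 1 0) UNIV" for m by (rule smooth_on_bump)
    have neg: "(t - a) * (b - t) \<le> 0" if "t \<notin> {a<..<b}" for t
      using that assms by (auto simp: mult_le_0_iff not_less)
    have out: "bump (q m) 1 0 t = 0" if "t \<notin> {a<..<b}" for m t
      using mult_nonneg_nonpos[OF _ neg[OF that], of "real m"] by (simp add: bump_def q not_less)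
    then show "bump (q m) 1 0 t = 0" if "t \<notin> {a..b}" for m t using that by auto
    show "\<bar>bump (q m) 1 0 t\<bar> \<le> 1" for m t by (simp add: bump_def)
    show "(\<lambda>m. bump (q m) 1 0 t) \<longlonglongrightarrow> indicator {a<..<b} t" for t
    proof (cases "t \<in> {a<..<b}")
      case True
      define d where "d = (t - a) * (b - t)"
      have d: "0 < d" using True by (simp add: d_def)
      have qd: "poly (q m) t = real m * d" for m by (simp add: q d_def)
      have "(\<lambda>m. exp (- (1 / d * (1 / real m)))) \<longlonglongrightarrow> exp (- (1 / d * 0))"
        by (intro tendsto_intros lim_1_over_n)
      moreover have "\<forall>\<^sub>F m in sequentially. exp (- (1 / d * (1 / real m))) = bump (q m) 1 0 t"
        using eventually_gt_at_top[of 0] by eventually_elim (use d in \<open>simp add: bump_def qd mult.commute\<close>)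
      ultimately show ?thesis using True by (simp add: tendsto_cong)
    next
      case False
      then show ?thesis by (simp add: out)
    qed
  qed
qed

section \<open>Functions of time\<close>

lemma borel_measurable_lebesgue_AE_eq:
  fixes f g :: "'a::euclidean_space \<Rightarrow> 'b::topological_space"
  assumes f: "f \<in> borel_measurable lebesgue" and eq: "AE t in lebesgue. f t = g t"
  shows "g \<in> borel_measurable lebesgue"
proof (rule measurableI)
  fix B :: "'b set" assume B: "B \<in> sets borel"
  have "f -` B \<in> sets lebesgue" using measurable_sets[OF f B] by simp
  moreover have "AE t in lebesgue. t \<in> f -` B \<longleftrightarrow> t \<in> g -` B" using eq by eventually_elim simp
  ultimately show "g -` B \<inter> space lebesgue \<in> sets lebesgue"
    using completion.in_sets_AE[where A="f -` B" and B="g -` B"] by simp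
qed simp

text \<open>On an approximating simple function, \<open>H\<close> takes finitely many values on
  measurable sets; sequential continuity of \<open>H\<close> passes to the limit.\<close>

lemma strongly_measurable_compose:
  fixes H :: "'f::minus \<Rightarrow> 'b::{banach, second_countable_topology}"
  assumes g: "strongly_measurable I V N g" and I: "I \<in> sets lebesgue"
    and H: "\<And>w v. (\<And>k. w k \<in> V) \<Longrightarrow> v \<in> V \<Longrightarrow> (\<lambda>k. N (w k - v)) \<longlonglongrightarrow> 0 \<Longrightarrow> (\<lambda>k. H (w k)) \<longlonglongrightarrow> H v"
  shows "set_borel_measurable lebesgue I (\<lambda>t. H (g t))"
proof -
  obtain \<sigma> :: "nat \<Rightarrow> real \<Rightarrow> 'f" where fin: "\<And>k. finite (\<sigma> k ` I)" and V: "\<And>k t. t \<in> I \<Longrightarrow> \<sigma> k t \<in> V"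
    and meas: "\<And>k w. {t \<in> I. \<sigma> k t = w} \<in> sets lebesgue"
    and lim: "AE t in lebesgue. t \<in> I \<longrightarrow> g t \<in> V \<and> (\<lambda>k. N (\<sigma> k t - g t)) \<longlonglongrightarrow> 0"
    using g unfolding strongly_measurable_def by (auto simp: image_subset_iff)
  define h where "h k t = indicator I t *\<^sub>R H (\<sigma> k t)" for k t
  have [measurable]: "h k \<in> borel_measurable lebesgue" for k
  proof -
    have "h k t = (\<Sum>w\<in>\<sigma> k ` I. indicator {t \<in> I. \<sigma> k t = w} t *\<^sub>R H w)" for t
    proof (cases "t \<in> I")
      case True
      then have "(\<Sum>w\<in>\<sigma> k ` I. indicator {t \<in> I. \<sigma> k t = w} t *\<^sub>R H w)
          = (\<Sum>w\<in>\<sigma> k ` I. if w = \<sigma> k t then H w else 0)"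
        by (intro sum.cong) (auto simp: indicator_def)
      then show ?thesis using True fin by (simp add: h_def)
    qed (simp add: h_def)
    moreover have "(\<lambda>t. \<Sum>w\<in>\<sigma> k ` I. indicator {t \<in> I. \<sigma> k t = w} t *\<^sub>R H w) \<in> borel_measurable lebesgue"
      using meas by (intro borel_measurable_sum borel_measurable_scaleR borel_measurable_indicator) auto
    ultimately show ?thesis by (simp add: fun_eq_iff cong: measurable_cong)
  qed
  have hlim: "AE t in lebesgue. (\<lambda>k. h k t) \<longlonglongrightarrow> indicator I t *\<^sub>R H (g t)"
    using lim
  proof eventually_elim
    case (elim t)
    show ?case
    proof (cases "t \<in> I")
      case True
      then show ?thesis using elim H[of "\<lambda>k. \<sigma> k t" "g t"] V by (simp add: h_def)
    qed (simp add: h_def)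
  qed
  have "(\<lambda>t. lim (\<lambda>k. h k t)) \<in> borel_measurable lebesgue" by (rule borel_measurable_lim_metric) measurable
  moreover have "AE t in lebesgue. lim (\<lambda>k. h k t) = indicator I t *\<^sub>R H (g t)"
    using hlim by eventually_elim (rule limI)
  ultimately show ?thesis unfolding set_borel_measurable_def by (rule borel_measurable_lebesgue_AE_eq)
qed

text \<open>The approximating simple functions have countable range, so a countable family of balls
  captures all exceptional times.\<close>

lemma strongly_measurable_AE_essential:
  fixes g :: "real \<Rightarrow> 'f::minus"
  assumes g: "strongly_measurable I V N g" and S: "S \<subseteq> I"
    and tri: "\<And>a b c. a \<in> V \<Longrightarrow> b \<in> V \<Longrightarrow> c \<in> V \<Longrightarrow> N (a - b) \<le> N (c - a) + N (c - b)"
    and N0: "\<And>a. 0 \<le> N a"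
  shows "AE t in lebesgue. t \<in> S \<longrightarrow> g t \<in> V \<and>
    (\<forall>e>0. \<not> (AE r in lebesgue. \<not> (r \<in> S \<and> g r \<in> V \<and> N (g r - g t) < e)))"
proof -
  obtain \<sigma> :: "nat \<Rightarrow> real \<Rightarrow> 'f" where fin: "\<And>k. finite (\<sigma> k ` I)" and V: "\<And>k t. t \<in> I \<Longrightarrow> \<sigma> k t \<in> V"
    and lim: "AE t in lebesgue. t \<in> I \<longrightarrow> g t \<in> V \<and> (\<lambda>k. N (\<sigma> k t - g t)) \<longlonglongrightarrow> 0"
    using g unfolding strongly_measurable_def by (auto simp: image_subset_iff)
  define D where "D = (\<Union>k. \<sigma> k ` I)"
  \<comment> \<open>The times of \<open>S\<close> whose value lies within 1 / (m + 1) of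
    \<open>d\<close>; \<open>E\<close> indexes the null ones among these sets.\<close>
  define W where "W d m = {t \<in> S. g t \<in> V \<and> N (d - g t) < 1 / real (Suc m)}" for d m
  define E where "E = {(d, m). d \<in> D \<and> (AE t in lebesgue. t \<notin> W d m)}"
  have "countable D" unfolding D_def using fin by (intro countable_UN) (auto intro: countable_finite)
  then have "countable (D \<times> (UNIV :: nat set))" by simp
  then have E: "countable E" by (rule countable_subset[rotated]) (auto simp: E_def)
  have "AE t in lebesgue. \<forall>x\<in>E. t \<notin> W (fst x) (snd x)"
    unfolding AE_ball_countable[OF E] by (auto simp: E_def)
  with lim show ?thesis
  proof eventually_elim
    case (elim t)
    show ?case
    proof (intro impI conjI allI notI)
      assume t: "t \<in> S"
      then show gt: "g t \<in> V" using elim S by auto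
      fix e :: real assume e: "0 < e"
        and null: "AE r in lebesgue. \<not> (r \<in> S \<and> g r \<in> V \<and> N (g r - g t) < e)"
      obtain m where m: "1 / real (Suc m) < e / 2" using e nat_approx_posE half_gt_zero by metis
      have "(\<lambda>k. N (\<sigma> k t - g t)) \<longlonglongrightarrow> 0" using elim t S by auto
      then have "\<forall>\<^sub>F k in sequentially. N (\<sigma> k t - g t) < 1 / real (Suc m)"
        by (rule order_tendstoD) simp
      then obtain k where k: "N (\<sigma> k t - g t) < 1 / real (Suc m)" by (auto simp: eventually_sequentially)
      have d: "\<sigma> k t \<in> D" "\<sigma> k t \<in> V" using t S V by (auto simp: D_def)
      \<comment> \<open>If \<open>u\<close>-type values near \<open>g t\<close> occurred on a null
        set only, the same would hold for the smaller ball around the approximant, which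
        nevertheless contains \<open>g t\<close>.\<close>
      have "AE r in lebesgue. r \<notin> W (\<sigma> k t) m"
        using null
      proof eventually_elim
        case (elim r)
        show ?case
        proof
          assume r: "r \<in> W (\<sigma> k t) m"
          then have "N (g r - g t) \<le> N (\<sigma> k t - g r) + N (\<sigma> k t - g t)"
            using gt d by (intro tri) (auto simp: W_def)
          also have "\<dots> < e" using r k m by (simp add: W_def)
          finally show False using elim r by (auto simp: W_def)
        qed
      qed
      then have "(\<sigma> k t, m) \<in> E" using d by (simp add: E_def)
      then have "t \<notin> W (\<sigma> k t) m" using elim(2) by force
      then show False using t gt k by (simp add: W_def)
    qed
  qed
qed

text \<open>Lebesgue differentiation: almost every value is the limit of averages over intervals to
  the right, and these are all 0.\<close>

lemma AE_zero_if_interval_integrals_zero: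
  fixes g :: "real \<Rightarrow> 'a::euclidean_space"
  assumes int: "\<And>a b. 0 < a \<Longrightarrow> a < b \<Longrightarrow> set_integrable lebesgue {a..b} g"
    and zero: "\<And>a b. 0 < a \<Longrightarrow> a < b \<Longrightarrow> (LINT t:{a..b}|lebesgue. g t) = 0"
  shows "AE t in lebesgue. 0 < t \<longrightarrow> g t = 0"
proof -
  have "AE t in lebesgue. 1 / real (Suc m) < t \<longrightarrow> g t = 0" for m
  proof -
    define \<delta> where "\<delta> = 1 / real (Suc m)"
    have \<delta>: "0 < \<delta>" by (simp add: \<delta>_def)
    \<comment> \<open>Integrability is assumed away from 0; the cut-off at \<delta> makes the
      function integrable on every interval.\<close>
    define h where "h t = (if t \<in> {\<delta>..} then g t else 0)" for t
    have "h integrable_on cbox a b" for a b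
    proof -
      have "set_integrable lebesgue {\<delta>..max b (\<delta> + 1)} g" using \<delta> by (intro int) auto
      then have "g integrable_on {\<delta>..max b (\<delta> + 1)}" by (rule set_lebesgue_integral_eq_integral)
      then have "g integrable_on {max a \<delta>..b}"
        by (rule integrable_on_subinterval) auto
      also have "{max a \<delta>..b} = {\<delta>..} \<inter> cbox a b" by auto
      finally show ?thesis unfolding h_def by (subst integrable_restrict_Int)
    qed
    then obtain N where N: "negligible N"
      "\<And>x e. \<lbrakk>x \<notin> N; 0 < e\<rbrakk> \<Longrightarrow> \<exists>d>0. \<forall>r. 0 < r \<and> r < d \<longrightarrow>
          norm (integral (cbox x (x + r *\<^sub>R One)) h /\<^sub>R r ^ DIM(real) - h x) < e"
      using integrable_ccontinuous_explicit[of h] by blast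
    have "AE t in lebesgue. t \<notin> N" using N(1) by (intro AE_not_in) (simp add: negligible_iff_null_sets)
    then show ?thesis
    proof eventually_elim
      case (elim t)
      show ?case
      proof (intro impI, rule ccontr)
        assume t: "1 / real (Suc m) < t" and nz: "g t \<noteq> 0"
        then obtain d where d: "0 < d" "\<And>r. 0 < r \<Longrightarrow> r < d \<Longrightarrow>
            norm (integral (cbox t (t + r *\<^sub>R One)) h /\<^sub>R r ^ DIM(real) - h t) < norm (g t)"
          using N(2)[OF elim, of "norm (g t)"] by auto
        define r where "r = d / 2"
        have r: "0 < r" "r < d" using d by (auto simp: r_def)
        have t0: "0 < t" using t \<delta> unfolding \<delta>_def by linarith
        have "integral {t..t + r} h = integral {t..t + r} g"
          using t by (intro integral_cong) (auto simp: h_def \<delta>_def)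
        also have "\<dots> = (LINT t:{t..t + r}|lebesgue. g t)"
          using t0 r by (intro set_lebesgue_integral_eq_integral(2)[symmetric] int) auto
        also have "\<dots> = 0" using t0 r by (intro zero) auto
        finally have "norm (h t) < norm (g t)" using d(2)[OF r] by simp
        then show False using t by (simp add: h_def \<delta>_def)
      qed
    qed
  qed
  then have "AE t in lebesgue. \<forall>m. 1 / real (Suc m) < t \<longrightarrow> g t = 0"
    unfolding AE_all_countable by blast
  then show ?thesis
  proof eventually_elim
    case (elim t)
    show ?case
    proof
      assume "0 < t"
      then obtain m where "1 / real (Suc m) < t" using nat_approx_posE by blast
      then show "g t = 0" using elim by blast
    qed
  qed
qed

text \<open>Test functions approximating the indicator of an open interval carry the identity over
  to interval integrals by dominated convergence; the endpoints are null.\<close>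

lemma AE_eq_if_test_integrals_eq:
  fixes c d :: "real \<Rightarrow> complex"
  assumes int: "\<And>a b. 0 < a \<Longrightarrow> a < b \<Longrightarrow> set_integrable lebesgue {a..b} c"
      "\<And>a b. 0 < a \<Longrightarrow> a < b \<Longrightarrow> set_integrable lebesgue {a..b} d"
    and eq: "\<And>\<psi> :: real \<Rightarrow> real. smooth_on \<psi> UNIV \<Longrightarrow> (\<exists>a b. 0 < a \<and> (\<forall>t. t \<notin> {a..b} \<longrightarrow> \<psi> t = 0)) \<Longrightarrow>
      (LINT t:{0<..}|lebesgue. of_real (\<psi> t) * c t) = (LINT t:{0<..}|lebesgue. of_real (\<psi> t) * d t)"
  shows "AE t in lebesgue. 0 < t \<longrightarrow> c t = d t"
proof -
  have "AE t in lebesgue. 0 < t \<longrightarrow> c t - d t = 0"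
  proof (rule AE_zero_if_interval_integrals_zero)
    fix a b :: real assume ab: "0 < a" "a < b"
    show int_cd: "set_integrable lebesgue {a..b} (\<lambda>t. c t - d t)"
      using int ab by (intro set_integral_diff(1)) auto
    obtain \<psi> :: "nat \<Rightarrow> real \<Rightarrow> real" where \<psi>: "\<And>m. smooth_on (\<psi> m) UNIV" "\<And>m t. t \<notin> {a..b} \<Longrightarrow> \<psi> m t = 0"
      "\<And>m t. \<bar>\<psi> m t\<bar> \<le> 1" "\<And>t. (\<lambda>m. \<psi> m t) \<longlonglongrightarrow> indicator {a<..<b} t"
      using test_function_approx[OF ab(2)] by blast
    have cont: "\<psi> m \<in> borel_measurable lebesgue" for m
    proof -
      have "continuous_on UNIV (\<psi> m)" using \<psi>(1)[of m] unfolding smooth_on_def by (metis Ck_on.simps(1))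
      then show ?thesis by (intro measurable_completion) (simp add: borel_measurable_continuous_onI)
    qed
    have lim: "(\<lambda>m. \<integral>t. \<psi> m t *\<^sub>R (indicator {a..b} t *\<^sub>R h t) \<partial>lebesgue)
        \<longlonglongrightarrow> (\<integral>t. indicator {a<..<b} t *\<^sub>R (indicator {a..b} t *\<^sub>R h t) \<partial>lebesgue)"
      if h: "set_integrable lebesgue {a..b} h" for h :: "real \<Rightarrow> complex"
    proof (rule integral_dominated_convergence[where w="\<lambda>t. cmod (indicator {a..b} t *\<^sub>R h t)"])
      have h': "integrable lebesgue (\<lambda>t. indicator {a..b} t *\<^sub>R h t)" using h by (simp add: set_integrable_def)
      note hm = borel_measurable_integrable[OF h']
      show "(\<lambda>t. indicator {a<..<b} t *\<^sub>R (indicator {a..b} t *\<^sub>R h t)) \<in> borel_measurable lebesgue"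
        by (intro borel_measurable_scaleR hm borel_measurable_indicator) auto
      show "(\<lambda>t. \<psi> m t *\<^sub>R (indicator {a..b} t *\<^sub>R h t)) \<in> borel_measurable lebesgue" for m
        by (intro borel_measurable_scaleR hm cont)
      show "integrable lebesgue (\<lambda>t. cmod (indicator {a..b} t *\<^sub>R h t))" using h' by (rule integrable_norm)
      show "AE t in lebesgue. (\<lambda>m. \<psi> m t *\<^sub>R (indicator {a..b} t *\<^sub>R h t))
          \<longlonglongrightarrow> indicator {a<..<b} t *\<^sub>R (indicator {a..b} t *\<^sub>R h t)"
        by (intro AE_I2 tendsto_intros \<psi>)
      show "AE t in lebesgue. norm (\<psi> m t *\<^sub>R (indicator {a..b} t *\<^sub>R h t)) \<le> cmod (indicator {a..b} t *\<^sub>R h t)" for m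
        unfolding norm_scaleR using \<psi>(3) by (intro AE_I2 mult_left_le_one_le) auto
    qed
    have rew: "(LINT t:{0<..}|lebesgue. of_real (\<psi> m t) * h t) = (\<integral>t. \<psi> m t *\<^sub>R (indicator {a..b} t *\<^sub>R h t) \<partial>lebesgue)"
      for m and h :: "real \<Rightarrow> complex"
      unfolding set_lebesgue_integral_def
    proof (rule Bochner_Integration.integral_cong[OF refl])
      fix t
      show "indicator {0<..} t *\<^sub>R (of_real (\<psi> m t) * h t) = \<psi> m t *\<^sub>R (indicator {a..b} t *\<^sub>R h t)"
        using \<psi>(2)[of t m] ab by (cases "t \<in> {a..b}") (auto simp: indicator_def scaleR_conv_of_real)
    qed
    have "\<exists>a b. 0 < a \<and> (\<forall>t. t \<notin> {a..b} \<longrightarrow> \<psi> m t = 0)" for m using ab \<psi>(2) by blast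
    from eq[OF \<psi>(1) this]
    have "(\<integral>t. \<psi> m t *\<^sub>R (indicator {a..b} t *\<^sub>R c t) \<partial>lebesgue)
        = (\<integral>t. \<psi> m t *\<^sub>R (indicator {a..b} t *\<^sub>R d t) \<partial>lebesgue)" for m
      unfolding rew .
    then have eq': "(\<integral>t. indicator {a<..<b} t *\<^sub>R (indicator {a..b} t *\<^sub>R c t) \<partial>lebesgue)
        = (\<integral>t. indicator {a<..<b} t *\<^sub>R (indicator {a..b} t *\<^sub>R d t) \<partial>lebesgue)"
      using LIMSEQ_unique[OF lim[OF int(1)[OF ab]]] lim[OF int(2)[OF ab]] by simp
    have ends: "(\<integral>t. indicator {a<..<b} t *\<^sub>R (indicator {a..b} t *\<^sub>R h t) \<partial>lebesgue) = (LINT t:{a..b}|lebesgue. h t)"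
      if h: "set_integrable lebesgue {a..b} h" for h :: "real \<Rightarrow> complex"
      unfolding set_lebesgue_integral_def
    proof (rule integral_cong_AE)
      have h': "(\<lambda>t. indicator {a..b} t *\<^sub>R h t) \<in> borel_measurable lebesgue"
        using h by (simp add: set_integrable_def)
      then show "(\<lambda>t. indicator {a..b} t *\<^sub>R h t) \<in> borel_measurable lebesgue" .
      show "(\<lambda>t. indicator {a<..<b} t *\<^sub>R (indicator {a..b} t *\<^sub>R h t)) \<in> borel_measurable lebesgue"
        by (intro borel_measurable_scaleR h' borel_measurable_indicator) auto
      have "{a, b} \<in> null_sets lebesgue" by (simp add: negligible_iff_null_sets[symmetric])
      from AE_not_in[OF this]
      show "AE t in lebesgue. indicator {a<..<b} t *\<^sub>R (indicator {a..b} t *\<^sub>R h t) = indicator {a..b} t *\<^sub>R h t"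
        by eventually_elim (auto simp: indicator_def)
    qed
    show "(LINT t:{a..b}|lebesgue. c t - d t) = 0"
      using eq' unfolding ends[OF int(1)[OF ab]] ends[OF int(2)[OF ab]]
      by (simp add: set_integral_diff int ab)
  qed
  then show ?thesis by eventually_elim simp
qed

section \<open>The evolution equation at almost every time\<close>

text \<open>Extension by zero, so that \<open>L2\<close> over a set becomes square integrability on
  the whole space.\<close>

definition restr :: "'a set \<Rightarrow> ('a \<Rightarrow> complex) \<Rightarrow> 'a \<Rightarrow> complex" where
  "restr U w x = indicator U x *\<^sub>R w x"

lemma norm_restr_sq: "(cmod (restr U w x))\<^sup>2 = indicator U x *\<^sub>R (cmod (w x))\<^sup>2"
  by (simp add: restr_def indicator_def)

lemma L2_iff: "w \<in> L2 U \<longleftrightarrow> sq_integrable lebesgue (restr U w)"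
  unfolding L2_def sq_integrable_def norm_restr_sq set_integrable_def set_borel_measurable_def
  by (simp add: restr_def[abs_def])

lemma L2_norm_eq: "L2_norm U w = l2norm lebesgue (restr U w)"
  by (simp add: L2_norm_def l2norm_def norm_restr_sq set_lebesgue_integral_def)

lemma L2_norm_nonneg: "0 \<le> L2_norm U w"
  by (simp add: L2_norm_eq)

lemma restr_diff: "restr U (w - v) = (\<lambda>x. restr U w x - restr U v x)"
  by (simp add: restr_def fun_eq_iff scaleR_diff_right)

abbreviation pairing :: "(real^'n) set \<Rightarrow> (real^'n \<Rightarrow> complex) \<Rightarrow> (real^'n \<Rightarrow> complex) \<Rightarrow> complex" where
  "pairing U w h \<equiv> LINT x:U|lebesgue. w x * cnj (h x)"

lemma L2_pairing_eq:
  "pairing U w h = l2inner lebesgue (restr U w) (restr U h)"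
proof -
  have "indicator U x *\<^sub>R (w x * cnj (h x)) = restr U w x * cnj (restr U h x)" for x
    by (simp add: restr_def indicator_def)
  then show ?thesis by (simp add: set_lebesgue_integral_def l2inner_def)
qed

lemma norm_L2_pairing_le:
  assumes "w \<in> L2 U" "h \<in> L2 U"
  shows "cmod (pairing U w h) \<le> L2_norm U w * L2_norm U h"
  using assms unfolding L2_pairing_eq L2_norm_eq L2_iff by (rule norm_l2inner_le)

lemma strongly_measurable_AE_mem:
  "strongly_measurable I V N g \<Longrightarrow> AE t in lebesgue. t \<in> I \<longrightarrow> g t \<in> V"
  unfolding strongly_measurable_def by (auto elim: eventually_mono)

text \<open>Pairing with \<open>h\<close> is continuous in the L2 seminorm, which gives
  measurability. On a set of finite measure, a <= 1 + a^2 reduces integrability to square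
  integrability in time.\<close>

lemma L2_pairing_integrable:
  fixes U :: "(real^'n) set"
  assumes w: "w \<in> L2_time I (L2 U) (L2_norm U)" and h: "h \<in> L2 U"
    and I: "I \<in> sets lebesgue" and J: "J \<in> sets lebesgue" "J \<subseteq> I" "emeasure lebesgue J < \<infinity>"
  shows "set_integrable lebesgue J (\<lambda>t. pairing U (w t) h)"
proof -
  have sm: "strongly_measurable I (L2 U) (L2_norm U) w"
    and sq: "set_integrable lebesgue I (\<lambda>t. (L2_norm U (w t))\<^sup>2)"
    using w by (auto simp: L2_time_def)
  let ?c = "\<lambda>t. pairing U (w t) h"
  have "set_borel_measurable lebesgue I ?c"
  proof (rule strongly_measurable_compose[OF sm I])
    fix v :: "nat \<Rightarrow> real^'n \<Rightarrow> complex" and v'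
    assume v: "\<And>k. v k \<in> L2 U" "v' \<in> L2 U" and lim: "(\<lambda>k. L2_norm U (v k - v')) \<longlonglongrightarrow> 0"
    have "norm (pairing U (v k) h - pairing U v' h)
        \<le> L2_norm U (v k - v') * L2_norm U h" for k
    proof -
      have "v k - v' \<in> L2 U"
        using v(1)[of k] v(2) unfolding L2_iff restr_diff by (rule sq_integrable_diff)
      from norm_L2_pairing_le[OF this h] show ?thesis
        using v(1)[of k] v(2) h unfolding L2_pairing_eq restr_diff L2_iff by (simp add: l2inner_diff_left)
    qed
    then have "(\<lambda>k. pairing U (v k) h - pairing U v' h) \<longlonglongrightarrow> 0"
      by (intro Lim_null_comparison[OF always_eventually tendsto_mult_left_zero[OF lim]] allI)
    then show "(\<lambda>k. pairing U (v k) h) \<longlonglongrightarrow> pairing U v' h"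
      by (rule LIM_zero_cancel)
  qed
  then have meas: "set_borel_measurable lebesgue J ?c"
    using J(1,2) by (rule set_borel_measurable_subset)
  show ?thesis
    unfolding set_integrable_def
  proof (rule Bochner_Integration.integrable_bound)
    have "set_integrable lebesgue J (\<lambda>t. (L2_norm U (w t))\<^sup>2)"
      using J by (intro set_integrable_subset[OF sq]) auto
    moreover have "integrable lebesgue (indicator J :: real \<Rightarrow> real)"
      using J by (intro integrable_real_indicator) auto
    ultimately show "integrable lebesgue (\<lambda>t. (indicator J t + indicator J t *\<^sub>R (L2_norm U (w t))\<^sup>2) * L2_norm U h)"
      unfolding set_integrable_def by (intro integrable_mult_left Bochner_Integration.integrable_add)
    show "(\<lambda>t. indicator J t *\<^sub>R ?c t) \<in> borel_measurable lebesgue"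
      using meas by (simp add: set_borel_measurable_def)
    show "AE t in lebesgue. norm (indicator J t *\<^sub>R ?c t)
      \<le> norm ((indicator J t + indicator J t *\<^sub>R (L2_norm U (w t))\<^sup>2) * L2_norm U h)"
      using strongly_measurable_AE_mem[OF sm]
    proof eventually_elim
      case (elim t)
      show ?case
      proof (cases "t \<in> J")
        case True
        let ?a = "L2_norm U (w t)"
        have "cmod (?c t) \<le> ?a * L2_norm U h" using elim True J by (intro norm_L2_pairing_le h) auto
        also have "\<dots> \<le> (1 + ?a\<^sup>2) * L2_norm U h"
        proof (intro mult_right_mono L2_norm_nonneg)
          have "0 \<le> (?a - 1)\<^sup>2" "0 \<le> ?a\<^sup>2" by simp_all
          moreover have "(?a - 1)\<^sup>2 = ?a\<^sup>2 + 1 - 2 * ?a" by (simp add: power2_diff)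
          ultimately show "?a \<le> 1 + ?a\<^sup>2" by linarith
        qed
        finally show ?thesis using True by (simp add: L2_norm_nonneg)
      qed simp
    qed
  qed
qed

text \<open>\<open>solution_on\<close> provides its derivative by an existential, so a priori the
  derivative varies with the final time. The distributional identity makes all choices agree against
  a given \<open>h\<close>, outside a null set depending on \<open>h\<close>.\<close>

lemma time_derivative_unique:
  assumes w: "w \<in> L2_time {0<..} (L2 \<Omega>) (L2_norm \<Omega>)" "v \<in> L2_time {0<..} (L2 \<Omega>) (L2_norm \<Omega>)"
    and d: "has_time_derivative \<Omega> u w" "has_time_derivative \<Omega> u v" and h: "h \<in> L2 \<Omega>"
  shows "AE t in lebesgue. 0 < t \<longrightarrow>
    pairing \<Omega> (w t) h = pairing \<Omega> (v t) h"
proof (rule AE_eq_if_test_integrals_eq)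
  show "set_integrable lebesgue {a..b} (\<lambda>t. pairing \<Omega> (w t) h)" if "0 < a" "a < b" for a b :: real
    using that by (intro L2_pairing_integrable[OF w(1) h]) auto
  show "set_integrable lebesgue {a..b} (\<lambda>t. pairing \<Omega> (v t) h)" if "0 < a" "a < b" for a b :: real
    using that by (intro L2_pairing_integrable[OF w(2) h]) auto
  fix \<psi> :: "real \<Rightarrow> real"
  assume "smooth_on \<psi> UNIV" "\<exists>a b. 0 < a \<and> (\<forall>t. t \<notin> {a..b} \<longrightarrow> \<psi> t = 0)"
  then have \<psi>: "smooth_on \<psi> UNIV \<and> (\<exists>a b. 0 < a \<and> (\<forall>t. t \<notin> {a..b} \<longrightarrow> \<psi> t = 0))" by blast
  show "(LINT t:{0<..}|lebesgue. of_real (\<psi> t) * pairing \<Omega> (w t) h)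
      = (LINT t:{0<..}|lebesgue. of_real (\<psi> t) * pairing \<Omega> (v t) h)"
    using d(1)[unfolded has_time_derivative_def, rule_format, OF \<psi> h]
      d(2)[unfolded has_time_derivative_def, rule_format, OF \<psi> h] by simp
qed

text \<open>The weak identity lives on \<open>{0<..<S}\<close>; subtracting two instances reaches
  intervals away from 0.\<close>

lemma AE_zero_if_initial_integrals_zero:
  fixes g :: "real \<Rightarrow> 'a::euclidean_space"
  assumes int: "\<And>S. 0 < S \<Longrightarrow> set_integrable lebesgue {0<..<S} g"
    and zero: "\<And>S. 0 < S \<Longrightarrow> (LINT t:{0<..<S}|lebesgue. g t) = 0"
  shows "AE t in lebesgue. 0 < t \<longrightarrow> g t = 0"
proof (rule AE_zero_if_interval_integrals_zero)
  fix a b :: real assume ab: "0 < a" "a < b"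
  show i: "set_integrable lebesgue {a..b} g"
    using ab by (intro set_integrable_subset[OF int[of "b + 1"]]) auto
  have i': "set_integrable lebesgue {a..<b} g" using ab by (intro set_integrable_subset[OF i]) auto
  have "{0<..<b} = {0<..<a} \<union> {a..<b}" using ab by auto
  then have "(LINT t:{0<..<b}|lebesgue. g t) = (LINT t:{0<..<a}|lebesgue. g t) + (LINT t:{a..<b}|lebesgue. g t)"
    using ab i' by (simp only:) (subst set_integral_Un, auto intro: int)
  then have "(LINT t:{a..<b}|lebesgue. g t) = 0" using zero[of a] zero[of b] ab by simp
  moreover have "(LINT t:{a..b}|lebesgue. g t) = (LINT t:{a..<b}|lebesgue. g t)"
    unfolding set_lebesgue_integral_def
  proof (rule integral_cong_AE)
    show "(\<lambda>t. indicator {a..b} t *\<^sub>R g t) \<in> borel_measurable lebesgue"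
      "(\<lambda>t. indicator {a..<b} t *\<^sub>R g t) \<in> borel_measurable lebesgue"
      using i i' by (simp_all add: set_integrable_def)
    have "{b} \<in> null_sets lebesgue" by (simp add: negligible_iff_null_sets[symmetric])
    from AE_not_in[OF this] show "AE t in lebesgue. indicator {a..b} t *\<^sub>R g t = indicator {a..<b} t *\<^sub>R g t"
      by eventually_elim (auto simp: indicator_def)
  qed
  ultimately show "(LINT t:{a..b}|lebesgue. g t) = 0" by simp
qed

section \<open>Localizing the evolution equation in time\<close>

context kirchhoff
begin

lemma X_L2:
  assumes "\<phi> \<in> X"
  shows "\<phi> \<in> L2 \<Omega>" "L2_norm \<Omega> \<phi> = l2norm lebesgue \<phi>"
proof -
  have eq: "AE x in lebesgue. \<phi> x = restr \<Omega> \<phi> x"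
    using X_D(3)[OF assms] by eventually_elim (auto simp: restr_def indicator_def)
  have m: "\<phi> \<in> borel_measurable lebesgue" "restr \<Omega> \<phi> \<in> borel_measurable lebesgue"
    using X_D(4)[OF assms] borel_measurable_lebesgue_AE_eq[OF X_D(4)[OF assms] eq] by auto
  show "L2_norm \<Omega> \<phi> = l2norm lebesgue \<phi>"
    unfolding L2_norm_eq using l2norm_cong_AE[OF eq m] by simp
  have "integrable lebesgue (\<lambda>x. (cmod (restr \<Omega> \<phi> x))\<^sup>2)"
    by (rule integrable_cong_AE_imp[OF sq_integrableD(2)[OF X_D(1)[OF assms]]])
      (use m eq in \<open>auto elim!: eventually_mono\<close>)
  then show "\<phi> \<in> L2 \<Omega>" unfolding L2_iff sq_integrable_def using m by simp
qed

lemma bounded_reaction: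
  assumes \<phi>: "\<phi> \<in> X"
  obtains K where "\<And>w. w \<in> X \<Longrightarrow> Xnorm w \<le> B \<Longrightarrow> cmod (reaction w \<phi>) \<le> K"
proof -
  have p0: "0 < p" using p by simp
  obtain K where K: "\<And>w. w \<in> X \<Longrightarrow> Xnorm w \<le> B \<Longrightarrow>
    integrable lebesgue (\<lambda>x. cmod (w x) powr p) \<and> (\<integral>x. cmod (w x) powr p \<partial>lebesgue) \<le> K"
    using X_sobolev[OF p0 p(2)] by blast
  have pC: "0 < p * C" using p C by simp
  have i\<phi>: "integrable lebesgue (\<lambda>x. cmod (\<phi> x) powr p)" by (rule X_integrable_powr[OF \<phi> p0 p(2)])
  show ?thesis
  proof (rule that)
    fix w assume w: "w \<in> X" "Xnorm w \<le> B"
    let ?g = "\<lambda>x. indicator \<Omega> x *\<^sub>R (of_real (f (cmod (w x))) * w x * cnj (\<phi> x))"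
    have "cmod (reaction w \<phi>) \<le> (\<integral>x. cmod (?g x) \<partial>lebesgue)"
      unfolding reaction_def set_lebesgue_integral_def by (rule integral_norm_bound)
    also have "\<dots> \<le> (\<integral>x. p * C * (cmod (w x) powr p + cmod (\<phi> x) powr p) \<partial>lebesgue)"
    proof (rule integral_mono)
      show "integrable lebesgue (\<lambda>x. cmod (?g x))" by (intro integrable_norm integrable_reaction w \<phi>)
      show "integrable lebesgue (\<lambda>x. p * C * (cmod (w x) powr p + cmod (\<phi> x) powr p))"
        using K[OF w] i\<phi> by (intro integrable_mult_right Bochner_Integration.integrable_add) auto
      fix x
      have "cmod (?g x) \<le> cmod (of_real (f (cmod (w x))) * w x * cnj (\<phi> x))" by (simp add: indicator_def)
      also note reaction_integrand_bound
      finally show "cmod (?g x) \<le> p * C * (cmod (w x) powr p + cmod (\<phi> x) powr p)" .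
    qed
    also have "\<dots> \<le> p * C * (K + (\<integral>x. cmod (\<phi> x) powr p \<partial>lebesgue))"
      using K[OF w] i\<phi> pC by (simp add: mult_left_mono)
    finally show "cmod (reaction w \<phi>) \<le> p * C * (K + (\<integral>x. cmod (\<phi> x) powr p \<partial>lebesgue))" .
  qed
qed

text \<open>Continuity along convergent sequences gives measurability in time, and boundedness on
  balls turns the essential bound on \<open>u\<close> into one on \<open>H\<close>.\<close>

lemma time_integrable:
  fixes H :: "(real^'n \<Rightarrow> complex) \<Rightarrow> 'b::{banach, second_countable_topology}"
  assumes u: "u \<in> Linf_time {0<..} X Xnorm" and S: "S \<in> sets lebesgue" "S \<subseteq> {0<..}" "emeasure lebesgue S < \<infinity>"
    and H: "\<And>w v. (\<And>k. w k \<in> X) \<Longrightarrow> v \<in> X \<Longrightarrow> (\<lambda>k. Xnorm (w k - v)) \<longlonglongrightarrow> 0 \<Longrightarrow> (\<lambda>k. H (w k)) \<longlonglongrightarrow> H v"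
    and bd: "\<And>B. \<exists>K. \<forall>w\<in>X. Xnorm w \<le> B \<longrightarrow> norm (H w) \<le> K"
  shows "set_integrable lebesgue S (\<lambda>t. H (u t))"
proof -
  have sm: "strongly_measurable {0<..} X Xnorm u" using u by (simp add: Linf_time_def)
  obtain B where B: "AE t in lebesgue. t \<in> {0<..} \<longrightarrow> Xnorm (u t) \<le> B" using u by (auto simp: Linf_time_def)
  obtain K where K: "\<And>w. w \<in> X \<Longrightarrow> Xnorm w \<le> B \<Longrightarrow> norm (H w) \<le> K" using bd[of B] by blast
  have "set_borel_measurable lebesgue {0<..} (\<lambda>t. H (u t))"
    by (rule strongly_measurable_compose[OF sm _ H]) auto
  then have meas: "set_borel_measurable lebesgue S (\<lambda>t. H (u t))"
    using S(1,2) by (rule set_borel_measurable_subset)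
  show ?thesis
    unfolding set_integrable_def
  proof (rule Bochner_Integration.integrable_bound)
    show "integrable lebesgue (\<lambda>t. indicator S t * K)"
      using S by (intro integrable_mult_left integrable_real_indicator) auto
    show "(\<lambda>t. indicator S t *\<^sub>R H (u t)) \<in> borel_measurable lebesgue"
      using meas by (simp add: set_borel_measurable_def)
    show "AE t in lebesgue. norm (indicator S t *\<^sub>R H (u t)) \<le> norm (indicator S t * K)"
      using B strongly_measurable_AE_mem[OF sm]
    proof eventually_elim
      case (elim t)
      show ?case
      proof (cases "t \<in> S")
        case True
        then have "norm (H (u t)) \<le> K" using elim S by (intro K) auto
        then show ?thesis using True by simp
      qed simp
    qed
  qed
qed

text \<open>The integrated equation holds for every final time, so its integrand vanishes almost
  everywhere. The test function is fixed beforehand, and the exceptional set depends on it.\<close>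

lemma equation_AE:
  assumes sol: "\<forall>S>0. solution_on s A \<Omega> M f u\<^sub>0 S u"
    and w: "w \<in> L2_time {0<..} (L2 \<Omega>) (L2_norm \<Omega>)" "has_time_derivative \<Omega> u w"
    and \<phi>: "\<phi> \<in> X"
  shows "AE t in lebesgue. 0 < t \<longrightarrow>
    Re (pairing \<Omega> (w t) \<phi>) + J' (u t) \<phi> = 0"
proof -
  have u: "u \<in> Linf_time {0<..} X Xnorm" using sol[rule_format, of 1] by (simp add: solution_on_def)
  note \<phi>2 = X_L2(1)[OF \<phi>]
  define c where "c t = pairing \<Omega> (w t) \<phi>" for t
  define m where "m t = M ((Xnorm (u t))\<^sup>2) * X_inner s A (u t) \<phi>" for t
  define \<rho> where "\<rho> t = reaction (u t) \<phi>" for t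
  have ic: "set_integrable lebesgue {0<..<S} c" if "0 < S" for S
    unfolding c_def using that by (intro L2_pairing_integrable[OF w(1) \<phi>2]) auto
  have im: "set_integrable lebesgue {0<..<S} m" if "0 < S" for S
    unfolding m_def
  proof (rule time_integrable[OF u, where H="\<lambda>v. M ((Xnorm v)\<^sup>2) * X_inner s A v \<phi>"])
    show "(\<lambda>k. M ((Xnorm (v k))\<^sup>2) * X_inner s A (v k) \<phi>) \<longlonglongrightarrow> M ((Xnorm v')\<^sup>2) * X_inner s A v' \<phi>"
      if "\<And>k. v k \<in> X" "v' \<in> X" "(\<lambda>k. Xnorm (v k - v')) \<longlonglongrightarrow> 0" for v v'
      by (intro tendsto_mult M_tendsto Xnorm_tendsto X_inner_tendsto that \<phi>)
    fix B
    have "compact (M ` {0..B\<^sup>2})"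
      by (intro compact_continuous_image continuous_on_subset[OF M_cont]) auto
    then have "bounded (M ` {0..B\<^sup>2})" by (rule compact_imp_bounded)
    then obtain b where "\<forall>y\<in>M ` {0..B\<^sup>2}. norm y \<le> b" unfolding bounded_iff by blast
    then have b: "\<And>x. x \<in> {0..B\<^sup>2} \<Longrightarrow> norm (M x) \<le> b" by blast
    show "\<exists>K. \<forall>v\<in>X. Xnorm v \<le> B \<longrightarrow> norm (M ((Xnorm v)\<^sup>2) * X_inner s A v \<phi>) \<le> K"
    proof (intro exI ballI impI)
      fix v assume v: "v \<in> X" "Xnorm v \<le> B"
      have M: "\<bar>M ((Xnorm v)\<^sup>2)\<bar> \<le> b" using b[of "(Xnorm v)\<^sup>2"] v power_mono[OF v(2), of 2] by simp
      have "\<bar>X_inner s A v \<phi>\<bar> \<le> Xnorm v * Xnorm \<phi>" by (rule abs_X_inner_le[OF v(1) \<phi>])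
      also have "\<dots> \<le> B * Xnorm \<phi>" using v by (intro mult_right_mono) auto
      finally have "\<bar>M ((Xnorm v)\<^sup>2)\<bar> * \<bar>X_inner s A v \<phi>\<bar> \<le> b * (B * Xnorm \<phi>)"
        using M by (intro mult_mono) auto
      then show "norm (M ((Xnorm v)\<^sup>2) * X_inner s A v \<phi>) \<le> b * (B * Xnorm \<phi>)" by (simp add: abs_mult)
    qed
  qed (use that in auto)
  have i\<rho>: "set_integrable lebesgue {0<..<S} \<rho>" if "0 < S" for S
    unfolding \<rho>_def
  proof (rule time_integrable[OF u, where H="\<lambda>v. reaction v \<phi>"])
    show "\<exists>K. \<forall>v\<in>X. Xnorm v \<le> B \<longrightarrow> cmod (reaction v \<phi>) \<le> K" for B
      using bounded_reaction[OF \<phi>, of B] by metis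
  qed (use that in \<open>auto intro: reaction_tendsto \<phi>\<close>)
  have "AE t in lebesgue. 0 < t \<longrightarrow> Re (c t) + m t - Re (\<rho> t) = 0"
  proof (rule AE_zero_if_initial_integrals_zero)
    fix S :: real assume S: "0 < S"
    have iR: "set_integrable lebesgue {0<..<S} (\<lambda>t. Re (c t))" "set_integrable lebesgue {0<..<S} (\<lambda>t. Re (\<rho> t))"
      "(LINT t:{0<..<S}|lebesgue. Re (c t)) = Re (LINT t:{0<..<S}|lebesgue. c t)"
      "(LINT t:{0<..<S}|lebesgue. Re (\<rho> t)) = Re (LINT t:{0<..<S}|lebesgue. \<rho> t)"
      using integrable_Re[OF ic[OF S, unfolded set_integrable_def]] integrable_Re[OF i\<rho>[OF S, unfolded set_integrable_def]]
        integral_Re[OF ic[OF S, unfolded set_integrable_def]] integral_Re[OF i\<rho>[OF S, unfolded set_integrable_def]]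
      by (simp_all add: set_integrable_def set_lebesgue_integral_def)
    show "set_integrable lebesgue {0<..<S} (\<lambda>t. Re (c t) + m t - Re (\<rho> t))"
      using iR im[OF S] by (intro set_integral_add set_integral_diff)
    obtain v where v: "v \<in> L2_time {0<..} (L2 \<Omega>) (L2_norm \<Omega>)" "has_time_derivative \<Omega> u v"
      and eq: "Re (LINT t:{0<..<S}|lebesgue. pairing \<Omega> (v t) \<phi>)
           + (LINT t:{0<..<S}|lebesgue. M ((X_norm s A (u t))\<^sup>2) * X_inner s A (u t) \<phi>)
           - Re (LINT t:{0<..<S}|lebesgue. (LINT x:\<Omega>|lebesgue.
                   of_real (f (cmod (u t x))) * u t x * cnj (\<phi> x))) = 0"
      using sol[rule_format, OF S] \<phi> unfolding solution_on_def by blast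
    \<comment> \<open>The derivative attached to the final time \<open>S\<close> is exchanged for
      the fixed \<open>w\<close>.\<close>
    have "(LINT t:{0<..<S}|lebesgue. pairing \<Omega> (v t) \<phi>) = (LINT t:{0<..<S}|lebesgue. c t)"
      unfolding set_lebesgue_integral_def[of lebesgue "{0<..<S}"]
    proof (rule integral_cong_AE)
      have "set_integrable lebesgue {0<..<S} (\<lambda>t. pairing \<Omega> (v t) \<phi>)"
        using S by (intro L2_pairing_integrable[OF v(1) \<phi>2]) auto
      then show "(\<lambda>t. indicator {0<..<S} t *\<^sub>R pairing \<Omega> (v t) \<phi>) \<in> borel_measurable lebesgue"
        by (simp add: set_integrable_def)
      show "(\<lambda>t. indicator {0<..<S} t *\<^sub>R c t) \<in> borel_measurable lebesgue"
        using ic[OF S] by (simp add: set_integrable_def)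
      show "AE t in lebesgue. indicator {0<..<S} t *\<^sub>R pairing \<Omega> (v t) \<phi> = indicator {0<..<S} t *\<^sub>R c t"
        using time_derivative_unique[OF v(1) w(1) v(2) w(2) \<phi>2]
        by eventually_elim (auto simp: indicator_def c_def)
    qed
    then have eq': "Re (LINT t:{0<..<S}|lebesgue. c t) + (LINT t:{0<..<S}|lebesgue. m t)
        - Re (LINT t:{0<..<S}|lebesgue. \<rho> t) = 0"
      using eq unfolding m_def \<rho>_def reaction_def by simp
    have "(LINT t:{0<..<S}|lebesgue. Re (c t) + m t - Re (\<rho> t))
        = (LINT t:{0<..<S}|lebesgue. Re (c t) + m t) - (LINT t:{0<..<S}|lebesgue. Re (\<rho> t))"
      by (intro set_integral_diff set_integral_add iR im[OF S])
    also have "(LINT t:{0<..<S}|lebesgue. Re (c t) + m t)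
        = (LINT t:{0<..<S}|lebesgue. Re (c t)) + (LINT t:{0<..<S}|lebesgue. m t)"
      by (intro set_integral_add iR im[OF S])
    finally show "(LINT t:{0<..<S}|lebesgue. Re (c t) + m t - Re (\<rho> t)) = 0"
      using eq' unfolding iR(3,4) by simp
  qed
  then show ?thesis by eventually_elim (auto simp: c_def m_def \<rho>_def J_deriv_eq)
qed

text \<open>The order of choices matters: \<open>B\<close> and \<open>P\<close> precede
  \<open>T\<close> and \<epsilon>, and the time precedes the test function, as a Palais-Smale
  sequence demands. The recurrence of \<open>u\<close> near its value at that time makes the second
  order possible.\<close>

lemma almost_critical_time:
  assumes sol: "\<forall>S>0. solution_on s A \<Omega> M f u\<^sub>0 S u"
  obtains B P where "\<And>T \<epsilon>. 0 \<le> T \<Longrightarrow> 0 < \<epsilon> \<Longrightarrow> \<exists>t>T. u t \<in> X \<and> Xnorm (u t) \<le> B \<and>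
    (\<forall>\<phi>\<in>X. \<bar>J' (u t) \<phi>\<bar> \<le> \<epsilon> * P * Xnorm \<phi>)"
proof -
  have u: "u \<in> Linf_time {0<..} X Xnorm" using sol[rule_format, of 1] by (simp add: solution_on_def)
  then have sm: "strongly_measurable {0<..} X Xnorm u" by (simp add: Linf_time_def)
  obtain B where B: "AE t in lebesgue. t \<in> {0<..} \<longrightarrow> Xnorm (u t) \<le> B" using u by (auto simp: Linf_time_def)
  obtain w where w: "w \<in> L2_time {0<..} (L2 \<Omega>) (L2_norm \<Omega>)" "has_time_derivative \<Omega> u w"
    using sol[rule_format, of 1] by (auto simp: solution_on_def)
  have wm: "strongly_measurable {0<..} (L2 \<Omega>) (L2_norm \<Omega>) w"
    and w2: "set_integrable lebesgue {0<..} (\<lambda>t. (L2_norm \<Omega> (w t))\<^sup>2)"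
    using w(1) by (auto simp: L2_time_def)
  obtain P where P: "0 < P" "\<And>w. w \<in> X \<Longrightarrow> l2norm lebesgue w \<le> P * Xnorm w"
    using X_poincare by blast
  show ?thesis
  proof (rule that[of B P])
    fix T \<epsilon> :: real assume T: "0 \<le> T" and \<epsilon>: "0 < \<epsilon>"
    define S where "S = {t. T < t \<and> w t \<in> L2 \<Omega> \<and> L2_norm \<Omega> (w t) \<le> \<epsilon>}"
    \<comment> \<open>Otherwise the L2 norm of \<open>w\<close> would be at least \<epsilon> at
      almost all times beyond \<open>T\<close>, against square integrability.\<close>
    have notnull: "\<not> (AE t in lebesgue. t \<notin> S)"
    proof
      assume "AE t in lebesgue. t \<notin> S"
      with strongly_measurable_AE_mem[OF wm]
      have big: "AE t in lebesgue. T < t \<longrightarrow> \<epsilon>\<^sup>2 \<le> (L2_norm \<Omega> (w t))\<^sup>2"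
      proof eventually_elim
        case (elim t)
        show ?case
        proof
          assume "T < t"
          then have "\<epsilon> \<le> L2_norm \<Omega> (w t)" using elim T by (auto simp: S_def)
          then show "\<epsilon>\<^sup>2 \<le> (L2_norm \<Omega> (w t))\<^sup>2" using \<epsilon> by (intro power_mono) auto
        qed
      qed
      let ?I = "LINT t:{0<..}|lebesgue. (L2_norm \<Omega> (w t))\<^sup>2"
      have "\<epsilon>\<^sup>2 * real n \<le> ?I" for n
      proof -
        have "\<epsilon>\<^sup>2 * real n = (\<integral>t. indicator {T<..<T + real n} t * \<epsilon>\<^sup>2 \<partial>lebesgue)" by simp
        also have "\<dots> \<le> ?I"
          unfolding set_lebesgue_integral_def
        proof (rule integral_mono_AE)
          show "integrable lebesgue (\<lambda>t. indicator {T<..<T + real n} t * \<epsilon>\<^sup>2)"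
            by (intro integrable_mult_left integrable_real_indicator) auto
          show "integrable lebesgue (\<lambda>t. indicator {0<..} t *\<^sub>R (L2_norm \<Omega> (w t))\<^sup>2)"
            using w2 by (simp add: set_integrable_def)
          show "AE t in lebesgue. indicator {T<..<T + real n} t * \<epsilon>\<^sup>2 \<le> indicator {0<..} t *\<^sub>R (L2_norm \<Omega> (w t))\<^sup>2"
            using big by eventually_elim (use T in \<open>auto simp: indicator_def\<close>)
        qed
        finally show ?thesis .
      qed
      moreover obtain n where "?I / \<epsilon>\<^sup>2 < real n" using reals_Archimedean2 by blast
      ultimately show False using \<epsilon> by (simp add: field_simps) (meson not_less)
    qed
    have ess: "AE t in lebesgue. t \<in> S \<longrightarrow> u t \<in> X \<and>
      (\<forall>e>0. \<not> (AE r in lebesgue. \<not> (r \<in> S \<and> u r \<in> X \<and> Xnorm (u r - u t) < e)))"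
    proof (rule strongly_measurable_AE_essential[OF sm])
      show "S \<subseteq> {0<..}" using T by (auto simp: S_def)
      show "Xnorm (a - b) \<le> Xnorm (c - a) + Xnorm (c - b)" if "a \<in> X" "b \<in> X" "c \<in> X" for a b c
      proof -
        have "a - b = (c - b) - (c - a)" by (simp add: fun_eq_iff)
        then show ?thesis
          using Xnorm_diff_triangle[OF X_diff[OF that(3,2)] X_diff[OF that(3,1)]] by simp
      qed
    qed simp
    have "\<exists>t. t \<in> S \<and> Xnorm (u t) \<le> B \<and> u t \<in> X \<and>
      (\<forall>e>0. \<not> (AE r in lebesgue. \<not> (r \<in> S \<and> u r \<in> X \<and> Xnorm (u r - u t) < e)))"
    proof (rule ccontr)
      assume none: "\<not> ?thesis"
      have "AE t in lebesgue. t \<notin> S"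
        using ess B
      proof eventually_elim
        case (elim t)
        then show ?case using none T by (auto simp: S_def)
      qed
      with notnull show False by blast
    qed
    then obtain t where t: "t \<in> S" "Xnorm (u t) \<le> B" "u t \<in> X"
      and et: "\<And>e. 0 < e \<Longrightarrow> \<not> (AE r in lebesgue. \<not> (r \<in> S \<and> u r \<in> X \<and> Xnorm (u r - u t) < e))" by blast
    have "\<bar>J' (u t) \<phi>\<bar> \<le> \<epsilon> * P * Xnorm \<phi>" if \<phi>: "\<phi> \<in> X" for \<phi>
    proof -
      \<comment> \<open>The nearby times in \<open>S\<close> do not form a null set, so they meet
        the set of full measure where the equation holds for this \<phi>.\<close>
      have "\<exists>r. r \<in> S \<and> u r \<in> X \<and> Xnorm (u r - u t) < e \<and>
          Re (pairing \<Omega> (w r) \<phi>) + J' (u r) \<phi> = 0" if e: "0 < e" for e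
      proof (rule ccontr)
        assume none: "\<not> ?thesis"
        have "AE r in lebesgue. \<not> (r \<in> S \<and> u r \<in> X \<and> Xnorm (u r - u t) < e)"
          using equation_AE[OF sol w \<phi>]
        proof eventually_elim
          case (elim r)
          then show ?case using none T by (auto simp: S_def)
        qed
        with et[OF e] show False by blast
      qed
      then have "\<forall>k::nat. \<exists>r. r \<in> S \<and> u r \<in> X \<and> Xnorm (u r - u t) < 1 / real (Suc k) \<and>
          Re (pairing \<Omega> (w r) \<phi>) + J' (u r) \<phi> = 0" by simp
      then obtain r where "\<forall>k. r k \<in> S \<and> u (r k) \<in> X \<and> Xnorm (u (r k) - u t) < 1 / real (Suc k) \<and>
          Re (pairing \<Omega> (w (r k)) \<phi>) + J' (u (r k)) \<phi> = 0"
        unfolding choice_iff by (elim exE)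
      then have r: "\<And>k. r k \<in> S" "\<And>k. u (r k) \<in> X" "\<And>k. Xnorm (u (r k) - u t) < 1 / real (Suc k)"
        "\<And>k. Re (pairing \<Omega> (w (r k)) \<phi>) + J' (u (r k)) \<phi> = 0" by simp_all
      have "(\<lambda>k. Xnorm (u (r k) - u t)) \<longlonglongrightarrow> 0"
      proof (rule Lim_null_comparison)
        show "(\<lambda>k. 1 / real (Suc k)) \<longlonglongrightarrow> 0" using LIMSEQ_inverse_real_of_nat by (simp add: inverse_eq_divide)
        show "\<forall>\<^sub>F k in sequentially. norm (Xnorm (u (r k) - u t)) \<le> 1 / real (Suc k)"
          by (rule always_eventually) (use r(3) in \<open>simp add: less_imp_le\<close>)
      qed
      then have lim: "(\<lambda>k. J' (u (r k)) \<phi>) \<longlonglongrightarrow> J' (u t) \<phi>"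
        by (rule J_deriv_tendsto[OF r(2) t(3) \<phi>])
      \<comment> \<open>At the nearby times \<open>w\<close> is small because they belong to
        \<open>S\<close>; the bound does not depend on \<open>k\<close> and survives the
        limit.\<close>
      have "\<bar>J' (u (r k)) \<phi>\<bar> \<le> \<epsilon> * P * Xnorm \<phi>" for k
      proof -
        have wr: "w (r k) \<in> L2 \<Omega>" "L2_norm \<Omega> (w (r k)) \<le> \<epsilon>" using r(1)[of k] by (auto simp: S_def)
        have "\<bar>J' (u (r k)) \<phi>\<bar> = \<bar>Re (pairing \<Omega> (w (r k)) \<phi>)\<bar>"
          using r(4)[of k] by linarith
        also have "\<dots> \<le> cmod (pairing \<Omega> (w (r k)) \<phi>)" by (rule abs_Re_le_cmod)
        also have "\<dots> \<le> L2_norm \<Omega> (w (r k)) * L2_norm \<Omega> \<phi>" by (rule norm_L2_pairing_le[OF wr(1) X_L2(1)[OF \<phi>]])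
        also have "\<dots> \<le> \<epsilon> * (P * Xnorm \<phi>)"
          using wr(2) P(2)[OF \<phi>] \<epsilon> by (intro mult_mono) (auto simp: X_L2(2)[OF \<phi>])
        finally show ?thesis by (simp add: mult.assoc)
      qed
      then show ?thesis using LIMSEQ_le_const2[OF tendsto_rabs[OF lim]] by blast
    qed
    then show "\<exists>t>T. u t \<in> X \<and> Xnorm (u t) \<le> B \<and> (\<forall>\<phi>\<in>X. \<bar>J' (u t) \<phi>\<bar> \<le> \<epsilon> * P * Xnorm \<phi>)"
      using t by (intro exI[of _ t]) (auto simp: S_def)
  qed
qed

text \<open>Dependent choice makes the times increase, the n-th one lying beyond n and having a
  derivative of size at most P / (n + 1); passing to the Palais-Smale subsequence keeps monotonicity
  and divergence.\<close>

lemma convergence_to_stationary: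
  assumes sol: "\<forall>S>0. solution_on s A \<Omega> M f u\<^sub>0 S u"
  shows "\<exists>(t :: nat \<Rightarrow> real) v. strict_mono t \<and> (\<forall>k. t k \<ge> 0) \<and> filterlim t at_top sequentially \<and>
    stationary_solution s A \<Omega> M f v \<and> (\<lambda>k. X_norm s A (u (t k) - v)) \<longlonglongrightarrow> 0"
proof -
  obtain B P where good: "\<And>T \<epsilon>. 0 \<le> T \<Longrightarrow> 0 < \<epsilon> \<Longrightarrow> \<exists>t>T. u t \<in> X \<and> Xnorm (u t) \<le> B \<and>
    (\<forall>\<phi>\<in>X. \<bar>J' (u t) \<phi>\<bar> \<le> \<epsilon> * P * Xnorm \<phi>)"
    using almost_critical_time[OF sol] by blast
  define G where "G n t \<longleftrightarrow> real n < t \<and> u t \<in> X \<and> Xnorm (u t) \<le> B \<and>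
    (\<forall>\<phi>\<in>X. \<bar>J' (u t) \<phi>\<bar> \<le> 1 / real (Suc n) * P * Xnorm \<phi>)" for n t
  have "\<exists>t. \<forall>n. G n (t n) \<and> t n < t (Suc n)"
  proof (rule dependent_nat_choice)
    show "\<exists>t. G 0 t" using good[of 0 1] by (auto simp: G_def)
    fix x n assume "G n x"
    have "\<exists>t>max (real (Suc n)) x. u t \<in> X \<and> Xnorm (u t) \<le> B \<and>
      (\<forall>\<phi>\<in>X. \<bar>J' (u t) \<phi>\<bar> \<le> 1 / real (Suc (Suc n)) * P * Xnorm \<phi>)"
      by (rule good) auto
    then show "\<exists>y. G (Suc n) y \<and> x < y" unfolding G_def by auto
  qed
  then obtain t where t: "\<And>n. G n (t n)" "\<And>n. t n < t (Suc n)" by blast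
  have mono: "strict_mono t" using t(2) by (rule strict_monoI_Suc)
  have e: "(\<lambda>k. 1 / real (Suc k) * P) \<longlonglongrightarrow> 0"
    using tendsto_mult_left_zero[OF LIMSEQ_inverse_real_of_nat, of P] by (simp add: inverse_eq_divide)
  obtain r v where r: "strict_mono (r :: nat \<Rightarrow> nat)" and v: "stationary_solution s A \<Omega> M f v"
    and lim: "(\<lambda>k. Xnorm (u (t (r k)) - v)) \<longlonglongrightarrow> 0"
    by (rule palais_smale[OF _ _ e, of "\<lambda>k. u (t k)" B]) (use t(1) in \<open>auto simp: G_def\<close>)
  have ge: "real k \<le> t (r k)" for k
  proof -
    have "real k \<le> real (r k)" using seq_suble[OF r, of k] by simp
    also have "\<dots> < t (r k)" using t(1)[of "r k"] by (simp add: G_def)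
    finally show ?thesis by simp
  qed
  show ?thesis
  proof (intro exI conjI allI)
    show "strict_mono (t \<circ> r)" using mono r by (rule strict_mono_o)
    show "0 \<le> (t \<circ> r) k" for k using ge[of k] by (simp add: order_trans[of 0 "real k"])
    show "filterlim (t \<circ> r) at_top sequentially"
      by (rule filterlim_at_top_mono[OF filterlim_real_sequentially]) (use ge in auto)
    show "stationary_solution s A \<Omega> M f v" by (rule v)
    show "(\<lambda>k. X_norm s A (u ((t \<circ> r) k) - v)) \<longlonglongrightarrow> 0" using lim by simp
  qed
qed

end

theorem theorem3p1:
  fixes s p C \<gamma> m\<^sub>0 \<theta> \<mu> :: real
    and \<Omega> :: "(real^'n) set"
    and A :: "real^'n \<Rightarrow> real^'n"
    and f f' M :: "real \<Rightarrow> real"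
    and u\<^sub>0 :: "real^'n \<Rightarrow> complex"
    and u :: "real \<Rightarrow> real^'n \<Rightarrow> complex"
    and T :: ereal
  assumes "0 < s" "s < 1" "2 * s < real CARD('n)"
    and "bounded_smooth_domain \<Omega>"
    and "Linf_loc A"
    and "2 < p" "p < crit_exp CARD('n) s"
    and f_nonneg: "\<forall>\<sigma>\<ge>0. f \<sigma> \<ge> 0"
    and M_nonneg: "\<forall>\<sigma>\<ge>0. M \<sigma> \<ge> 0"
    and f_C1: "\<forall>\<sigma>\<ge>0. (f has_real_derivative f' \<sigma>) (at \<sigma> within {0..})"
              "continuous_on {0..} f'"
    and "C > 0" "\<gamma> \<ge> p"
    and f_growth: "\<forall>\<sigma>\<ge>0. \<bar>F_prim f \<sigma>\<bar> \<le> C * \<sigma> powr p"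
                  "\<forall>\<sigma>\<ge>0. f \<sigma> * \<sigma>\<^sup>2 \<le> p * C * \<sigma> powr p"
    and f_AR: "\<forall>\<sigma>>0. 0 < \<gamma> * F_prim f \<sigma> \<and> \<gamma> * F_prim f \<sigma> \<le> f \<sigma> * \<sigma>\<^sup>2"
    and f_mono: "\<forall>\<sigma>>0. \<sigma>\<^sup>2 * (\<sigma> * f' \<sigma> - (p - 2) * f \<sigma>) \<ge> 0"
    and M_cont: "continuous_on {0..} M"
    and "m\<^sub>0 > 0" "1 < \<theta>" "\<theta> < crit_exp CARD('n) s / 2"
    and M_lower: "\<forall>\<sigma>\<ge>0. M \<sigma> \<ge> m\<^sub>0 * \<sigma> powr (\<theta> - 1)"
    and "1 < \<mu>" "\<mu> < crit_exp CARD('n) s / 2"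
    and M_upper: "\<forall>\<sigma>\<ge>0. \<mu> * M_prim M \<sigma> \<ge> M \<sigma> * \<sigma>"
    and "2 * max \<theta> \<mu> < p"
    and u0: "u\<^sub>0 \<in> X0A s A \<Omega>"
            "ereal (J_fun s A \<Omega> M f u\<^sub>0) \<le> mp_level s A \<Omega> M f"
            "I_fun s A \<Omega> M f u\<^sub>0 > 0"
    and sol: "evolution_solution s A \<Omega> M f u\<^sub>0 T u"
    and max_time: "maximal_existence_time s A \<Omega> u T"
    and T_inf: "T = \<infinity>"
  shows "\<exists>(t :: nat \<Rightarrow> real) v.
           strict_mono t \<and> (\<forall>k. t k \<ge> 0) \<and> filterlim t at_top sequentially \<and>
           stationary_solution s A \<Omega> M f v \<and>
           (\<lambda>k. X_norm s A (u (t k) - v)) \<longlonglongrightarrow> 0"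
proof -
  interpret kirchhoff s A \<Omega> p C m\<^sub>0 \<theta> f M
  proof
    show "open \<Omega>" "bounded \<Omega>"
      using \<open>bounded_smooth_domain \<Omega>\<close> by (auto simp: bounded_smooth_domain_def)
    show "continuous_on {0..} f"
      unfolding continuous_on_eq_continuous_within
      using f_C1(1) by (auto intro: DERIV_continuous)
  qed (use assms in auto)
  have "global_solution s A \<Omega> M f u\<^sub>0 u"
    using sol T_inf by (auto simp: evolution_solution_def)
  then show ?thesis
    unfolding global_solution_def by (rule convergence_to_stationary)
qed

end
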